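(* Let $\mathcal{P}$ be a reliable graph property with $d(\mathcal{P})=r$, let $G$ be a connected graph, and let $(X,H)$ be a cover of $G$ such that $r|X_v|\ge d_G(v)$ for all $v\in V(G)$. If $G$ is not $(\mathcal{P},(X,H))$-colorable (that is, $(X,H)$ has no $\mathcal{P}$-transversal), then each block $B$ of $G$ is a brick, or $B=tB'$ with $t\in\mathbb{N}$ such that either $B'\in\mathrm{CR}(\mathcal{P})$ and $B'$ is $r$-regular, or $B'\in\mathcal{P}$ and $\Delta(B')\le r$.
   Context: $\mathbb{N}$ is the set of positive integers. Graphs are finite, undirected, may have multiple edges, no loops. $\mu_G(u,v)$ is the number of edges joining $u$ and $v$; $d_G(v)$ is the number of edges incident with $v$; $\Delta,\delta$ denote maximum and minimum degree. $K_n$ (complete graph) and $C_n$ ($n\ge 3$, cycle) are simple graphs. For $t\in\mathbb{N}$, $tG$ is the graph with vertex set $V(G)$ and $\mu_{tG}(u,v)=t\mu_G(u,v)$. A brick is a graph of the form $tK_n$ with $t,n\in\mathbb{N}$ or $tC_n$ with $t,n\in\mathbb{N}$, $n\ge 3$. A separating vertex of a connected graph is a vertex whose deletion leaves at least two components; a block of $G$ is a maximal connected subgraph that itself has no separating vertex ($K_1$ is allowed). Connected graphs are non-empty. A cover of $G$ is a pair $(X,H)$ where $H$ is a graph and $X$ assigns to each $v\in V(G)$ a set $X_v\subseteq V(H)$ such that the sets $X_v$ are pairwise disjoint, $V(H)=\bigcup_v X_v$, each $X_v$ is independent in $H$, and for distinct $u,v\in V(G)$ the set $E_H(X_u,X_v)$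 of edges of $H$ between $X_u$ and $X_v$ is the union of $\mu_G(u,v)$ (possibly empty) matchings of $H$. A transversal of $(X,H)$ is a set $T\subseteq V(H)$ with $|T\cap X_v|=1$ for all $v\in V(G)$. A graph property is a class of graphs closed under isomorphism. It is non-trivial if it contains a non-empty graph but not all graphs; hereditary if closed under induced subgraphs; additive if closed under disjoint unions; reliable if non-trivial, hereditary and additive. For non-trivial hereditary $\mathcal{P}$: $\mathrm{CR}(\mathcal{P})$ is the class of graphs $G\notin\mathcal{P}$ with $G-v\in\mathcal{P}$ for all $v\in V(G)$, and $d(\mathcal{P})=\min\{\delta(G): G\in\mathrm{CR}(\mathcal{P})\}$. A $\mathcal{P}$-transversal of $(X,H)$ is a transversal $T$ with $H[T]\in\mathcal{P}$. *)

theory Defs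
  imports Main "HOL-Library.Disjoint_Sets"
begin

section \<open>Multigraphs\<close>

text \<open>
  A multigraph is given by its vertex set and its multiplicity function. The multiplicity is
  forced to vanish outside the vertex set, so that equality of records is equality of graphs.
\<close>

record 'a mgraph =
  verts :: "'a set"
  mu :: "'a \<Rightarrow> 'a \<Rightarrow> nat"

definition multigraph :: "'a mgraph \<Rightarrow> bool" where
  "multigraph G \<longleftrightarrow>
     finite (verts G) \<and>
     (\<forall>u v. mu G u v = mu G v u) \<and>
     (\<forall>v. mu G v v = 0) \<and>
     (\<forall>u v. mu G u v > 0 \<longrightarrow> u \<in> verts G \<and> v \<in> verts G)"

text \<open>The edges joining \<open>u\<close> and \<open>v\<close> are the pairs \<open>({u, v}, i)\<close> with \<open>i < mu G u v\<close>.\<close>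

type_synonym 'a edge = "'a set \<times> nat"

definition edges :: "'a mgraph \<Rightarrow> 'a edge set" where
  "edges G = {({u, v}, i) | u v i. i < mu G u v}"

definition edges_between :: "'a mgraph \<Rightarrow> 'a set \<Rightarrow> 'a set \<Rightarrow> 'a edge set" where
  "edges_between G A B = {e \<in> edges G. \<exists>a\<in>A. \<exists>b\<in>B. fst e = {a, b}}"

definition vdegree :: "'a mgraph \<Rightarrow> 'a \<Rightarrow> nat" where
  "vdegree G v = card {e \<in> edges G. v \<in> fst e}"

definition max_degree :: "'a mgraph \<Rightarrow> nat" where
  "max_degree G = Max (vdegree G ` verts G)"

definition min_degree :: "'a mgraph \<Rightarrow> nat" where
  "min_degree G = Min (vdegree G ` verts G)"

definition regular_graph :: "nat \<Rightarrow> 'a mgraph \<Rightarrow> bool" where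
  "regular_graph r G \<longleftrightarrow> (\<forall>v\<in>verts G. vdegree G v = r)"

definition graph_iso :: "'a mgraph \<Rightarrow> 'b mgraph \<Rightarrow> bool" where
  "graph_iso G H \<longleftrightarrow>
     (\<exists>f. bij_betw f (verts G) (verts H) \<and>
          (\<forall>u\<in>verts G. \<forall>v\<in>verts G. mu H (f u) (f v) = mu G u v))"

definition subgraph :: "'a mgraph \<Rightarrow> 'a mgraph \<Rightarrow> bool" where
  "subgraph H G \<longleftrightarrow>
     multigraph H \<and> verts H \<subseteq> verts G \<and> (\<forall>u v. mu H u v \<le> mu G u v)"

definition induced :: "'a mgraph \<Rightarrow> 'a set \<Rightarrow> 'a mgraph" where
  "induced G S =
     \<lparr>verts = verts G \<inter> S, mu = (\<lambda>u v. if u \<in> S \<and> v \<in> S then mu G u v else 0)\<rparr>"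

definition delete_vertex :: "'a mgraph \<Rightarrow> 'a \<Rightarrow> 'a mgraph" where
  "delete_vertex G v = induced G (verts G - {v})"

definition graph_union :: "'a mgraph \<Rightarrow> 'a mgraph \<Rightarrow> 'a mgraph" where
  "graph_union G H = \<lparr>verts = verts G \<union> verts H, mu = (\<lambda>u v. mu G u v + mu H u v)\<rparr>"

definition multiple :: "nat \<Rightarrow> 'a mgraph \<Rightarrow> 'a mgraph" where
  "multiple t G = \<lparr>verts = verts G, mu = (\<lambda>u v. t * mu G u v)\<rparr>"

definition complete_graph :: "nat \<Rightarrow> nat mgraph" where
  "complete_graph n =
     \<lparr>verts = {..<n}, mu = (\<lambda>u v. if u < n \<and> v < n \<and> u \<noteq> v then 1 else 0)\<rparr>"

definition cycle_graph :: "nat \<Rightarrow> nat mgraph" where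
  "cycle_graph n =
     \<lparr>verts = {..<n},
      mu = (\<lambda>u v. if u < n \<and> v < n \<and> (v = (u + 1) mod n \<or> u = (v + 1) mod n) then 1 else 0)\<rparr>"

definition brick :: "'a mgraph \<Rightarrow> bool" where
  "brick B \<longleftrightarrow>
     (\<exists>t\<ge>1. \<exists>n\<ge>1. graph_iso B (multiple t (complete_graph n))) \<or>
     (\<exists>t\<ge>1. \<exists>n\<ge>3. graph_iso B (multiple t (cycle_graph n)))"


section \<open>Connectivity and blocks\<close>

definition reachable :: "'a mgraph \<Rightarrow> 'a \<Rightarrow> 'a \<Rightarrow> bool" where
  "reachable G = (\<lambda>u v. mu G u v > 0)\<^sup>*\<^sup>*"

text \<open>Components are represented by their vertex sets.\<close>

definition components :: "'a mgraph \<Rightarrow> 'a set set" where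
  "components G = verts G // {(u, v). u \<in> verts G \<and> v \<in> verts G \<and> reachable G u v}"

definition connected_graph :: "'a mgraph \<Rightarrow> bool" where
  "connected_graph G \<longleftrightarrow> verts G \<noteq> {} \<and> (\<forall>u\<in>verts G. \<forall>v\<in>verts G. reachable G u v)"

definition separating_vertex :: "'a mgraph \<Rightarrow> 'a \<Rightarrow> bool" where
  "separating_vertex G v \<longleftrightarrow> v \<in> verts G \<and> card (components (delete_vertex G v)) \<ge> 2"

definition nonseparable :: "'a mgraph \<Rightarrow> bool" where
  "nonseparable G \<longleftrightarrow> connected_graph G \<and> \<not> (\<exists>v. separating_vertex G v)"

definition block_of :: "'a mgraph \<Rightarrow> 'a mgraph \<Rightarrow> bool" where
  "block_of B G \<longleftrightarrow>
     subgraph B G \<and> nonseparable B \<and>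
     (\<forall>B'. subgraph B' G \<and> nonseparable B' \<and> subgraph B B' \<longrightarrow> B' = B)"


section \<open>Graph properties\<close>

text \<open>
  Every finite graph has an isomorphic copy on natural numbers, so a class of graphs closed under
  isomorphism is given by its members with vertices in \<open>nat\<close>; a graph over an arbitrary
  vertex type belongs to the class iff it is isomorphic to one of these members.
\<close>

definition graph_property :: "nat mgraph set \<Rightarrow> bool" where
  "graph_property P \<longleftrightarrow>
     (\<forall>G\<in>P. multigraph G) \<and>
     (\<forall>G\<in>P. \<forall>G'. multigraph G' \<and> graph_iso G G' \<longrightarrow> G' \<in> P)"

definition in_class :: "'a mgraph \<Rightarrow> nat mgraph set \<Rightarrow> bool" where
  "in_class G P \<longleftrightarrow> multigraph G \<and> (\<exists>G'\<in>P. graph_iso G G')"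

definition nontrivial_property :: "nat mgraph set \<Rightarrow> bool" where
  "nontrivial_property P \<longleftrightarrow>
     (\<exists>G\<in>P. verts G \<noteq> {}) \<and> (\<exists>G. multigraph G \<and> G \<notin> P)"

definition hereditary_property :: "nat mgraph set \<Rightarrow> bool" where
  "hereditary_property P \<longleftrightarrow> (\<forall>G\<in>P. \<forall>S\<subseteq>verts G. induced G S \<in> P)"

definition additive_property :: "nat mgraph set \<Rightarrow> bool" where
  "additive_property P \<longleftrightarrow>
     (\<forall>G\<in>P. \<forall>H\<in>P. verts G \<inter> verts H = {} \<longrightarrow> graph_union G H \<in> P)"

definition reliable_property :: "nat mgraph set \<Rightarrow> bool" where
  "reliable_property P \<longleftrightarrow>
     graph_property P \<and> nontrivial_property P \<and> hereditary_property P \<and> additive_property P"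

definition CR :: "nat mgraph set \<Rightarrow> nat mgraph set" where
  "CR P = {G. multigraph G \<and> G \<notin> P \<and> (\<forall>v\<in>verts G. delete_vertex G v \<in> P)}"

text \<open>
  The set of minimum degrees may be infinite, hence \<open>LEAST\<close> and not \<open>Min\<close>; it is non-empty
  when \<open>P\<close> is non-trivial and hereditary.
\<close>

definition crit_degree :: "nat mgraph set \<Rightarrow> nat" where
  "crit_degree P = (LEAST k. \<exists>G\<in>CR P. min_degree G = k)"


section \<open>Covers and transversals\<close>

definition independent_in :: "'a mgraph \<Rightarrow> 'a set \<Rightarrow> bool" where
  "independent_in G S \<longleftrightarrow> (\<forall>x\<in>S. \<forall>y\<in>S. mu G x y = 0)"

definition matching :: "'a mgraph \<Rightarrow> 'a edge set \<Rightarrow> bool" where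
  "matching G M \<longleftrightarrow>
     M \<subseteq> edges G \<and> (\<forall>e\<in>M. \<forall>e'\<in>M. e \<noteq> e' \<longrightarrow> fst e \<inter> fst e' = {})"

definition cover :: "'a mgraph \<Rightarrow> ('a \<Rightarrow> 'b set) \<Rightarrow> 'b mgraph \<Rightarrow> bool" where
  "cover G X H \<longleftrightarrow>
     multigraph H \<and>
     disjoint_family_on X (verts G) \<and>
     verts H = (\<Union>v\<in>verts G. X v) \<and>
     (\<forall>v\<in>verts G. independent_in H (X v)) \<and>
     (\<forall>u\<in>verts G. \<forall>v\<in>verts G. u \<noteq> v \<longrightarrow>
        (\<exists>M :: nat \<Rightarrow> 'b edge set.
           (\<forall>i<mu G u v. matching H (M i)) \<and>
           edges_between H (X u) (X v) = (\<Union>i<mu G u v. M i)))"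

definition transversal :: "'a mgraph \<Rightarrow> ('a \<Rightarrow> 'b set) \<Rightarrow> 'b mgraph \<Rightarrow> 'b set \<Rightarrow> bool" where
  "transversal G X H T \<longleftrightarrow> T \<subseteq> verts H \<and> (\<forall>v\<in>verts G. card (T \<inter> X v) = 1)"

definition colorable ::
  "nat mgraph set \<Rightarrow> 'a mgraph \<Rightarrow> ('a \<Rightarrow> 'b set) \<Rightarrow> 'b mgraph \<Rightarrow> bool" where
  "colorable P G X H \<longleftrightarrow> (\<exists>T. transversal G X H T \<and> in_class (induced H T) P)"

end

theory Submission
  imports Defs
begin

text \<open>
  Every graph outside \<open>P\<close> contains a subgraph of minimum degree at least \<open>r\<close>, so a transversal is a
  \<open>P\<close>-transversal as soon as it is strictly \<open>f\<close>-degenerate (each nonempty set \<open>S\<close> of its vertices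
  has a member with fewer than \<open>f x\<close> edges into \<open>S\<close>) for the constant weight \<open>f = r\<close>. It therefore
  suffices to study weighted covers without strictly degenerate transversal where the weights of
  \<open>X v\<close> sum to at least the degree of \<open>v\<close>. Colouring part of the graph and subtracting from each
  weight the number of edges to the coloured part preserves this situation, as long as the rest is
  connected; in this way the blocks can be treated one at a time.

  In a non-separable graph, greedy colouring towards a vertex \<open>v\<close> leaves only \<open>v\<close> uncoloured, and then
  all inequalities are equalities: each colour \<open>x\<close> of \<open>v\<close> has exactly \<open>f x\<close> edges to the coloured
  part. Such a choice is called bad at \<open>v\<close>; badness spreads along the edges of the cover. If some bad
  choice is connected, then all edges of the graph are full (any two colours of positive weight at the
  ends are adjacent), all choices induce isomorphic graphs \<open>B'\<close>, and the block is a multiple of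
  \<open>B'\<close>. Otherwise the block is complete or a cycle and no edge is full: this is shown by induction
  on the number of vertices, deleting a coloured vertex if there is no separating pair, and cutting
  along a separating pair if there is one. A bad choice in a complete block can be moved to
  any other vertex set of the same size, and in a cycle the neighbourhoods of the colours of one vertex
  partition the colours of the next; both facts force constant edge multiplicities, that is, a brick.
\<close>

section \<open>Connectivity\<close>

text \<open>Weights have to vary from colour to colour: subtracting the edges to a coloured part is
  not uniform, even if all weights start at \<open>r\<close>. The obstacle is that this subtraction
  can exhaust colours. Fullness speaks only of colours of positive weight, so what holds after a
  reduction need not hold before it. In a nonseparable hard set, however, all vertices have equally
  many positive colours, by double counting the edges between two colour classes. Hence, if the
  remainder is nonseparable and one of its vertices has no neighbour in the coloured part, no colour
  is exhausted anywhere and fullness can be carried back. For this reason separating pairs are cut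
  in such a way that the remainder stays nonseparable. The number of positive colours per vertex is
  also the factor of the multiple of \<open>B'\<close>: in the full case, the edges that a fixed
  colour of one vertex sends to another vertex are shared equally among the positive colours
  there.\<close>

definition conn :: "('a \<Rightarrow> 'a \<Rightarrow> nat) \<Rightarrow> 'a set \<Rightarrow> bool" where
  "conn \<mu> S \<longleftrightarrow> S \<noteq> {} \<and>
     (\<forall>A\<subseteq>S. A \<noteq> {} \<and> A \<noteq> S \<longrightarrow> (\<exists>u\<in>A. \<exists>w\<in>S - A. 0 < \<mu> u w))"

text \<open>Connectivity is phrased by cuts of a vertex set, so that deleting vertices is set
  difference and no subgraph has to be formed. The case \<open>S = {c}\<close> is separate because
  \<open>conn\<close> rejects the empty set.\<close>

definition nonsep :: "('a \<Rightarrow> 'a \<Rightarrow> nat) \<Rightarrow> 'a set \<Rightarrow> bool" where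
  "nonsep \<mu> S \<longleftrightarrow> conn \<mu> S \<and> (\<forall>c\<in>S. S = {c} \<or> conn \<mu> (S - {c}))"

definition sym_mult :: "('a \<Rightarrow> 'a \<Rightarrow> nat) \<Rightarrow> bool" where
  "sym_mult \<mu> \<longleftrightarrow> (\<forall>u v. \<mu> u v = \<mu> v u) \<and> (\<forall>v. \<mu> v v = 0)"

lemma sym_multD: "sym_mult \<mu> \<Longrightarrow> \<mu> u v = \<mu> v u" "sym_mult \<mu> \<Longrightarrow> \<mu> v v = 0"
  by (auto simp: sym_mult_def)

lemma conn_nonempty: "conn \<mu> S \<Longrightarrow> S \<noteq> {}"
  by (simp add: conn_def)

lemma conn_edge:
  assumes "conn \<mu> S" "A \<subseteq> S" "A \<noteq> {}" "A \<noteq> S"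
  obtains u w where "u \<in> A" "w \<in> S - A" "0 < \<mu> u w"
  using assms unfolding conn_def by blast

lemma conn_closed:
  assumes "conn \<mu> S" "A \<subseteq> S" "A \<noteq> {}" "\<And>u w. u \<in> A \<Longrightarrow> w \<in> S \<Longrightarrow> 0 < \<mu> u w \<Longrightarrow> w \<in> A"
  shows "A = S"
  using assms unfolding conn_def by (metis DiffE)

lemma conn_singleton: "conn \<mu> {v}"
  by (auto simp: conn_def)

text \<open>Every bipartition has a side avoiding a given vertex, so only those sides need to be examined.\<close>

lemma connI_avoid:
  assumes "sym_mult \<mu>" "q \<in> S"
    and "\<And>A. A \<subseteq> S \<Longrightarrow> A \<noteq> {} \<Longrightarrow> q \<notin> A \<Longrightarrow> \<exists>u\<in>A. \<exists>w\<in>S - A. 0 < \<mu> u w"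
  shows "conn \<mu> S"
  unfolding conn_def
proof (intro conjI allI impI)
  show "S \<noteq> {}" using assms by blast
  fix A assume A: "A \<subseteq> S" "A \<noteq> {} \<and> A \<noteq> S"
  show "\<exists>u\<in>A. \<exists>w\<in>S - A. 0 < \<mu> u w"
  proof (cases "q \<in> A")
    case True
    then have "\<exists>u\<in>S - A. \<exists>w\<in>S - (S - A). 0 < \<mu> u w" using assms(3)[of "S - A"] A by blast
    then show ?thesis using sym_multD(1)[OF assms(1)] by (metis DiffD1 DiffD2 DiffI)
  qed (use assms(3) A in blast)
qed

text \<open>A set avoiding the common vertex \<open>q\<close> meets \<open>A\<close> or
  \<open>B\<close>, and its trace there is proper because it misses \<open>q\<close>; an edge
  leaving the trace inside that connected part leaves the set.\<close>

lemma conn_union: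
  assumes "sym_mult \<mu>" "conn \<mu> A" "conn \<mu> B" "q \<in> A" "q \<in> B"
  shows "conn \<mu> (A \<union> B)"
proof (rule connI_avoid[OF assms(1), of q])
  show "q \<in> A \<union> B" using assms by simp
  fix D assume D: "D \<subseteq> A \<union> B" "D \<noteq> {}" "q \<notin> D"
  have "\<exists>u\<in>D. \<exists>w\<in>(A \<union> B) - D. 0 < \<mu> u w"
    if C: "conn \<mu> C" "q \<in> C" "D \<inter> C \<noteq> {}" "C \<subseteq> A \<union> B" for C
  proof -
    have "D \<inter> C \<noteq> C" using C D by blast
    then obtain u w where "u \<in> D \<inter> C" "w \<in> C - D \<inter> C" "0 < \<mu> u w"
      using conn_edge[OF C(1), of "D \<inter> C"] C(3) by blast
    then show ?thesis using C(4) by blast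
  qed
  then show "\<exists>u\<in>D. \<exists>w\<in>(A \<union> B) - D. 0 < \<mu> u w" using D assms by blast
qed

lemma conn_pair:
  assumes "sym_mult \<mu>" "0 < \<mu> u w"
  shows "conn \<mu> {u, w}"
proof (rule connI_avoid[OF assms(1), of u])
  fix A assume "A \<subseteq> {u, w}" "A \<noteq> {}" "u \<notin> A"
  then have "A = {w}" "u \<in> {u, w} - A" by auto
  then show "\<exists>p\<in>A. \<exists>q\<in>{u, w} - A. 0 < \<mu> p q"
    using assms sym_multD(1)[OF assms(1), of w u] by auto
qed simp

lemma conn_insert:
  assumes "sym_mult \<mu>" "conn \<mu> S" "u \<in> S" "0 < \<mu> u w"
  shows "conn \<mu> (insert w S)"
proof -
  have "conn \<mu> (S \<union> {u, w})"
    using conn_union[OF assms(1,2) conn_pair[of \<mu> u w, OF assms(1,4)] assms(3)] by simp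
  moreover have "S \<union> {u, w} = insert w S" using assms(3) by blast
  ultimately show ?thesis by simp
qed

text \<open>Take a maximal connected proper subset containing \<open>v\<close>. Adding a vertex
  joined to it keeps it connected, so by maximality gives all of \<open>S\<close>: only that vertex
  was missing.\<close>

lemma conn_noncut:
  assumes "sym_mult \<mu>" "finite S" "conn \<mu> S" "v \<in> S" "S \<noteq> {v}"
  obtains w where "w \<in> S - {v}" "conn \<mu> (S - {w})"
proof -
  let ?F = "{A. A \<subseteq> S \<and> A \<noteq> S \<and> v \<in> A \<and> conn \<mu> A}"
  have "finite ?F" "{v} \<in> ?F" using assms conn_singleton[of \<mu> v] by auto
  then obtain A where A: "A \<in> ?F" and "\<forall>B\<in>?F. A \<subseteq> B \<longrightarrow> A = B"
    using finite_has_maximal2[of ?F "{v}"] by meson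
  then have mx: "B = A" if "B \<in> ?F" "A \<subseteq> B" for B using that by blast
  have "A \<subseteq> S" "A \<noteq> {}" "A \<noteq> S" "conn \<mu> A" "v \<in> A" using A by auto
  then obtain u w where uw: "u \<in> A" "w \<in> S - A" "0 < \<mu> u w"
    using conn_edge[OF assms(3), of A] by blast
  have "conn \<mu> (insert w A)" using conn_insert[OF assms(1) \<open>conn \<mu> A\<close> uw(1,3)] .
  then have "insert w A = S" using mx[of "insert w A"] uw A by blast
  then have "S - {w} = A" using uw by blast
  then show ?thesis using that[of w] uw \<open>conn \<mu> A\<close> \<open>v \<in> A\<close> by auto
qed

lemma nonsepD: "nonsep \<mu> S \<Longrightarrow> conn \<mu> S"
  "nonsep \<mu> S \<Longrightarrow> c \<in> S \<Longrightarrow> S \<noteq> {c} \<Longrightarrow> conn \<mu> (S - {c})"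
  by (auto simp: nonsep_def)

lemma conn_nbr:
  assumes "sym_mult \<mu>" "conn \<mu> S" "v \<in> S" "S \<noteq> {v}"
  obtains w where "w \<in> S" "w \<noteq> v" "0 < \<mu> v w"
  using conn_edge[OF assms(2), of "{v}"] assms by blast

subsection \<open>Separating pairs\<close>

text \<open>\<open>J\<close> is one side of the pair. It need not be connected: it is any nontrivial
  union of components of \<open>U - {a, b}\<close>, so the complement of a side is a side.\<close>

definition cut_pair :: "('a \<Rightarrow> 'a \<Rightarrow> nat) \<Rightarrow> 'a set \<Rightarrow> 'a \<Rightarrow> 'a \<Rightarrow> 'a set \<Rightarrow> bool" where
  "cut_pair \<mu> U a b J \<longleftrightarrow> a \<noteq> b \<and> a \<in> U \<and> b \<in> U \<and> J \<subseteq> U - {a, b} \<and> J \<noteq> {} \<and>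
     U - {a, b} - J \<noteq> {} \<and> (\<forall>j\<in>J. \<forall>i\<in>U - {a, b} - J. \<mu> j i = 0)"

lemma cut_pair_compl:
  assumes "sym_mult \<mu>" "cut_pair \<mu> U a b J"
  shows "cut_pair \<mu> U a b (U - {a, b} - J)"
proof -
  have "U - {a, b} - (U - {a, b} - J) = J" using assms(2) unfolding cut_pair_def by blast
  then show ?thesis using assms sym_multD(1)[OF assms(1)] unfolding cut_pair_def
    by (metis Diff_subset)
qed

lemma cut_pair_swap: "cut_pair \<mu> U a b J \<Longrightarrow> cut_pair \<mu> U b a J"
  unfolding cut_pair_def by (metis insert_commute)

lemma cut_pair_exists:
  assumes "sym_mult \<mu>" "a \<in> U" "b \<in> U" "a \<noteq> b" "U - {a, b} \<noteq> {}" "\<not> conn \<mu> (U - {a, b})"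
  obtains J where "cut_pair \<mu> U a b J"
proof -
  obtain A where A: "A \<subseteq> U - {a, b}" "A \<noteq> {}" "A \<noteq> U - {a, b}"
    "\<And>u w. u \<in> A \<Longrightarrow> w \<in> U - {a, b} - A \<Longrightarrow> \<mu> u w = 0"
    using assms(5,6) unfolding conn_def by (metis gr_zeroI)
  show ?thesis by (rule that[of A]) (use A assms in \<open>auto simp: cut_pair_def\<close>)
qed

text \<open>\<open>U\<close> stays connected without \<open>c\<close>, so some edge leaves
  \<open>D\<close>; as \<open>D\<close> lies in \<open>J\<close>, that edge cannot reach the
  opposite side.\<close>

lemma side_edge:
  assumes "nonsep \<mu> U" "cut_pair \<mu> U a b J" "D \<subseteq> J" "D \<noteq> {}" "c \<in> U" "c \<notin> D"
  obtains u w where "u \<in> D" "w \<in> insert a (insert b J) - {c} - D" "0 < \<mu> u w"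
proof -
  have c: "conn \<mu> (U - {c})" "D \<subseteq> U - {c}" "D \<noteq> U - {c}"
    using assms nonsepD(2)[OF assms(1), of c] unfolding cut_pair_def by blast+
  obtain u w where uw: "u \<in> D" "w \<in> U - {c} - D" "0 < \<mu> u w"
    using conn_edge[OF c(1,2) assms(4) c(3)] by blast
  then have "w \<in> insert a (insert b J)" using assms(2,3) unfolding cut_pair_def
    by force
  then show ?thesis using that uw by blast
qed

lemma side_conn:
  assumes "sym_mult \<mu>" "nonsep \<mu> U" "cut_pair \<mu> U a b J"
  shows "conn \<mu> (insert a J)" "conn \<mu> (insert b J)" "conn \<mu> (insert a (insert b J))"
proof -
  have *: "conn \<mu> (insert a J)" if cut: "cut_pair \<mu> U a b J" for a b
  proof (rule connI_avoid[OF assms(1), of a])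
    fix A assume A: "A \<subseteq> insert a J" "A \<noteq> {}" "a \<notin> A"
    then have "A \<subseteq> J" "b \<in> U" "b \<notin> A" using cut unfolding cut_pair_def by auto
    then obtain u w where "u \<in> A" "w \<in> insert a (insert b J) - {b} - A" "0 < \<mu> u w"
      using side_edge[OF assms(2) cut, of A b] A by blast
    then show "\<exists>u\<in>A. \<exists>w\<in>insert a J - A. 0 < \<mu> u w" by blast
  qed simp
  show a: "conn \<mu> (insert a J)" using * assms(3) .
  show b: "conn \<mu> (insert b J)" using *[OF cut_pair_swap[OF assms(3)]] .
  obtain j where "j \<in> J" using assms(3) unfolding cut_pair_def by blast
  then have "conn \<mu> (insert a J \<union> insert b J)" using conn_union[OF assms(1) a b, of j] by blast
  then show "conn \<mu> (insert a (insert b J))" by (simp add: insert_commute Un_insert_right)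
qed

text \<open>This shrinks one side of a separating pair to a part \<open>P\<close> that still links
  \<open>a\<close> with \<open>b\<close> and whose pieces stay attached when one vertex is lost.
  \<open>P = {}\<close> serves adjacent \<open>a\<close> and \<open>b\<close>, a minimal connector
  the nonadjacent case.\<close>

lemma nonsep_glue:
  assumes mu: "sym_mult \<mu>" and ns: "nonsep \<mu> U" and cut: "cut_pair \<mu> U a b J"
    and P: "P \<subseteq> J" and conn: "conn \<mu> (insert a (insert b P))"
    and D: "\<And>q D. q \<in> insert a (insert b P) \<Longrightarrow> D \<subseteq> P - {q} \<Longrightarrow> D \<noteq> {} \<Longrightarrow>
       \<exists>u\<in>D. \<exists>w\<in>insert a (insert b P) - {q} - D. 0 < \<mu> u w"
  shows "nonsep \<mu> (insert a (insert b P) \<union> (U - {a, b} - J))"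
proof -
  let ?Q = "insert a (insert b P)" and ?I = "U - {a, b} - J"
  note cutI = cut_pair_compl[OF mu cut]
  note I = side_conn[OF mu ns cutI]
  have ab: "a \<noteq> b" "a \<in> U" "b \<in> U" "J \<subseteq> U - {a, b}" using cut unfolding cut_pair_def by auto
  have all: "conn \<mu> (?Q \<union> ?I)"
    using conn_union[OF mu conn I(3), of a] by (simp add: insert_commute Un_insert_right)
  have "conn \<mu> (?Q \<union> ?I - {c})" if c: "c \<in> ?Q \<union> ?I" for c
  proof -
    \<comment> \<open>In each case a set avoiding a surviving one of \<open>a\<close> and
      \<open>b\<close> is examined; it has an outgoing edge inside the connector or inside the
      untouched side.\<close>
    consider "c \<in> ?I" | "c = a" | "c = b" | "c \<in> P" using c by blast
    then show ?thesis
    proof cases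
      case 1
      have "c \<noteq> a" "c \<notin> P" "c \<noteq> b" using 1 P by auto
      show ?thesis
      proof (rule connI_avoid[OF mu, of a])
        show "a \<in> ?Q \<union> ?I - {c}" using \<open>c \<noteq> a\<close> by blast
        fix A assume A: "A \<subseteq> ?Q \<union> ?I - {c}" "A \<noteq> {}" "a \<notin> A"
        show "\<exists>u\<in>A. \<exists>w\<in>?Q \<union> ?I - {c} - A. 0 < \<mu> u w"
        proof (cases "A \<inter> ?Q = {}")
          case True
          then have "A \<subseteq> ?I" "c \<in> U" "c \<notin> A" using A 1 by blast+
          then obtain u w where "u \<in> A" "w \<in> insert a (insert b ?I) - {c} - A" "0 < \<mu> u w"
            using side_edge[OF ns cutI, of A c] A by blast
          then show ?thesis by blast
        next
          case False
          obtain u w where "u \<in> A \<inter> ?Q" "w \<in> ?Q - A \<inter> ?Q" "0 < \<mu> u w"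
            using conn_edge[OF conn, of "A \<inter> ?Q"] False A by blast
          then show ?thesis using \<open>c \<noteq> a\<close> \<open>c \<noteq> b\<close> \<open>c \<notin> P\<close> by blast
        qed
      qed
    next
      case 2
      show ?thesis
      proof (rule connI_avoid[OF mu, of b])
        show "b \<in> ?Q \<union> ?I - {c}" using 2 ab by blast
        fix A assume A: "A \<subseteq> ?Q \<union> ?I - {c}" "A \<noteq> {}" "b \<notin> A"
        show "\<exists>u\<in>A. \<exists>w\<in>?Q \<union> ?I - {c} - A. 0 < \<mu> u w"
        proof (cases "A \<inter> ?I = {}")
          case True
          then have "A \<subseteq> P - {a}" using A 2 by blast
          then show ?thesis using D[of a A] A 2 by blast
        next
          case False
          obtain u w where "u \<in> A \<inter> ?I" "w \<in> insert b ?I - A \<inter> ?I" "0 < \<mu> u w"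
            using conn_edge[OF I(2), of "A \<inter> ?I"] False A by blast
          then show ?thesis using 2 A ab by blast
        qed
      qed
    next
      case 3
      show ?thesis
      proof (rule connI_avoid[OF mu, of a])
        show "a \<in> ?Q \<union> ?I - {c}" using 3 ab by blast
        fix A assume A: "A \<subseteq> ?Q \<union> ?I - {c}" "A \<noteq> {}" "a \<notin> A"
        show "\<exists>u\<in>A. \<exists>w\<in>?Q \<union> ?I - {c} - A. 0 < \<mu> u w"
        proof (cases "A \<inter> ?I = {}")
          case True
          then have "A \<subseteq> P - {b}" using A 3 by blast
          then show ?thesis using D[of b A] A 3 by blast
        next
          case False
          obtain u w where "u \<in> A \<inter> ?I" "w \<in> insert a ?I - A \<inter> ?I" "0 < \<mu> u w"
            using conn_edge[OF I(1), of "A \<inter> ?I"] False A by blast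
          then show ?thesis using 3 A ab by blast
        qed
      qed
    next
      case 4
      then have c': "c \<noteq> a" "c \<noteq> b" "c \<notin> ?I" using P ab by blast+
      show ?thesis
      proof (rule connI_avoid[OF mu, of a])
        show "a \<in> ?Q \<union> ?I - {c}" using c' by blast
        fix A assume A: "A \<subseteq> ?Q \<union> ?I - {c}" "A \<noteq> {}" "a \<notin> A"
        show "\<exists>u\<in>A. \<exists>w\<in>?Q \<union> ?I - {c} - A. 0 < \<mu> u w"
        proof (cases "A \<inter> insert b ?I = {}")
          case True
          then have "A \<subseteq> P - {c}" using A by blast
          then show ?thesis using D[of c A] A 4 by blast
        next
          case False
          obtain u w where "u \<in> A \<inter> insert a (insert b ?I)"
            "w \<in> insert a (insert b ?I) - A \<inter> insert a (insert b ?I)" "0 < \<mu> u w"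
            using conn_edge[OF I(3), of "A \<inter> insert a (insert b ?I)"] False A by blast
          then show ?thesis using c' by blast
        qed
      qed
    qed
  qed
  then show ?thesis using all unfolding nonsep_def by blast
qed

text \<open>\<open>P\<close> is in effect the interior of an induced path from \<open>a\<close> to
  \<open>b\<close>, obtained without paths as an inclusion-minimal connecting set. If some
  \<open>D\<close> were attached only through \<open>q\<close>, dropping \<open>D\<close> would
  leave a smaller connector.\<close>

lemma minimal_connector:
  assumes mu: "sym_mult \<mu>" and fin: "finite J" and J: "conn \<mu> (insert a (insert b J))"
  obtains P where "P \<subseteq> J" "conn \<mu> (insert a (insert b P))"
    "\<And>P'. P' \<subset> P \<Longrightarrow> \<not> conn \<mu> (insert a (insert b P'))"
    "\<And>q D. q \<in> insert a (insert b P) \<Longrightarrow> D \<subseteq> P - {a, b, q} \<Longrightarrow> D \<noteq> {} \<Longrightarrow>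
       \<exists>u\<in>D. \<exists>w\<in>insert a (insert b P) - {q} - D. 0 < \<mu> u w"
proof -
  let ?F = "{P. P \<subseteq> J \<and> conn \<mu> (insert a (insert b P))}"
  have "finite ?F" "J \<in> ?F" using fin J by auto
  then obtain P where P: "P \<in> ?F" and "\<forall>B\<in>?F. B \<subseteq> P \<longrightarrow> P = B"
    using finite_has_minimal2[of ?F J] by meson
  then have mn: "B = P" if "B \<in> ?F" "B \<subseteq> P" for B using that by blast
  have m: "\<not> conn \<mu> (insert a (insert b P'))" if "P' \<subset> P" for P'
    using mn[of P'] that P by auto
  let ?Q = "insert a (insert b P)"
  have Q: "conn \<mu> ?Q" using P by simp
  have "\<exists>u\<in>D. \<exists>w\<in>?Q - {q} - D. 0 < \<mu> u w"
    if D: "q \<in> ?Q" "D \<subseteq> P - {a, b, q}" "D \<noteq> {}" for q D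
  proof (rule ccontr)
    assume neg: "\<not> ?thesis"
    have eq: "?Q - D = insert a (insert b (P - D))" using D by blast
    have "conn \<mu> (?Q - D)"
    proof (rule connI_avoid[OF mu, of q])
      show "q \<in> ?Q - D" using D by blast
      fix A assume A: "A \<subseteq> ?Q - D" "A \<noteq> {}" "q \<notin> A"
      obtain u w where uw: "u \<in> A" "w \<in> ?Q - A" "0 < \<mu> u w"
        using conn_edge[OF Q, of A] A D by blast
      have "w \<notin> D"
      proof
        assume "w \<in> D"
        moreover have "u \<in> ?Q - {q} - D" using uw A by blast
        ultimately show False using neg uw(3) sym_multD(1)[OF mu, of u w] by metis
      qed
      then show "\<exists>u\<in>A. \<exists>w\<in>?Q - D - A. 0 < \<mu> u w" using uw by blast
    qed
    moreover have "P - D \<subset> P" using D by blast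
    ultimately show False using m eq by metis
  qed
  then show ?thesis using that[of P] P m by blast
qed

section \<open>Path-like sides of separating pairs\<close>

definition nbrs :: "('a \<Rightarrow> 'a \<Rightarrow> nat) \<Rightarrow> 'a set \<Rightarrow> 'a \<Rightarrow> 'a set" where
  "nbrs \<mu> S v = {w \<in> S. 0 < \<mu> v w}"

text \<open>A local description of a side that is the interior of a path from \<open>a\<close> to
  \<open>b\<close>. If both sides of a nonadjacent pair are thin, the whole set is a cycle.\<close>

definition thin_side :: "('a \<Rightarrow> 'a \<Rightarrow> nat) \<Rightarrow> 'a set \<Rightarrow> 'a \<Rightarrow> 'a \<Rightarrow> 'a set \<Rightarrow> bool" where
  "thin_side \<mu> U a b J \<longleftrightarrow> (\<forall>j\<in>J. card (nbrs \<mu> U j) = 2) \<and>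
     card (nbrs \<mu> J a) = 1 \<and> card (nbrs \<mu> J b) = 1"

lemma thin_sides_two_nbrs:
  assumes "sym_mult \<mu>" "finite U" "cut_pair \<mu> U a b J" "\<mu> a b = 0"
    and "thin_side \<mu> U a b J" "thin_side \<mu> U a b (U - {a, b} - J)" "v \<in> U"
  shows "card (nbrs \<mu> U v) = 2"
proof -
  let ?I = "U - {a, b} - J"
  have J: "J \<subseteq> U" "a \<in> U" "b \<in> U" "J \<subseteq> U - {a, b}" using assms(3) unfolding cut_pair_def by auto
  have *: "card (nbrs \<mu> U c) = 2" if "c \<in> {a, b}" for c
  proof -
    have "\<mu> c a = 0" "\<mu> c b = 0" using that assms(4) sym_multD[OF assms(1)] by (metis insert_iff singletonD)+
    then have "nbrs \<mu> U c = nbrs \<mu> J c \<union> nbrs \<mu> ?I c" using J unfolding nbrs_def by force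
    moreover have "nbrs \<mu> J c \<inter> nbrs \<mu> ?I c = {}" "finite (nbrs \<mu> J c)" "finite (nbrs \<mu> ?I c)"
      using assms(2) J unfolding nbrs_def by (auto intro: finite_subset)
    ultimately have "card (nbrs \<mu> U c) = card (nbrs \<mu> J c) + card (nbrs \<mu> ?I c)"
      by (simp add: card_Un_disjoint)
    then show ?thesis using assms(5,6) that unfolding thin_side_def by auto
  qed
  consider "v \<in> J" | "v \<in> ?I" | "v \<in> {a, b}" using assms(7) by blast
  then show ?thesis using * assms(5,6) unfolding thin_side_def by cases auto
qed

text \<open>Here \<open>c\<close> separates \<open>a\<close> from \<open>b\<close> inside
  \<open>J\<close> with \<open>a\<close> and \<open>b\<close> added. Either \<open>a\<close> meets
  \<open>J\<close> in \<open>c\<close> alone, or \<open>{a, c}\<close> is itself a separating pair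
  with the smaller side \<open>J1\<close>, which is thin by assumption.\<close>

lemma half_thin:
  assumes mu: "sym_mult \<mu>" and ns: "nonsep \<mu> U" and cut: "cut_pair \<mu> U a b J"
    and c: "c \<in> J" and J1: "J1 \<subseteq> J - {c}" "J2 \<subseteq> J - {c}" "J = insert c (J1 \<union> J2)"
    and no: "\<forall>u\<in>insert a J1. \<forall>w\<in>insert b J2. \<mu> u w = 0"
    and nonadj: "\<forall>a b J. cut_pair \<mu> U a b J \<longrightarrow> \<mu> a b = 0"
    and thin: "\<forall>x y J'. cut_pair \<mu> U x y J' \<longrightarrow> J' \<subset> J \<longrightarrow> thin_side \<mu> U x y J'"
  shows "card (nbrs \<mu> J a) = 1 \<and> card (nbrs \<mu> (insert a J1) c) = 1 \<and>
    (\<forall>j\<in>J1. card (nbrs \<mu> U j) = 2)"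
proof -
  have ab: "a \<noteq> b" "a \<in> U" "b \<in> U" "J \<subseteq> U - {a, b}" "\<And>j i. j \<in> J \<Longrightarrow> i \<in> U - {a, b} - J \<Longrightarrow> \<mu> j i = 0"
    using cut unfolding cut_pair_def by auto
  have J2: "\<mu> a w = 0" if "w \<in> J2" for w using no that by blast
  show ?thesis
  proof (cases "J1 = {}")
    case True
    have "nbrs \<mu> J a \<subseteq> {c}" using J1(3) J2 True unfolding nbrs_def by auto
    moreover obtain w where "w \<in> insert a J" "w \<noteq> a" "0 < \<mu> a w"
      using conn_nbr[OF mu side_conn(1)[OF mu ns cut], of a] c ab by blast
    ultimately have n: "nbrs \<mu> J a = {c}" unfolding nbrs_def by blast
    then have "c \<in> nbrs \<mu> J a" by simp
    then have "0 < \<mu> c a" using sym_multD(1)[OF mu, of a c] unfolding nbrs_def by simp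
    then have "nbrs \<mu> (insert a J1) c = {a}" unfolding nbrs_def True by auto
    then show ?thesis using n True by simp
  next
    case False
    have J1U: "J1 \<subseteq> U - {a, c}" using J1 ab by blast
    have "b \<in> U - {a, c} - J1" using ab c J1 by blast
    moreover have "\<mu> j i = 0" if "j \<in> J1" "i \<in> U - {a, c} - J1" for j i
    proof (cases "i \<in> insert b J2")
      case True then show ?thesis using no that by auto
    next
      case False
      then have "i \<in> U - {a, b} - J" using that J1 by blast
      then show ?thesis using ab(5) that J1 by blast
    qed
    moreover have "a \<noteq> c" "c \<in> U" using ab c by blast+
    ultimately have cut1: "cut_pair \<mu> U a c J1"
      unfolding cut_pair_def using ab J1U False by blast
    moreover have "J1 \<subset> J" using J1 c by blast
    ultimately have t: "thin_side \<mu> U a c J1" using thin by blast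
    have ac: "\<mu> a c = 0" "\<mu> c a = 0" using nonadj cut1 sym_multD(1)[OF mu, of a c] by metis+
    then have "nbrs \<mu> J a = nbrs \<mu> J1 a" using J1(3) J2 unfolding nbrs_def by fastforce
    moreover have "nbrs \<mu> (insert a J1) c = nbrs \<mu> J1 c" using ac unfolding nbrs_def by auto
    ultimately show ?thesis using t unfolding thin_side_def by simp
  qed
qed

text \<open>Choose a side that is not thin and has the fewest vertices. A cut vertex
  \<open>c\<close> of this side with \<open>a\<close> and \<open>b\<close> added would separate
  \<open>a\<close> from \<open>b\<close>, and the two halves, each empty or thin by minimality,
  would make the whole side thin.\<close>

lemma nonsep_side_exists:
  assumes mu: "sym_mult \<mu>" and fin: "finite U" and ns: "nonsep \<mu> U"
    and ex: "cut_pair \<mu> U a0 b0 J0"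
    and nonadj: "\<forall>a b J. cut_pair \<mu> U a b J \<longrightarrow> \<mu> a b = 0"
    and notcyc: "\<not> (\<forall>v\<in>U. card (nbrs \<mu> U v) = 2)"
  obtains a b J where "cut_pair \<mu> U a b J" "nonsep \<mu> (insert a (insert b J))"
proof -
  let ?bad = "\<lambda>n. \<exists>a b J. card J = n \<and> cut_pair \<mu> U a b J \<and> \<not> thin_side \<mu> U a b J"
  have "\<exists>n. ?bad n"
    using thin_sides_two_nbrs[OF mu fin ex nonadj[rule_format, OF ex]] notcyc ex cut_pair_compl[OF mu ex] by blast
  then obtain n where n: "?bad n" and mn: "\<And>k. k < n \<Longrightarrow> \<not> ?bad k"
    using exists_least_iff[of ?bad] by blast
  then obtain a b J where J: "card J = n" "cut_pair \<mu> U a b J" "\<not> thin_side \<mu> U a b J" by blast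
  have ab: "a \<noteq> b" "a \<in> U" "b \<in> U" "J \<subseteq> U - {a, b}" "J \<noteq> {}"
    "\<And>j i. j \<in> J \<Longrightarrow> i \<in> U - {a, b} - J \<Longrightarrow> \<mu> j i = 0"
    using J(2) unfolding cut_pair_def by auto
  have finJ: "finite J" using ab fin by (meson finite_Diff finite_subset)
  have thin: "thin_side \<mu> U x y J'" if "cut_pair \<mu> U x y J'" "J' \<subset> J" for x y J'
    using mn[of "card J'"] that J(1) psubset_card_mono[OF finJ] by blast
  let ?B = "insert a (insert b J)"
  have conns: "conn \<mu> (insert a J)" "conn \<mu> (insert b J)" "conn \<mu> ?B"
    using side_conn[OF mu ns J(2)] by auto
  have "conn \<mu> (?B - {c})" if c: "c \<in> ?B" for c
  proof (rule ccontr)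
    assume nc: "\<not> conn \<mu> (?B - {c})"
    have "?B - {a} = insert b J" "?B - {b} = insert a J" using ab by blast+
    then have "c \<noteq> a" "c \<noteq> b" using nc conns by metis+
    then have c: "c \<in> J" "c \<noteq> a" "c \<noteq> b" using c by blast+
    have cU: "c \<in> U" using c ab by blast
    have "?B - {c} \<noteq> {}" using c by blast
    then obtain A' where A': "A' \<subseteq> ?B - {c}" "A' \<noteq> {}" "A' \<noteq> ?B - {c}"
      "\<forall>u\<in>A'. \<forall>w\<in>?B - {c} - A'. \<mu> u w = 0"
      using nc unfolding conn_def by (metis gr_zeroI)
    \<comment> \<open>The cut is oriented so that \<open>A\<close> contains \<open>a\<close>. Then
      \<open>D\<close> contains \<open>b\<close>, since otherwise \<open>D\<close> would be attached
      to \<open>c\<close> only.\<close>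
    define A where "A = (if a \<in> A' then A' else ?B - {c} - A')"
    define D where "D = ?B - {c} - A"
    have A: "A \<subseteq> ?B - {c}" "D \<noteq> {}" "a \<in> A" "a \<notin> D" "D \<subseteq> ?B - {c}" "A \<union> D = ?B - {c}" "A \<inter> D = {}"
      using A' c unfolding A_def D_def by auto
    have AD: "\<mu> u w = 0" if "u \<in> A" "w \<in> D" for u w
      using A'(4) that sym_multD(1)[OF mu, of u w] unfolding A_def D_def by (auto split: if_splits)
    have "b \<in> D"
    proof (rule ccontr)
      assume b: "b \<notin> D"
      then have DJ: "D \<subseteq> J" "c \<notin> D" using A by blast+
      obtain u w where uw: "u \<in> D" "w \<in> insert a (insert b J) - {c} - D" "0 < \<mu> u w"
        using side_edge[OF ns J(2) DJ(1) A(2) cU DJ(2)] by blast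
      have "w \<in> A" using uw(2) unfolding D_def by blast
      then show False using AD[of w u] uw sym_multD(1)[OF mu, of u w] by simp
    qed
    have bA: "b \<notin> A" using \<open>b \<in> D\<close> A(7) by blast
    define J1 J2 where "J1 = A - {a}" and "J2 = D - {b}"
    have s45: "A = insert a J1" "D = insert b J2" using A(3) \<open>b \<in> D\<close> unfolding J1_def J2_def by blast+
    have s12: "J1 \<subseteq> J - {c}" "J2 \<subseteq> J - {c}" using A(1,4,5) bA unfolding J1_def J2_def by blast+
    have s3: "J = insert c (J1 \<union> J2)"
    proof
      show "J \<subseteq> insert c (J1 \<union> J2)" using A(6) ab(4) unfolding J1_def J2_def by blast
      show "insert c (J1 \<union> J2) \<subseteq> J" using s12 c by blast
    qed
    have s678: "J1 \<inter> J2 = {}" "a \<notin> J2" "b \<notin> J1" using A(7) s12 ab(4) unfolding J1_def J2_def by blast+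
    note s = s12 s3 s45 s678
    have no: "\<forall>u\<in>insert a J1. \<forall>w\<in>insert b J2. \<mu> u w = 0"
      using AD s45 by (intro ballI) simp
    then have no': "\<forall>u\<in>insert b J2. \<forall>w\<in>insert a J1. \<mu> u w = 0"
      using sym_multD(1)[OF mu] by metis
    have th: "\<forall>x y J'. cut_pair \<mu> U x y J' \<longrightarrow> J' \<subset> J \<longrightarrow> thin_side \<mu> U x y J'" using thin by blast
    have s3': "J = insert c (J2 \<union> J1)" using s(3) by blast
    have h1: "card (nbrs \<mu> J a) = 1" "card (nbrs \<mu> (insert a J1) c) = 1"
      "\<forall>j\<in>J1. card (nbrs \<mu> U j) = 2"
      using half_thin[OF mu ns J(2) c(1) s(1,2,3) no nonadj th] by blast+
    have h2: "card (nbrs \<mu> J b) = 1" "card (nbrs \<mu> (insert b J2) c) = 1"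
      "\<forall>j\<in>J2. card (nbrs \<mu> U j) = 2"
      using half_thin[OF mu ns cut_pair_swap[OF J(2)] c(1) s(2,1) s3' no' nonadj th] by blast+
    have "nbrs \<mu> U c = nbrs \<mu> (insert a J1) c \<union> nbrs \<mu> (insert b J2) c"
    proof
      show "nbrs \<mu> U c \<subseteq> nbrs \<mu> (insert a J1) c \<union> nbrs \<mu> (insert b J2) c"
      proof
        fix w assume w: "w \<in> nbrs \<mu> U c"
        then have "w \<in> U" "0 < \<mu> c w" "w \<noteq> c" using sym_multD(2)[OF mu, of c] unfolding nbrs_def by auto
        moreover have "w \<in> ?B" using calculation ab(6)[OF c(1), of w] by auto
        ultimately show "w \<in> nbrs \<mu> (insert a J1) c \<union> nbrs \<mu> (insert b J2) c"
          using s(3) unfolding nbrs_def by blast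
      qed
      show "nbrs \<mu> (insert a J1) c \<union> nbrs \<mu> (insert b J2) c \<subseteq> nbrs \<mu> U c"
        using s ab unfolding nbrs_def by blast
    qed
    moreover have "nbrs \<mu> (insert a J1) c \<inter> nbrs \<mu> (insert b J2) c = {}"
      using s(4-8) A(7) unfolding nbrs_def by blast
    moreover have "finite (nbrs \<mu> (insert a J1) c)" "finite (nbrs \<mu> (insert b J2) c)"
      using h1(2) h2(2) by (auto intro: card_ge_0_finite)
    ultimately have "card (nbrs \<mu> U c) = 2" using h1(2) h2(2) by (simp add: card_Un_disjoint)
    then have "thin_side \<mu> U a b J" using h1 h2 s(3) unfolding thin_side_def by auto
    then show False using J(3) by blast
  qed
  then have "nonsep \<mu> ?B" using conns(3) unfolding nonsep_def by blast
  then show ?thesis using that J(2) by blast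
qed

section \<open>Weighted covers\<close>

lemma sum_posE:
  fixes g :: "'c \<Rightarrow> nat"
  assumes "0 < sum g S"
  obtains x where "x \<in> S" "0 < g x"
proof -
  have "sum g S \<noteq> 0" using assms by simp
  then obtain x where "x \<in> S" "g x \<noteq> 0" by (rule sum.not_neutral_contains_not_neutral)
  then show ?thesis using that by simp
qed

text \<open>The matchings of a cover enter as a degree bound: a colour of \<open>u\<close> sends at
  most \<open>\<mu> u v\<close> edges to all colours of \<open>v\<close> together. The vertex set is
  passed separately, so that it can shrink while \<mu>, \<open>X\<close> and \<open>m\<close> stay
  fixed.\<close>

locale cover_system =
  fixes \<mu> :: "'a \<Rightarrow> 'a \<Rightarrow> nat" and X :: "'a \<Rightarrow> 'b set" and m :: "'b \<Rightarrow> 'b \<Rightarrow> nat"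
  assumes mu: "sym_mult \<mu>" and m: "sym_mult m"
    and finite_X: "finite (X v)"
    and cov: "x \<in> X u \<Longrightarrow> (\<Sum>y\<in>X v. m x y) \<le> \<mu> u v"
begin

definition edges_to :: "'b \<Rightarrow> ('a \<Rightarrow> 'b) \<Rightarrow> 'a set \<Rightarrow> nat" where
  "edges_to x t S = (\<Sum>w\<in>S. m x (t w))"

definition choice :: "('a \<Rightarrow> 'b) \<Rightarrow> 'a set \<Rightarrow> bool" where
  "choice t S \<longleftrightarrow> (\<forall>u\<in>S. t u \<in> X u)"

definition sdegen :: "('b \<Rightarrow> nat) \<Rightarrow> ('a \<Rightarrow> 'b) \<Rightarrow> 'a set \<Rightarrow> bool" where
  "sdegen f t S \<longleftrightarrow> (\<forall>S'\<subseteq>S. S' \<noteq> {} \<longrightarrow> (\<exists>u\<in>S'. edges_to (t u) t S' < f (t u)))"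

text \<open>Truncation at 0 only overestimates the remaining weight, so the degree condition
  survives; and a colour of weight 0 can never be used in a strictly degenerate choice.\<close>

definition red :: "('b \<Rightarrow> nat) \<Rightarrow> ('a \<Rightarrow> 'b) \<Rightarrow> 'a set \<Rightarrow> 'b \<Rightarrow> nat" where
  "red f t A x = f x - edges_to x t A"

definition weighted :: "'a set \<Rightarrow> ('b \<Rightarrow> nat) \<Rightarrow> bool" where
  "weighted U f \<longleftrightarrow> finite U \<and> conn \<mu> U \<and> (\<forall>u\<in>U. (\<Sum>w\<in>U. \<mu> u w) \<le> (\<Sum>x\<in>X u. f x))"

definition hard :: "'a set \<Rightarrow> ('b \<Rightarrow> nat) \<Rightarrow> bool" where
  "hard U f \<longleftrightarrow> weighted U f \<and> (\<forall>t. choice t U \<longrightarrow> \<not> sdegen f t U)"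

definition hole :: "'a set \<Rightarrow> ('b \<Rightarrow> nat) \<Rightarrow> ('a \<Rightarrow> 'b) \<Rightarrow> 'a \<Rightarrow> bool" where
  "hole U f t v \<longleftrightarrow> v \<in> U \<and> choice t (U - {v}) \<and> sdegen f t (U - {v})"

text \<open>The colour at \<open>v\<close> is arbitrary, even weight 0 is allowed, so recolouring at
  the hole is free.\<close>

definition bad :: "'a set \<Rightarrow> ('b \<Rightarrow> nat) \<Rightarrow> ('a \<Rightarrow> 'b) \<Rightarrow> 'a \<Rightarrow> bool" where
  "bad U f t v \<longleftrightarrow> hole U f t v \<and> t v \<in> X v"

definition pos :: "('b \<Rightarrow> nat) \<Rightarrow> 'a \<Rightarrow> 'b set" where
  "pos f v = {x \<in> X v. 0 < f x}"

definition full :: "('b \<Rightarrow> nat) \<Rightarrow> 'a \<Rightarrow> 'a \<Rightarrow> bool" where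
  "full f u v \<longleftrightarrow> (\<forall>x\<in>pos f u. \<forall>y\<in>pos f v. 0 < m x y)"

definition all_full :: "'a set \<Rightarrow> ('b \<Rightarrow> nat) \<Rightarrow> bool" where
  "all_full U f \<longleftrightarrow> (\<forall>u\<in>U. \<forall>v\<in>U. 0 < \<mu> u v \<longrightarrow> full f u v)"

lemmas mu_sym = sym_multD(1)[OF mu] and mu_irrefl [simp] = sym_multD(2)[OF mu]
  and m_sym = sym_multD(1)[OF m] and m_irrefl [simp] = sym_multD(2)[OF m]

lemma cov': "y \<in> X w \<Longrightarrow> (\<Sum>x\<in>X u. m x y) \<le> \<mu> u w"
  using cov[of y w u] by (simp add: m_sym mu_sym)

lemma full_sym: "full f u v \<Longrightarrow> full f v u"
  unfolding full_def using m_sym by metis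

lemma finite_pos [simp]: "finite (pos f v)"
  using finite_X unfolding pos_def by simp

lemma posD: "x \<in> pos f v \<Longrightarrow> x \<in> X v" "x \<in> pos f v \<Longrightarrow> 0 < f x"
  by (auto simp: pos_def)

lemma m_le: "x \<in> X u \<Longrightarrow> y \<in> X v \<Longrightarrow> m x y \<le> \<mu> u v"
  using cov[of x u v] member_le_sum[of y "X v" "m x"] finite_X[of v] by force

lemma mu_pos: "x \<in> X u \<Longrightarrow> y \<in> X v \<Longrightarrow> 0 < m x y \<Longrightarrow> 0 < \<mu> u v"
  using m_le by fastforce

lemma edges_to_cong: "(\<And>w. w \<in> S \<Longrightarrow> t w = t' w) \<Longrightarrow> edges_to x t S = edges_to x t' S"
  unfolding edges_to_def by (rule sum.cong) auto

lemma edges_to_split: "finite S \<Longrightarrow> A \<subseteq> S \<Longrightarrow> edges_to x t S = edges_to x t (S - A) + edges_to x t A"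
  unfolding edges_to_def by (rule sum.subset_diff)

lemma edges_to_mono: "finite S \<Longrightarrow> A \<subseteq> S \<Longrightarrow> edges_to x t A \<le> edges_to x t S"
  using edges_to_split[of S A x t] by simp

lemma edges_to_remove: "finite S \<Longrightarrow> v \<in> S \<Longrightarrow> edges_to x t S = edges_to x t (S - {v}) + m x (t v)"
  using edges_to_split[of S "{v}" x t] by (simp add: edges_to_def)

lemma edges_to_insert: "finite S \<Longrightarrow> v \<notin> S \<Longrightarrow> edges_to x t (insert v S) = m x (t v) + edges_to x t S"
  by (simp add: edges_to_def)

lemma edges_to_Un: "finite S \<Longrightarrow> finite S' \<Longrightarrow> S \<inter> S' = {} \<Longrightarrow>
    edges_to x t (S \<union> S') = edges_to x t S + edges_to x t S'"
  by (simp add: edges_to_def sum.union_disjoint)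

lemma edges_to_self: "finite S \<Longrightarrow> edges_to (t v) t (S - {v}) = edges_to (t v) t S"
  by (cases "v \<in> S") (simp_all add: edges_to_remove[of S v])

lemma edges_to_ge: "finite S \<Longrightarrow> v \<in> S \<Longrightarrow> m x (t v) \<le> edges_to x t S"
  by (simp add: edges_to_remove)

lemma choice_cong: "(\<And>w. w \<in> S \<Longrightarrow> t w = t' w) \<Longrightarrow> choice t S = choice t' S"
  unfolding choice_def by auto

lemma choice_mono: "choice t S \<Longrightarrow> A \<subseteq> S \<Longrightarrow> choice t A"
  unfolding choice_def by blast

lemma sdegen_cong:
  assumes "\<And>w. w \<in> S \<Longrightarrow> t w = t' w"
  shows "sdegen f t S = sdegen f t' S"
proof -
  have "edges_to (t u) t S' = edges_to (t' u) t' S'" "t u = t' u" if "S' \<subseteq> S" "u \<in> S'" for S' u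
  proof -
    show "t u = t' u" using assms that by blast
    then show "edges_to (t u) t S' = edges_to (t' u) t' S'"
      using edges_to_cong[of S' t t'] assms that by auto
  qed
  then show ?thesis unfolding sdegen_def by metis
qed

lemma sdegen_mono: "sdegen f t S \<Longrightarrow> A \<subseteq> S \<Longrightarrow> sdegen f t A"
  unfolding sdegen_def by blast

lemma sdegen_pos:
  assumes "sdegen f t S" "v \<in> S"
  shows "0 < f (t v)"
proof -
  have "\<exists>u\<in>{v}. edges_to (t u) t {v} < f (t u)"
    using assms unfolding sdegen_def by blast
  then show ?thesis by simp
qed

lemma sdegen_singleton: "0 < f (t v) \<Longrightarrow> sdegen f t {v}"
  by (auto simp: sdegen_def edges_to_def subset_singleton_iff)

text \<open>A set not contained in \<open>A\<close> has, by the reduced weights, a member with few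
  edges into the part outside \<open>A\<close>; its edges into the part inside \<open>A\<close> are
  already charged to its weight.\<close>

lemma sdegen_combine:
  assumes "finite U" "A \<subseteq> U" "sdegen f t A" "sdegen (red f t A) t (U - A)"
  shows "sdegen f t U"
  unfolding sdegen_def
proof (intro allI impI)
  fix S assume S: "S \<subseteq> U" "S \<noteq> {}"
  show "\<exists>u\<in>S. edges_to (t u) t S < f (t u)"
  proof (cases "S \<subseteq> A")
    case True then show ?thesis using assms(3) S unfolding sdegen_def by blast
  next
    case False
    have "S - A \<subseteq> U - A" "S - A \<noteq> {}" using S False by blast+
    then obtain u where u: "u \<in> S - A" "edges_to (t u) t (S - A) < red f t A (t u)"
      using assms(4) unfolding sdegen_def by blast
    have fin: "finite S" "finite A" using assms S finite_subset by blast+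
    have "S - S \<inter> A = S - A" by blast
    then have "edges_to (t u) t S = edges_to (t u) t (S - A) + edges_to (t u) t (S \<inter> A)"
      using edges_to_split[of S "S \<inter> A" "t u" t] fin by simp
    moreover have "edges_to (t u) t (S \<inter> A) \<le> edges_to (t u) t A"
      using edges_to_mono[of A "S \<inter> A"] fin by simp
    ultimately have "edges_to (t u) t S < f (t u)" using u unfolding red_def by linarith
    then show ?thesis using u by blast
  qed
qed

lemma sdegen_insert:
  assumes "finite S" "sdegen f t S" "v \<notin> S" "edges_to (t v) t S < f (t v)"
  shows "sdegen f t (insert v S)"
proof -
  have "insert v S - S = {v}" using assms by blast
  then show ?thesis
    using sdegen_combine[of "insert v S" S f t] sdegen_singleton[of "red f t S" t v] assms
    by (simp add: subset_insertI red_def)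
qed

text \<open>Each coloured \<open>w\<close> costs the colours of \<open>u\<close> at most
  \<open>\<mu> u w\<close> units of weight together, and the degree of \<open>u\<close> drops by
  exactly that number.\<close>

lemma weighted_reduce:
  assumes "weighted U f" "A \<subseteq> U" "choice t A" "conn \<mu> (U - A)"
  shows "weighted (U - A) (red f t A)"
proof -
  have finA: "finite A" "finite U" using assms finite_subset unfolding weighted_def by blast+
  have "(\<Sum>w\<in>U - A. \<mu> u w) \<le> (\<Sum>x\<in>X u. red f t A x)" if "u \<in> U - A" for u
  proof -
    have "(\<Sum>w\<in>U - A. \<mu> u w) + (\<Sum>w\<in>A. \<mu> u w) = (\<Sum>w\<in>U. \<mu> u w)"
      using sum.subset_diff[of A U "\<mu> u"] assms(2) finA by simp
    also have "\<dots> \<le> (\<Sum>x\<in>X u. f x)" using assms(1) that unfolding weighted_def by blast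
    also have "\<dots> \<le> (\<Sum>x\<in>X u. red f t A x + edges_to x t A)"
      by (rule sum_mono) (simp add: red_def)
    also have "\<dots> = (\<Sum>x\<in>X u. red f t A x) + (\<Sum>x\<in>X u. edges_to x t A)" by (rule sum.distrib)
    also have "(\<Sum>x\<in>X u. edges_to x t A) = (\<Sum>w\<in>A. \<Sum>x\<in>X u. m x (t w))"
      unfolding edges_to_def by (rule sum.swap)
    also have "\<dots> \<le> (\<Sum>w\<in>A. \<mu> u w)"
    proof (rule sum_mono)
      fix w assume "w \<in> A"
      then show "(\<Sum>x\<in>X u. m x (t w)) \<le> \<mu> u w" using cov' assms(3) unfolding choice_def by blast
    qed
    finally show ?thesis by simp
  qed
  then show ?thesis using assms finA unfolding weighted_def by simp
qed

lemma hard_reduce: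
  assumes "hard U f" "A \<subseteq> U" "choice t A" "sdegen f t A" "conn \<mu> (U - A)"
  shows "hard (U - A) (red f t A)"
  unfolding hard_def
proof (intro conjI allI impI)
  show "weighted (U - A) (red f t A)" using weighted_reduce assms unfolding hard_def by blast
  fix s assume s: "choice s (U - A)"
  show "\<not> sdegen (red f t A) s (U - A)"
  proof
    assume sd: "sdegen (red f t A) s (U - A)"
    define s' where "s' w = (if w \<in> A then t w else s w)" for w
    have "red f t A = red f s' A"
      unfolding red_def using edges_to_cong[of A t s'] by (simp add: s'_def fun_eq_iff)
    then have "sdegen (red f s' A) s' (U - A)"
      using sd sdegen_cong[of "U - A" s s' "red f t A"] by (simp add: s'_def)
    moreover have "sdegen f s' A" using assms(4) sdegen_cong[of A t s' f] by (simp add: s'_def)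
    moreover have "finite U" using assms unfolding hard_def weighted_def by blast
    ultimately have "sdegen f s' U" using sdegen_combine assms(2) by blast
    moreover have "choice s' U" using s assms(3) unfolding choice_def s'_def by auto
    ultimately show False using assms(1) unfolding hard_def by blast
  qed
qed

lemma weighted_pos:
  assumes "weighted U f" "v \<in> U" "U \<noteq> {v}"
  shows "pos f v \<noteq> {}"
proof
  assume e: "pos f v = {}"
  have "conn \<mu> U" "finite U" using assms unfolding weighted_def by auto
  then obtain w where w: "w \<in> U" "0 < \<mu> v w" using conn_nbr[OF mu _ assms(2,3)] by blast
  have "\<mu> v w \<le> (\<Sum>w\<in>U. \<mu> v w)" using member_le_sum[of w U "\<mu> v"] w \<open>finite U\<close> by simp
  also have "\<dots> \<le> (\<Sum>x\<in>X v. f x)" using assms unfolding weighted_def by blast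
  also have "\<dots> = 0" using e unfolding pos_def by simp
  finally show False using w by simp
qed

text \<open>Colour greedily, a non-cut vertex other than \<open>v\<close> first: each vertex is coloured while one of
  its neighbours is still uncoloured, so the weights never run out.\<close>

lemma hole_exists:
  assumes "weighted U f" "v \<in> U"
  obtains t where "hole U f t v"
proof -
  have "\<exists>t. hole U f t v" using assms
  proof (induction "card U" arbitrary: U f rule: less_induct)
    case less
    have fin: "finite U" and con: "conn \<mu> U" using less.prems unfolding weighted_def by auto
    show ?case
    proof (cases "U = {v}")
      case True
      then show ?thesis by (auto simp: hole_def choice_def sdegen_def)
    next
      case False
      then obtain w where w: "w \<in> U - {v}" "conn \<mu> (U - {w})"
        using conn_noncut[OF mu fin con less.prems(2)] by blast
      have "U \<noteq> {w}" using w less.prems by blast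
      then obtain x where x: "x \<in> pos f w" using weighted_pos[OF less.prems(1)] w by blast
      let ?t = "\<lambda>_. x"
      have "weighted (U - {w}) (red f ?t {w})"
        using weighted_reduce[OF less.prems(1), of "{w}" ?t] w x by (simp add: choice_def posD)
      moreover have "card (U - {w}) < card U" using w fin by (meson DiffD1 card_Diff1_less)
      ultimately obtain s where s: "hole (U - {w}) (red f ?t {w}) s v"
        using less.hyps less.prems w by blast
      let ?s = "s(w := x)"
      have rd: "red f ?t {w} = red f ?s {w}" by (simp add: red_def edges_to_def fun_eq_iff)
      have eq: "U - {w} - {v} = U - {v} - {w}" by blast
      have "sdegen (red f ?s {w}) ?s (U - {v} - {w})"
        using s rd eq sdegen_cong[of "U - {v} - {w}" s ?s] unfolding hole_def by simp
      moreover have "sdegen f ?s {w}" using sdegen_singleton[of f ?s w] x by (simp add: posD)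
      ultimately have "sdegen f ?s (U - {v})"
        using sdegen_combine[of "U - {v}" "{w}" f ?s] fin w by simp
      moreover have "choice ?s (U - {v})"
        using s x unfolding hole_def choice_def pos_def by auto
      ultimately show ?thesis using less.prems unfolding hole_def by blast
    qed
  qed
  then show ?thesis using that by blast
qed

lemma hole_extend:
  assumes "weighted U f" "v \<in> U" "A \<subseteq> U - {v}" "conn \<mu> (U - A)" "choice t A" "sdegen f t A"
  obtains s where "hole U f s v" "\<And>w. w \<in> A \<Longrightarrow> s w = t w"
proof -
  have AU: "A \<subseteq> U" "finite U" using assms unfolding weighted_def by auto
  have "weighted (U - A) (red f t A)" "v \<in> U - A" using weighted_reduce AU assms by auto
  then obtain r where r: "hole (U - A) (red f t A) r v" using hole_exists by blast
  define s where "s w = (if w \<in> A then t w else r w)" for w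
  have rd: "red f t A = red f s A"
    unfolding red_def using edges_to_cong[of A t s] by (simp add: s_def fun_eq_iff)
  have eq: "U - A - {v} = U - {v} - A" by blast
  have "sdegen (red f s A) s (U - {v} - A)"
    using r rd eq sdegen_cong[of "U - {v} - A" r s] unfolding hole_def by (simp add: s_def)
  moreover have "sdegen f s A" using assms(6) sdegen_cong[of A t s f] by (simp add: s_def)
  ultimately have "sdegen f s (U - {v})"
    using sdegen_combine[of "U - {v}" A f s] AU assms(3) by simp
  moreover have "choice s (U - {v})" using r assms(5) unfolding hole_def choice_def s_def by auto
  ultimately show ?thesis using that[of s] assms(2) unfolding hole_def s_def by auto
qed

lemma hardD:
  assumes "hard U f"
  shows "weighted U f" "finite U" "conn \<mu> U"
  using assms unfolding hard_def weighted_def by auto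

text \<open>A colour \<open>x\<close> of \<open>v\<close> with fewer than \<open>f x\<close> edges
  to the coloured part would complete a strictly degenerate choice. Summing over the colours of
  \<open>v\<close> closes the chain degree \<le> weight \<le> edges \<le> degree, so equality holds
  in every term.\<close>

lemma hole_tight:
  assumes "hard U f" "hole U f t v"
  shows "\<And>x. x \<in> X v \<Longrightarrow> edges_to x t (U - {v}) = f x"
    and "\<And>w. w \<in> U - {v} \<Longrightarrow> (\<Sum>x\<in>X v. m x (t w)) = \<mu> v w"
proof -
  let ?S = "U - {v}"
  have fin: "finite U" and v: "v \<in> U" using assms unfolding hole_def by (auto dest: hardD)
  have ge: "f x \<le> edges_to x t ?S" if "x \<in> X v" for x
  proof (rule ccontr)
    assume "\<not> f x \<le> edges_to x t ?S"
    moreover have "edges_to x (t(v := x)) ?S = edges_to x t ?S" by (rule edges_to_cong) simp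
    moreover have "sdegen f (t(v := x)) ?S"
      using assms(2) sdegen_cong[of ?S "t(v := x)" t f] unfolding hole_def by simp
    ultimately have "sdegen f (t(v := x)) (insert v ?S)"
      using sdegen_insert[of ?S f "t(v := x)" v] fin by simp
    moreover have "choice (t(v := x)) U" using assms(2) that unfolding hole_def choice_def by auto
    ultimately show False using assms(1) v unfolding hard_def by (metis insert_Diff)
  qed
  have le: "(\<Sum>x\<in>X v. m x (t w)) \<le> \<mu> v w" if "w \<in> ?S" for w
    using cov'[of "t w" w v] assms(2) that unfolding hole_def choice_def by blast
  have "(\<Sum>w\<in>?S. \<mu> v w) = (\<Sum>w\<in>U. \<mu> v w)" using sum.remove[OF fin v, of "\<mu> v"] by simp
  also have "\<dots> \<le> (\<Sum>x\<in>X v. f x)" using assms(1) v unfolding hard_def weighted_def by blast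
  finally have 1: "(\<Sum>w\<in>?S. \<mu> v w) \<le> (\<Sum>x\<in>X v. f x)" .
  have 2: "(\<Sum>x\<in>X v. f x) \<le> (\<Sum>x\<in>X v. edges_to x t ?S)" by (rule sum_mono) (rule ge)
  have 3: "(\<Sum>x\<in>X v. edges_to x t ?S) = (\<Sum>w\<in>?S. \<Sum>x\<in>X v. m x (t w))"
    unfolding edges_to_def by (rule sum.swap)
  have 4: "(\<Sum>w\<in>?S. \<Sum>x\<in>X v. m x (t w)) \<le> (\<Sum>w\<in>?S. \<mu> v w)" by (rule sum_mono) (rule le)
  have eq1: "(\<Sum>x\<in>X v. f x) = (\<Sum>x\<in>X v. edges_to x t ?S)" using 1 2 3 4 by linarith
  have eq2: "(\<Sum>w\<in>?S. \<Sum>x\<in>X v. m x (t w)) = (\<Sum>w\<in>?S. \<mu> v w)" using 1 2 3 4 by linarith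
  show "edges_to x t ?S = f x" if "x \<in> X v" for x
    using sum_mono_inv[OF eq1 ge that finite_X] by simp
  show "(\<Sum>x\<in>X v. m x (t w)) = \<mu> v w" if "w \<in> ?S" for w
    using sum_mono_inv[OF eq2 le that] fin by simp
qed

lemma bad_of_hole:
  assumes "hole U f t v" "x \<in> X v"
  shows "bad U f (t(v := x)) v"
  using assms choice_cong[of "U - {v}" "t(v := x)" t] sdegen_cong[of "U - {v}" "t(v := x)" t f]
  unfolding bad_def hole_def by simp

lemma badD:
  assumes "bad U f t v"
  shows "hole U f t v" "v \<in> U" "choice t U" "t v \<in> X v"
  using assms unfolding bad_def hole_def choice_def by auto

lemma bad_swap: "bad U f t v \<Longrightarrow> x \<in> X v \<Longrightarrow> bad U f (t(v := x)) v"
  using bad_of_hole badD by blast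

lemma bad_degree:
  assumes "hard U f" "bad U f t v"
  shows "edges_to (t v) t U = f (t v)"
  using hole_tight(1)[OF assms(1) badD(1,4)[OF assms(2)]] edges_to_self hardD(2)[OF assms(1)]
  by metis

text \<open>The hole moves from \<open>v\<close> to \<open>u\<close>: a set containing
  \<open>v\<close> but not \<open>u\<close> misses at least one of the exactly
  \<open>f (t v)\<close> edges at \<open>t v\<close>, and a set without \<open>v\<close> is covered
  by the old hole.\<close>

lemma bad_step:
  assumes "hard U f" "bad U f t v" "u \<in> U" "0 < m (t v) (t u)"
  shows "bad U f t u"
proof -
  have fin: "finite U" using assms hardD by blast
  have "sdegen f t (U - {u})"
    unfolding sdegen_def
  proof (intro allI impI)
    fix S assume S: "S \<subseteq> U - {u}" "S \<noteq> {}"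
    show "\<exists>w\<in>S. edges_to (t w) t S < f (t w)"
    proof (cases "v \<in> S")
      case True
      have "edges_to (t v) t S \<le> edges_to (t v) t (U - {u})" using edges_to_mono S fin by simp
      also have "\<dots> < edges_to (t v) t U" using edges_to_remove[OF fin assms(3)] assms(4) by simp
      also have "\<dots> = f (t v)" using bad_degree assms by blast
      finally show ?thesis using True by blast
    next
      case False
      then show ?thesis using S badD(1)[OF assms(2)] unfolding hole_def sdegen_def by blast
    qed
  qed
  then show ?thesis using assms(3) badD(3)[OF assms(2)] unfolding bad_def hole_def choice_def by blast
qed

lemma bad_spreads:
  assumes "hard U f" "bad U f t v" "conn (\<lambda>a b. m (t a) (t b)) W" "v \<in> W" "W \<subseteq> U" "u \<in> W"
  shows "bad U f t u"
proof -
  have "{w \<in> W. bad U f t w} = W"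
    by (rule conn_closed[OF assms(3)]) (use assms bad_step in auto)
  then show ?thesis using assms by blast
qed

lemma bad_pos:
  assumes "bad U f t v" "u \<in> U" "u \<noteq> v"
  shows "t u \<in> pos f u"
  using assms sdegen_pos[of f t "U - {v}" u] unfolding bad_def hole_def choice_def pos_def by auto

text \<open>A strictly degenerate partial colouring with connected remainder extends to a hole,
  where \<open>x\<close> is tight. Later contradictions arise by overloading such a colour.\<close>

lemma extend_le:
  assumes "hard U f" "v \<in> U" "A \<subseteq> U - {v}" "conn \<mu> (U - A)" "choice t A" "sdegen f t A" "x \<in> X v"
  shows "edges_to x t A \<le> f x"
proof -
  obtain s where s: "hole U f s v" "\<And>w. w \<in> A \<Longrightarrow> s w = t w"
    using hole_extend[OF hardD(1)[OF assms(1)] assms(2-6)] by blast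
  have "edges_to x t A = edges_to x s A" using edges_to_cong[of A s t] s(2) by simp
  also have "\<dots> \<le> edges_to x s (U - {v})"
    using edges_to_mono[of "U - {v}" A] assms(3) hardD(2)[OF assms(1)] by simp
  also have "\<dots> = f x" using hole_tight(1)[OF assms(1) s(1) assms(7)] .
  finally show ?thesis .
qed

end

section \<open>Hard weights on a nonseparable vertex set\<close>

locale hard_block = cover_system +
  fixes U :: "'a set" and f :: "'b \<Rightarrow> nat"
  assumes hard: "hard U f" and ns: "nonsep \<mu> U"
begin

lemmas wtd = hardD(1)[OF hard] and finU = hardD(2)[OF hard] and connU = hardD(3)[OF hard]

lemma conn_remove: "c \<in> U \<Longrightarrow> U \<noteq> {c} \<Longrightarrow> conn \<mu> (U - {c})"
  using nonsepD(2)[OF ns] .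

lemma hole_with:
  assumes "u \<in> U" "v \<in> U" "u \<noteq> v" "x \<in> pos f u"
  obtains t where "hole U f t v" "t u = x"
proof -
  have "conn \<mu> (U - {u})" using conn_remove assms by blast
  moreover have "choice (\<lambda>_. x) {u}" "sdegen f (\<lambda>_. x) {u}"
    using sdegen_singleton[of f "\<lambda>_. x" u] assms(4) by (simp_all add: choice_def posD)
  ultimately obtain t where "hole U f t v" "\<And>w. w \<in> {u} \<Longrightarrow> t w = x"
    using hole_extend[OF wtd assms(2), of "{u}" "\<lambda>_. x"] assms by blast
  then show ?thesis using that by blast
qed

text \<open>With \<open>y\<close> at \<open>u\<close> and the hole at \<open>v\<close>, tightness
  leaves no edge from \<open>x\<close> to the coloured part.\<close>

lemma zero_no_edge:
  assumes "u \<in> U" "v \<in> U" "u \<noteq> v" "x \<in> X v" "f x = 0" "y \<in> pos f u"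
  shows "m x y = 0"
proof -
  obtain t where t: "hole U f t v" "t u = y" using hole_with[OF assms(1-3,6)] by blast
  have "m x (t u) \<le> edges_to x t (U - {v})" using edges_to_ge[of "U - {v}" u] finU assms by simp
  then show ?thesis using hole_tight(1)[OF hard t(1) assms(4)] assms(5) t(2) by simp
qed

text \<open>Tightness at \<open>v\<close> forces equality in the cover bound, and colours of weight
  0 contribute nothing.\<close>

lemma perfect:
  assumes "u \<in> U" "v \<in> U" "u \<noteq> v" "x \<in> pos f u"
  shows "(\<Sum>y\<in>pos f v. m x y) = \<mu> u v"
proof -
  obtain t where t: "hole U f t v" "t u = x" using hole_with[OF assms] by blast
  have "(\<Sum>y\<in>pos f v. m x y) = (\<Sum>y\<in>X v. m x y)"
  proof (rule sum.mono_neutral_left)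
    show "\<forall>y\<in>X v - pos f v. m x y = 0"
      using zero_no_edge[OF assms(1-3)] assms(4) m_sym unfolding pos_def by auto
  qed (auto simp: finite_X pos_def)
  also have "\<dots> = (\<Sum>y\<in>X v. m y (t u))" using m_sym t(2) by metis
  also have "\<dots> = \<mu> v u" using hole_tight(2)[OF hard t(1), of u] assms by blast
  finally show ?thesis using mu_sym by metis
qed

lemma colour_nbr:
  assumes "u \<in> U" "v \<in> U" "0 < \<mu> u v" "x \<in> pos f u"
  obtains y where "y \<in> pos f v" "0 < m x y"
proof -
  have "u \<noteq> v" using assms by auto
  then have "(\<Sum>y\<in>pos f v. m x y) > 0" using perfect assms by simp
  then show ?thesis using that sum_posE[of "m x" "pos f v"] by blast
qed

lemma pos_nonempty: "v \<in> U \<Longrightarrow> U \<noteq> {v} \<Longrightarrow> pos f v \<noteq> {}"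
  using weighted_pos[OF wtd] .

lemma card_pos_eq:
  assumes "u \<in> U" "v \<in> U"
  shows "card (pos f u) = card (pos f v)"
proof -
  have step: "card (pos f u) = card (pos f v)" if "u \<in> U" "v \<in> U" "0 < \<mu> u v" for u v
  proof -
    have ne: "u \<noteq> v" using that by auto
    have "card (pos f u) * \<mu> u v = (\<Sum>x\<in>pos f u. \<Sum>y\<in>pos f v. m x y)"
      using perfect[OF that(1,2) ne] by simp
    also have "\<dots> = (\<Sum>y\<in>pos f v. \<Sum>x\<in>pos f u. m y x)"
      by (subst sum.swap) (simp add: m_sym)
    also have "\<dots> = card (pos f v) * \<mu> u v"
      using perfect[OF that(2,1)] ne mu_sym[of v u] by simp
    finally show ?thesis using that by simp
  qed
  have "{w \<in> U. card (pos f w) = card (pos f u)} = U"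
    by (rule conn_closed[OF connU]) (use assms step in auto)
  then have "v \<in> {w \<in> U. card (pos f w) = card (pos f u)}" using assms(2) by simp
  then show ?thesis by simp
qed

text \<open>Recolour \<open>v\<close> by a positive colour \<open>x\<close> adjacent to
  \<open>t u\<close>. Badness returns from \<open>v\<close> to \<open>u\<close>, so
  \<open>t u\<close> has degree \<open>f (t u)\<close> before and after, and \<open>t v\<close>
  receives as many edges from it as \<open>x\<close>.\<close>

lemma adjacent_colours_if_bad:
  assumes "bad U f t v" "bad U f t u" "0 < \<mu> u v"
  shows "0 < m (t u) (t v)"
proof -
  have uv: "u \<in> U" "v \<in> U" "u \<noteq> v" using assms badD by auto
  have "t u \<in> pos f u" using bad_pos[OF assms(1) uv(1,3)] .
  then obtain x where x: "x \<in> pos f v" "0 < m (t u) x" using colour_nbr uv assms(3) by blast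
  let ?t = "t(v := x)"
  have "bad U f ?t v" using bad_swap assms(1) x by (simp add: posD)
  then have "bad U f ?t u" using bad_step[OF hard, of ?t v u] uv x m_sym[of x] by simp
  then have "edges_to (t u) ?t U = f (t u)" using bad_degree[OF hard, of ?t u] uv by simp
  moreover have "edges_to (t u) t U = f (t u)" using bad_degree[OF hard assms(2)] .
  moreover have "edges_to (t u) ?t (U - {v}) = edges_to (t u) t (U - {v})"
    by (rule edges_to_cong) simp
  ultimately have "m (t u) x = m (t u) (t v)"
    using edges_to_remove[OF finU uv(2), of "t u" t] edges_to_remove[OF finU uv(2), of "t u" ?t] by simp
  then show ?thesis using x by simp
qed

lemma conn_colours_mono:
  assumes "conn \<mu> S" "\<And>a b. a \<in> S \<Longrightarrow> b \<in> S \<Longrightarrow> 0 < \<mu> a b \<Longrightarrow> 0 < m (t a) (t b)"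
  shows "conn (\<lambda>a b. m (t a) (t b)) S"
  using assms unfolding conn_def by (meson DiffD1 subsetD)

text \<open>If a bad choice is connected, then a swap at any vertex yields another connected bad choice.\<close>

lemma all_full_if_conn:
  assumes "bad U f t v" "conn (\<lambda>a b. m (t a) (t b)) U"
  shows "all_full U f"
proof -
  define good where "good t \<longleftrightarrow> (\<forall>u\<in>U. bad U f t u) \<and> (\<forall>a\<in>U. \<forall>b\<in>U. 0 < \<mu> a b \<longrightarrow> 0 < m (t a) (t b))" for t
  have good0: "good t" unfolding good_def
    using bad_spreads[OF hard assms(1,2)] badD(2)[OF assms(1)] adjacent_colours_if_bad by blast
  have swap: "good (s(w := x))" if s: "good s" and w: "w \<in> U" and x: "x \<in> pos f w" for s w x
  proof (cases "U = {w}")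
    case True
    then show ?thesis using s bad_swap[of U f s w x] x unfolding good_def by (auto simp: posD)
  next
    case False
    let ?s = "s(w := x)"
    have cw: "conn \<mu> (U - {w})" using conn_remove w False by blast
    have b: "bad U f ?s w" using bad_swap s w x unfolding good_def by (simp add: posD)
    then have "edges_to x ?s U = f x" using bad_degree[OF hard, of ?s w] by simp
    \<comment> \<open>Positive weight gives the new colour an edge to some untouched vertex; the old
      colours remain connected without \<open>w\<close>, so badness spreads through all of
      them.\<close>
    then have "0 < edges_to x ?s U" using x by (simp add: posD)
    then obtain u where u: "u \<in> U" "0 < m x (?s u)"
      unfolding edges_to_def using sum_posE by blast
    then have uw: "u \<in> U - {w}" by (cases "u = w") auto
    have bu: "bad U f ?s u" using bad_step[OF hard b u(1)] u by simp
    have "conn (\<lambda>a b. m (?s a) (?s b)) (U - {w})"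
      by (rule conn_colours_mono[OF cw]) (use s in \<open>auto simp: good_def\<close>)
    then have "bad U f ?s z" if "z \<in> U - {w}" for z using bad_spreads[OF hard bu _ uw _ that] by blast
    then have all: "\<forall>z\<in>U. bad U f ?s z" using b by blast
    then show ?thesis unfolding good_def using adjacent_colours_if_bad by blast
  qed
  have full: "full f a b" if ab: "a \<in> U" "b \<in> U" "0 < \<mu> a b" for a b
    unfolding full_def
  proof (intro ballI)
    fix x y assume xy: "x \<in> pos f a" "y \<in> pos f b"
    have "good (t(a := x, b := y))" using swap good0 ab xy by blast
    moreover have "a \<noteq> b" using ab by auto
    ultimately show "0 < m x y" using ab unfolding good_def by (metis fun_upd_same fun_upd_other)
  qed
  then show ?thesis unfolding all_full_def by blast
qed

text \<open>Conversely, all choices of positive colours are then tight, so the multiplicities between two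
  colour classes are constant.\<close>

lemma all_full_bad:
  assumes af: "all_full U f" and c: "\<And>u. u \<in> U \<Longrightarrow> t u \<in> pos f u" and v: "v \<in> U"
  shows "bad U f t v"
proof (cases "U = {v}")
  case True
  then show ?thesis using c by (auto simp: bad_def hole_def choice_def sdegen_def posD)
next
  case False
  obtain s where s: "hole U f s v" using hole_exists[OF wtd v] by blast
  have swap: "\<forall>u\<in>U. bad U f t' u" if "w \<in> U" "bad U f t' w" "t' w \<in> pos f w" for t' w
  proof -
    have "t' u \<in> pos f u" if "u \<in> U" for u
      using bad_pos[OF \<open>bad U f t' w\<close> that] \<open>t' w \<in> pos f w\<close> by (cases "u = w") auto
    then have "conn (\<lambda>a b. m (t' a) (t' b)) U"
      using conn_colours_mono[OF connU, of t'] af unfolding all_full_def full_def by blast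
    then show ?thesis using bad_spreads[OF hard that(2)] that(1) by blast
  qed
  \<comment> \<open>\<open>F\<close> collects the vertices already carrying the colour of
    \<open>t\<close>. It starts as \<open>{v}\<close>, where the hole accepts any colour; fullness
    makes the choice bad everywhere again after each recolouring.\<close>
  have "\<forall>u\<in>U. bad U f (\<lambda>w. if w \<in> F then t w else s w) u" if "F \<subseteq> U" "v \<in> F" for F
  proof -
    have "finite (F - {v})" using that finU finite_subset by blast
    then show ?thesis using that
    proof (induction "F - {v}" arbitrary: F rule: finite_induct)
      case empty
      then have F: "F = {v}" by blast
      have "bad U f (s(v := t v)) v" using bad_of_hole[OF s] posD(1)[OF c[OF v]] by blast
      moreover have "s(v := t v) = (\<lambda>w. if w \<in> F then t w else s w)" using F by auto
      ultimately show ?case using swap[of v] c v F by simp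
    next
      case (insert x G)
      let ?t = "\<lambda>w. if w \<in> F - {x} then t w else s w"
      have x: "x \<in> F" "x \<noteq> v" "x \<in> U" using insert by blast+
      have "F - {x} - {v} = G" using insert.hyps by blast
      then have "\<forall>u\<in>U. bad U f ?t u" using insert.hyps(3)[of "F - {x}"] insert.prems x by blast
      then have "bad U f (?t(x := t x)) x" using bad_swap x posD(1)[OF c[OF x(3)]] by blast
      moreover have "?t(x := t x) = (\<lambda>w. if w \<in> F then t w else s w)" using x by auto
      ultimately show ?case using swap[of x] c x by simp
    qed
  qed
  from this[of U] have "bad U f (\<lambda>w. if w \<in> U then t w else s w) v" using v by blast
  moreover have "sdegen f (\<lambda>w. if w \<in> U then t w else s w) (U - {v}) = sdegen f t (U - {v})"
    by (rule sdegen_cong) simp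
  ultimately show ?thesis using c v unfolding bad_def hole_def choice_def by (auto simp: posD)
qed

text \<open>Recolouring \<open>v\<close> within its positive colours keeps the choice bad at
  \<open>u\<close>, so the degree of \<open>t u\<close>, and with it its multiplicity to
  \<open>v\<close>, does not change; \<open>perfect\<close> adds up these equal terms.\<close>

lemma all_full_uniform:
  assumes af: "all_full U f" and c: "\<And>u. u \<in> U \<Longrightarrow> t u \<in> pos f u"
    and uv: "u \<in> U" "v \<in> U" "u \<noteq> v"
  shows "\<mu> u v = card (pos f v) * m (t u) (t v)"
proof -
  have "m (t u) x = m (t u) (t v)" if x: "x \<in> pos f v" for x
  proof -
    let ?t = "t(v := x)"
    have "bad U f t u" "bad U f ?t u" using all_full_bad[OF af, of _ u] c x uv by auto
    then have "edges_to (t u) t U = f (t u)" "edges_to (t u) ?t U = f (t u)"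
      using bad_degree[OF hard, of _ u] uv by fastforce+
    moreover have "edges_to (t u) ?t (U - {v}) = edges_to (t u) t (U - {v})"
      by (rule edges_to_cong) simp
    ultimately show ?thesis
      using edges_to_remove[OF finU uv(2), of "t u" t] edges_to_remove[OF finU uv(2), of "t u" ?t] by simp
  qed
  then have "(\<Sum>x\<in>pos f v. m (t u) x) = card (pos f v) * m (t u) (t v)" by simp
  then show ?thesis using perfect[OF uv c] uv by simp
qed

end

context cover_system
begin

lemma hard_blockI: "hard U f \<Longrightarrow> nonsep \<mu> U \<Longrightarrow> hard_block \<mu> X m U f"
  by unfold_locales

definition complete_on :: "'a set \<Rightarrow> bool" where
  "complete_on S \<longleftrightarrow> (\<forall>u\<in>S. \<forall>v\<in>S. u \<noteq> v \<longrightarrow> 0 < \<mu> u v)"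

definition two_nbrs :: "'a set \<Rightarrow> bool" where
  "two_nbrs S \<longleftrightarrow> (\<forall>v\<in>S. card (nbrs \<mu> S v) = 2)"

definition no_full :: "'a set \<Rightarrow> ('b \<Rightarrow> nat) \<Rightarrow> bool" where
  "no_full S f \<longleftrightarrow> (\<forall>u\<in>S. \<forall>v\<in>S. 0 < \<mu> u v \<longrightarrow> \<not> full f u v)"

text \<open>\<open>no_full\<close> belongs to the induction statement so that one full edge in a
  smaller block already forces \<open>all_full\<close> there.\<close>

definition trichotomy :: "'a set \<Rightarrow> ('b \<Rightarrow> nat) \<Rightarrow> bool" where
  "trichotomy S f \<longleftrightarrow> all_full S f \<or> (no_full S f \<and> (complete_on S \<or> two_nbrs S))"

lemma sdegen_weight_mono:
  assumes "sdegen f t S" "\<And>v. v \<in> S \<Longrightarrow> f (t v) \<le> g (t v)"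
  shows "sdegen g t S"
  unfolding sdegen_def
proof (intro allI impI)
  fix S' assume S': "S' \<subseteq> S" "S' \<noteq> {}"
  then obtain u where u: "u \<in> S'" "edges_to (t u) t S' < f (t u)"
    using assms(1) unfolding sdegen_def by metis
  then have "edges_to (t u) t S' < g (t u)" using assms(2)[OF subsetD[OF S'(1)], of u] by simp
  then show "\<exists>u\<in>S'. edges_to (t u) t S' < g (t u)" by (rule bexI) (rule u(1))
qed

lemma conn_complete:
  assumes "complete_on S" "A \<subseteq> S" "A \<noteq> {}"
  shows "conn \<mu> A"
  unfolding conn_def
proof (intro conjI allI impI)
  fix B assume B: "B \<subseteq> A" "B \<noteq> {} \<and> B \<noteq> A"
  then obtain u w where uw: "u \<in> B" "w \<in> A - B" by blast
  then have "u \<in> S" "w \<in> S" "u \<noteq> w" using assms(2) B by blast+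
  then have "0 < \<mu> u w" using assms(1) unfolding complete_on_def by simp
  then show "\<exists>u\<in>B. \<exists>w\<in>A - B. 0 < \<mu> u w" using uw by blast
qed (rule assms(3))

end

context hard_block
begin

subsection \<open>Deleting a coloured vertex\<close>

context
  fixes v x
  assumes v: "v \<in> U" and x: "x \<in> pos f v" and ns': "nonsep \<mu> (U - {v})"
    and big: "\<And>u. U - {v} \<noteq> {u}"
    and af: "all_full (U - {v}) (red f (\<lambda>_. x) {v})" and naf: "\<not> all_full U f"
begin

private abbreviation "g \<equiv> red f (\<lambda>_. x) {v}"

private lemma g_eq: "g y = f y - m x y"
  by (simp add: red_def edges_to_def m_sym)

private lemma x_sd: "choice (\<lambda>_. x) {v}" "sdegen f (\<lambda>_. x) {v}"
  using x sdegen_singleton[of f "\<lambda>_. x" v] by (simp_all add: choice_def posD)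

private lemma hb: "hard_block \<mu> X m (U - {v}) g"
  using hard_blockI[OF hard_reduce[OF hard _ x_sd nonsepD(1)[OF ns']] ns'] v by simp

interpretation B: hard_block \<mu> X m "U - {v}" g
  by (rule hb)

text \<open>Otherwise \<open>y\<close> keeps positive weight after the deletion. A positive choice
  through \<open>y\<close> is bad for \<open>g\<close> everywhere, and since \<open>f y\<close>
  exceeds \<open>g y\<close>, it is strictly degenerate for \<open>f\<close> on all of
  \<open>U - {v}\<close>. With \<open>x\<close> at \<open>v\<close> it is bad and connected, which
  would force \<open>all_full U f\<close>.\<close>

lemma deleted_zero_or_weight:
  assumes w: "w \<in> U - {v}" and y: "y \<in> pos f w"
  shows "m x y = 0 \<or> m x y = f y"
proof (rule ccontr)
  assume neg: "\<not> ?thesis"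
  have "conn \<mu> (U - {v})" using nonsepD(1)[OF ns'] .
  then have "edges_to y (\<lambda>_. x) {v} \<le> f y"
    using extend_le[OF hard, of w "{v}" "\<lambda>_. x" y] w v x_sd y by (auto simp: posD)
  then have "m x y \<le> f y" by (simp add: edges_to_def m_sym)
  then have less: "0 < m x y" "m x y < f y" using neg by auto
  have "y \<in> pos g w" using y less(2) by (simp add: pos_def g_eq)
  moreover have "pos g u \<noteq> {}" if "u \<in> U - {v}" for u using B.pos_nonempty big that by blast
  then have "\<forall>u. \<exists>z. u \<in> U - {v} \<longrightarrow> z \<in> pos g u" by blast
  then obtain t0 where "\<And>u. u \<in> U - {v} \<Longrightarrow> t0 u \<in> pos g u" by metis
  moreover define t where "t = t0(w := y, v := x)"
  ultimately have t: "u \<in> U - {v} \<Longrightarrow> t u \<in> pos g u" for u by simp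
  have tw: "t w = y" "t v = x" using w unfolding t_def by auto
  have Bbad: "bad (U - {v}) g t u" if "u \<in> U - {v}" for u using B.all_full_bad[OF af, of t u] t that by blast
  have "sdegen f t (U - {v})"
    unfolding sdegen_def
  proof (intro allI impI)
    fix S assume S: "S \<subseteq> U - {v}" "S \<noteq> {}"
    show "\<exists>u\<in>S. edges_to (t u) t S < f (t u)"
    proof (cases "S = U - {v}")
      case True
      have "edges_to (t w) t S = g (t w)" using bad_degree[OF B.hard Bbad[OF w]] True by simp
      then show ?thesis using tw less w True g_eq by force
    next
      case False
      then obtain u where u: "u \<in> U - {v}" "u \<notin> S" using S by blast
      have "sdegen g t (U - {v} - {u})" using Bbad[OF u(1)] unfolding bad_def hole_def by blast
      then obtain z where "z \<in> S" "edges_to (t z) t S < g (t z)"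
        using S u unfolding sdegen_def by (metis Diff_insert0 Diff_empty subset_Diff_insert)
      then show ?thesis using g_eq[of "t z"] by force
    qed
  qed
  moreover have "choice t U" using t tw x unfolding choice_def pos_def by force
  ultimately have bad: "bad U f t v" using v unfolding bad_def hole_def choice_def by blast
  have symt: "sym_mult (\<lambda>a b. m (t a) (t b))" using m unfolding sym_mult_def by blast
  have "conn (\<lambda>a b. m (t a) (t b)) (U - {v})"
    by (rule conn_colours_mono[OF nonsepD(1)[OF ns']])
      (use af t in \<open>auto simp: all_full_def full_def\<close>)
  then have "conn (\<lambda>a b. m (t a) (t b)) (insert v (U - {v}))"
    using conn_insert[OF symt _ w, of v] tw less m_sym[of y x] by simp
  then show False using all_full_if_conn[OF bad] naf v by (simp add: insert_absorb)
qed

text \<open>The reduced weight of \<open>y\<close> is 0 and that of \<open>z\<close> stays positive,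
  and \<open>zero_no_edge\<close> applies to the remaining hard block.\<close>

lemma deleted_separates:
  assumes "w \<in> U - {v}" "w' \<in> U - {v}" "w \<noteq> w'" "y \<in> pos f w" "z \<in> pos f w'"
    and "0 < m x y" "m x z = 0"
  shows "m y z = 0"
proof -
  have "g y = 0" "0 < g z"
    using deleted_zero_or_weight[OF assms(1,4)] assms by (auto simp: g_eq posD)
  then show ?thesis
    using B.zero_no_edge[of w' w y z] assms by (auto simp: pos_def)
qed

text \<open>By \<open>deleted_separates\<close>, the vertices with a positive colour adjacent to
  \<open>x\<close> are closed under adjacency in \<open>U - {v}\<close>, so they are all of
  it.\<close>

lemma deleted_adjacent:
  assumes "w \<in> U - {v}"
  shows "0 < \<mu> v w"
proof -
  let ?Z = "{w \<in> U - {v}. \<exists>y\<in>pos f w. 0 < m x y}"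
  have "U \<noteq> {v}" using assms by blast
  then obtain u where u: "u \<in> U" "u \<noteq> v" "0 < \<mu> v u" using conn_nbr[OF mu connU v] by blast
  have "?Z = U - {v}"
  proof (rule conn_closed[OF nonsepD(1)[OF ns']])
    have "\<exists>y\<in>pos f u. 0 < m x y" using colour_nbr[OF v u(1,3) x] by blast
    then show "?Z \<noteq> {}" using u by blast
    fix p q assume p: "p \<in> ?Z" and q: "q \<in> U - {v}" "0 < \<mu> p q"
    then obtain y where y: "y \<in> pos f p" "0 < m x y" "p \<in> U - {v}" by blast
    obtain z where z: "z \<in> pos f q" "0 < m y z" using colour_nbr[of p q y] y q by blast
    have "p \<noteq> q" using q by auto
    then have "0 < m x z" using deleted_separates[OF y(3) q(1) _ y(1) z(1) y(2)] z(2) by auto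
    then show "q \<in> ?Z" using q z by blast
  qed blast
  then obtain y where "y \<in> pos f w" "0 < m x y" using assms by blast
  then show ?thesis using mu_pos[of x v y w] x by (simp add: posD)
qed

end

subsection \<open>Complete blocks\<close>

lemma bad_closed_edges:
  assumes "bad U f t c"
  shows "edges_to (t c) t {u \<in> U. bad U f t u} = f (t c)"
proof -
  have "edges_to (t c) t {u \<in> U. bad U f t u} = edges_to (t c) t U"
    unfolding edges_to_def
    by (rule sum.mono_neutral_left) (use finU bad_step[OF hard assms] in auto)
  then show ?thesis using bad_degree[OF hard assms] by simp
qed

text \<open>In the bad set \<open>v\<close> is exchanged for \<open>u\<close> with colour
  \<open>y\<close>. The bad colours other than \<open>t v\<close> are kept and extended to a hole at
  \<open>u\<close>. Were they strictly degenerate together with \<open>y\<close>, they would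
  overload \<open>t v\<close>; the violating set must consist of all of them, and comparing degrees
  shows that they see \<open>y\<close> exactly as they saw \<open>t v\<close>.\<close>

lemma twin:
  assumes comp: "complete_on U" and t: "bad U f t v" and u: "u \<in> U" "\<not> bad U f t u"
    and y: "y \<in> pos f u" "0 < m (t v) y"
  obtains s where "bad U f s u"
    "\<And>w. bad U f s w \<Longrightarrow> w = u \<or> (w \<noteq> v \<and> bad U f t w)"
    "\<And>c. bad U f t c \<Longrightarrow> c \<noteq> v \<Longrightarrow> bad U f s c \<and> m (t c) y = m (t c) (t v)"
proof -
  let ?W = "{c \<in> U. bad U f t c}" and ?C = "{c \<in> U. bad U f t c} - {v}"
  have v: "v \<in> U" "u \<noteq> v" using t u badD by auto
  have W: "insert v ?C = ?W" "v \<notin> ?C" "finite ?C" using t v finU by auto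
  have chC: "choice t ?C" using badD(3)[OF t] by (auto simp: choice_def)
  have sdC: "sdegen f t ?C"
    using sdegen_mono[of f t "U - {v}" ?C] badD(1)[OF t] unfolding hole_def by blast
  have "?C \<subseteq> U - {u}" "U - ?C \<subseteq> U" "U - ?C \<noteq> {}" using u v by auto
  then obtain s0 where s0: "hole U f s0 u" "\<And>w. w \<in> ?C \<Longrightarrow> s0 w = t w"
    using hole_extend[OF wtd u(1) _ conn_complete[OF comp] chC sdC] by metis
  define s where "s = s0(u := y)"
  have sC: "s w = t w" if "w \<in> ?C" for w using s0(2) u(2) that unfolding s_def by auto
  have su: "s u = y" unfolding s_def by simp
  have bu: "bad U f s u" using bad_of_hole[OF s0(1)] y unfolding s_def by (simp add: posD)
  have uC: "u \<notin> ?C" using u by blast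
  have eC: "edges_to z s ?C = edges_to z t ?C" for z by (rule edges_to_cong) (use sC in blast)
  have tight: "edges_to (t c) t ?C + m (t c) (t v) = f (t c)" if "bad U f t c" for c
    using bad_closed_edges[OF that] edges_to_insert[OF W(3,2), of "t c" t] W(1) by simp
  have "\<not> sdegen f s (insert u ?C)"
  proof
    assume sd: "sdegen f s (insert u ?C)"
    have A: "insert u ?C \<subseteq> U - {v}" "U - insert u ?C \<subseteq> U" "U - insert u ?C \<noteq> {}"
      using u v W by auto
    have "choice s (insert u ?C)" using su y sC chC unfolding choice_def pos_def by auto
    then have "edges_to (t v) s (insert u ?C) \<le> f (t v)"
      using extend_le[OF hard v(1) A(1) conn_complete[OF comp A(2,3)] _ sd] badD(4)[OF t] by blast
    moreover have "edges_to (t v) s (insert u ?C) = m (t v) y + edges_to (t v) t ?C"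
      using edges_to_insert[OF W(3) uC] su eC by simp
    moreover have "edges_to (t v) t ?C = f (t v)" using tight[OF t] by simp
    ultimately show False using y by simp
  qed
  then obtain S where S: "S \<subseteq> insert u ?C" "S \<noteq> {}" "\<And>c. c \<in> S \<Longrightarrow> f (s c) \<le> edges_to (s c) s S"
    unfolding sdegen_def using leI by metis
  have SU: "S \<subseteq> U" "v \<notin> S" "finite S" using S(1) u v W finU by (auto intro: finite_subset)
  have closed: "w \<in> S" if "c \<in> S" "bad U f s c" "w \<in> U" "0 < m (s c) (s w)" for c w
  proof (rule ccontr)
    assume "w \<notin> S"
    then have "edges_to (s c) s (insert w S) \<le> edges_to (s c) s U"
      using edges_to_mono[OF finU, of "insert w S"] SU that by simp
    moreover have "edges_to (s c) s U = f (s c)" using bad_degree[OF hard that(2)] .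
    ultimately show False
      using S(3)[OF that(1)] edges_to_insert[OF SU(3) \<open>w \<notin> S\<close>, of "s c" s] that(4) by simp
  qed
  have uS: "u \<in> S"
  proof (rule ccontr)
    assume "u \<notin> S"
    then have SC: "S \<subseteq> ?C" using S(1) by blast
    then obtain c where c: "c \<in> S" "edges_to (t c) t S < f (t c)"
      using sdC S(2) unfolding sdegen_def by blast
    have "edges_to (s c) s S = edges_to (t c) t S"
      using edges_to_cong[of S s t "t c"] sC SC c(1) by (metis subsetD)
    moreover have "s c = t c" using sC SC c(1) by blast
    ultimately show False using S(3)[OF c(1)] c by simp
  qed
  have "0 < edges_to y s S" using S(3)[OF uS] su posD(2)[OF y(1)] by simp
  then obtain c where c: "c \<in> S" "0 < m y (s c)" unfolding edges_to_def using sum_posE by blast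
  have "c \<noteq> u" using c su by auto
  then have cC: "c \<in> ?C" using c S(1) by blast
  have bc: "bad U f s c" using bad_step[OF hard bu, of c] c su cC by auto
  \<comment> \<open>In a complete block the bad vertices carry pairwise adjacent colours, so one of
    them in \<open>S\<close> pulls in all the others.\<close>
  have adj: "0 < m (t p) (t q)" if "p \<in> ?C" "q \<in> ?C" "p \<noteq> q" for p q
  proof -
    have pq: "bad U f t q" "bad U f t p" "p \<in> U" "q \<in> U" using that by blast+
    then have "0 < \<mu> p q" using comp that(3) unfolding complete_on_def by simp
    then show ?thesis by (rule adjacent_colours_if_bad[OF pq(1,2)])
  qed
  have all: "p \<in> S \<and> bad U f s p" if p: "p \<in> ?C" for p
  proof (cases "p = c")
    case True then show ?thesis using bc c by simp
  next
    case False
    have "0 < m (s c) (s p)" using adj[OF cC p] False sC[OF cC] sC[OF p] by simp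
    then show ?thesis using closed[OF c(1) bc] bad_step[OF hard bc] p by blast
  qed
  have Seq: "S = insert u ?C" using S(1) uS all by blast
  have eq: "m (t c) y = m (t c) (t v)" if "bad U f t c" "c \<noteq> v" for c
  proof -
    have cC: "c \<in> ?C" using that badD by blast
    have "edges_to (s c) s S = edges_to (s c) s U"
      unfolding edges_to_def
      by (rule sum.mono_neutral_left) (use finU SU closed[of c] all[OF cC] in auto)
    then have "edges_to (t c) s (insert u ?C) = f (t c)"
      using bad_degree[OF hard, of s c] all[OF cC] sC[OF cC] Seq by simp
    then have "m (t c) y + edges_to (t c) t ?C = f (t c)"
      using edges_to_insert[OF W(3) uC, of "t c" s] su eC by simp
    then show ?thesis using tight[OF that(1)] by simp
  qed
  have only: "w \<in> S" if "bad U f s w" for w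
  proof (rule ccontr)
    assume "w \<notin> S"
    then have "S \<subseteq> U - {w}" using SU by blast
    moreover have "sdegen f s (U - {w})" using that unfolding bad_def hole_def by blast
    ultimately obtain c where "c \<in> S" "edges_to (s c) s S < f (s c)"
      using S(2) unfolding sdegen_def by blast
    then show False using S(3)[of c] by simp
  qed
  show ?thesis
  proof (rule that[OF bu])
    show "w = u \<or> (w \<noteq> v \<and> bad U f t w)" if "bad U f s w" for w using only[OF that] Seq by blast
    show "bad U f s c \<and> m (t c) y = m (t c) (t v)" if "bad U f t c" "c \<noteq> v" for c
      using eq[OF that] all[of c] that badD(2)[OF that(1)] by blast
  qed
qed

lemma complete_not_all_bad:
  assumes "complete_on U" "\<not> all_full U f" "bad U f t v"
  obtains u where "u \<in> U" "\<not> bad U f t u"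
proof (rule ccontr)
  assume "\<not> thesis"
  then have "\<forall>u\<in>U. bad U f t u" using that by blast
  then have "conn (\<lambda>a b. m (t a) (t b)) U"
    using conn_colours_mono[OF connU] adjacent_colours_if_bad by blast
  then show False using all_full_if_conn assms by blast
qed

lemma bad_exists:
  assumes "v \<in> U" "x \<in> pos f v"
  obtains t where "bad U f t v" "t v = x"
proof -
  obtain t0 where "hole U f t0 v" using hole_exists[OF wtd assms(1)] by blast
  then have "bad U f (t0(v := x)) v" using bad_of_hole assms(2) by (simp add: posD)
  then show ?thesis using that by (metis fun_upd_same)
qed

text \<open>The ends of a full edge are bad together. Exchanging \<open>a\<close> for an outside
  vertex keeps \<open>b\<close> bad, and fullness would make \<open>a\<close> bad again, contrary to
  the exchange.\<close>

lemma no_full_complete: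
  assumes comp: "complete_on U" and naf: "\<not> all_full U f"
  shows "no_full U f"
  unfolding no_full_def
proof (intro ballI impI notI)
  fix a b assume ab: "a \<in> U" "b \<in> U" "0 < \<mu> a b" and full: "full f a b"
  have ne: "a \<noteq> b" using ab by auto
  then obtain x where x: "x \<in> pos f a" using pos_nonempty ab by blast
  obtain t where t: "bad U f t a" "t a = x" using bad_exists[OF ab(1) x] by blast
  have "t b \<in> pos f b" using bad_pos[OF t(1) ab(2)] ne by blast
  then have "0 < m (t a) (t b)" using full x t(2) unfolding full_def by blast
  then have tb: "bad U f t b" using bad_step[OF hard t(1) ab(2)] by blast
  obtain u where u: "u \<in> U" "\<not> bad U f t u" using complete_not_all_bad[OF comp naf t(1)] by blast
  have ua: "u \<noteq> a" using u t by blast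
  then have "0 < \<mu> a u" using comp u ab unfolding complete_on_def by auto
  then obtain y where y: "y \<in> pos f u" "0 < m (t a) y" using colour_nbr[OF ab(1) u(1)] x t(2) by blast
  obtain s where s: "bad U f s u" "\<And>w. bad U f s w \<Longrightarrow> w = u \<or> (w \<noteq> a \<and> bad U f t w)"
    "\<And>c. bad U f t c \<Longrightarrow> c \<noteq> a \<Longrightarrow> bad U f s c \<and> m (t c) y = m (t c) (t a)"
    using twin[OF comp t(1) u y] by blast
  have sb: "bad U f s b" using s(3)[OF tb] ne by blast
  have "s a \<in> pos f a" "s b \<in> pos f b"
    using bad_pos[OF sb ab(1) ne] bad_pos[OF s(1) ab(2)] u(2) tb by auto
  then have "0 < m (s b) (s a)" using full m_sym unfolding full_def by metis
  then have "bad U f s a" using bad_step[OF hard sb ab(1)] by blast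
  then show False using s(2)[of a] ua by blast
qed

text \<open>\<open>K1\<close> compares the edges from an outside vertex to two bad ones;
  \<open>K2\<close> compares such an edge with one inside the bad set, by applying \<open>K1\<close>
  to an exchanged choice. Two outside vertices are handled by exchanging one of them into the bad
  set.\<close>

lemma uniform_complete:
  assumes comp: "complete_on U" and naf: "\<not> all_full U f"
  obtains \<tau> where "\<And>p q. p \<in> U \<Longrightarrow> q \<in> U \<Longrightarrow> p \<noteq> q \<Longrightarrow> \<mu> p q = \<tau>"
proof -
  have twin_colour: "\<exists>y\<in>pos f u. 0 < m (t v) y"
    if "bad U f t v" "bad U f t c" "c \<noteq> v" "u \<in> U" "\<not> bad U f t u" for t v c u
  proof -
    have v: "v \<in> U" "v \<noteq> u" using that badD by auto
    have "t v \<in> pos f v" using bad_pos[OF that(2) v(1)] that(3) by blast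
    moreover have "0 < \<mu> v u" using comp v that(4) unfolding complete_on_def by blast
    ultimately show ?thesis using colour_nbr[OF v(1) that(4)] by blast
  qed
  have K1: "\<mu> u c = \<mu> u v"
    if b: "bad U f t v" "bad U f t c" "c \<noteq> v" and u: "u \<in> U" "\<not> bad U f t u" for t v c u
  proof -
    have U: "v \<in> U" "c \<in> U" "u \<noteq> v" "u \<noteq> c" using b u badD by auto
    have tp: "t v \<in> pos f v" "t c \<in> pos f c"
      using bad_pos[OF b(2) U(1)] bad_pos[OF b(1) U(2)] b(3) by auto
    have "0 < \<mu> v c" using comp U b(3) unfolding complete_on_def by auto
    then have adj: "0 < m (t v) (t c)" by (rule adjacent_colours_if_bad[OF b(2,1)])
    \<comment> \<open>If \<open>y\<close> is adjacent to one of the two colours, the exchange makes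
      it adjacent to the other, in both cases with multiplicity
      \<open>m (t v) (t c)\<close>.\<close>
    have "m (t c) y = m (t v) y" if y: "y \<in> pos f u" for y
    proof -
      have 1: "m (t c) y = m (t c) (t v)" if "0 < m (t v) y"
        by (rule twin[OF comp b(1) u y that]) (use b(2,3) in blast)
      have 2: "m (t v) y = m (t v) (t c)" if "0 < m (t c) y"
        by (rule twin[OF comp b(2) u y that]) (use b(1,3) in blast)
      show ?thesis using 1 2 adj m_sym[of "t v" "t c"] by (cases "m (t v) y = 0") auto
    qed
    then have "(\<Sum>y\<in>pos f u. m (t c) y) = (\<Sum>y\<in>pos f u. m (t v) y)" by simp
    then have "\<mu> c u = \<mu> v u"
      using perfect[OF U(2) u(1) _ tp(2)] perfect[OF U(1) u(1) _ tp(1)] U by simp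
    then show ?thesis by (simp add: mu_sym)
  qed
  have K2: "\<mu> v u = \<mu> v c"
    if b: "bad U f t v" "bad U f t c" "c \<noteq> v" and u: "u \<in> U" "\<not> bad U f t u" for t v c u
  proof -
    obtain y where y: "y \<in> pos f u" "0 < m (t v) y" using twin_colour[OF b u] by blast
    obtain s where s: "bad U f s u" "\<And>w. bad U f s w \<Longrightarrow> w = u \<or> (w \<noteq> v \<and> bad U f t w)"
      "\<And>c. bad U f t c \<Longrightarrow> c \<noteq> v \<Longrightarrow> bad U f s c \<and> m (t c) y = m (t c) (t v)"
      using twin[OF comp b(1) u y] by blast
    have "\<not> bad U f s v" using s(2)[of v] b(1) u(2) by blast
    moreover have "bad U f s c" "c \<noteq> u" using s(3)[of c] b u by blast+
    ultimately show ?thesis using K1[OF _ s(1), of c v] badD(2)[OF b(1)] by metis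
  qed
  obtain v where v: "v \<in> U" using conn_nonempty[OF connU] by blast
  show ?thesis
  proof (cases "U = {v}")
    case True
    then show ?thesis using that[of 0] by blast
  next
    case False
    then obtain x where x: "x \<in> pos f v" using pos_nonempty v by blast
    obtain t where t: "bad U f t v" "t v = x" using bad_exists[OF v x] by blast
    have "0 < edges_to (t v) t U" using bad_degree[OF hard t(1)] t(2) x by (simp add: posD)
    then obtain c where c: "c \<in> U" "0 < m (t v) (t c)" unfolding edges_to_def using sum_posE by blast
    have tc: "bad U f t c" using bad_step[OF hard t(1) c] .
    have cv: "c \<noteq> v" using c by auto
    obtain u0 where u0: "u0 \<in> U" "\<not> bad U f t u0" using complete_not_all_bad[OF comp naf t(1)] by blast
    define \<tau> where "\<tau> = \<mu> v c"
    have nb: "\<mu> u p = \<tau>" if u: "u \<in> U" "\<not> bad U f t u" and p: "bad U f t p" for u p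
    proof -
      have uv: "\<mu> u v = \<tau>" using K2[OF t(1) tc cv u] mu_sym unfolding \<tau>_def by metis
      then show ?thesis using K1[OF t(1) p _ u] by (cases "p = v") auto
    qed
    have bb: "\<mu> p q = \<tau>" if "bad U f t p" "bad U f t q" "p \<noteq> q" for p q
      using K2[OF that(1,2) _ u0] nb[OF u0 that(1)] that(3) mu_sym by metis
    have nn: "\<mu> u' u = \<tau>" if u: "u \<in> U" "\<not> bad U f t u" "u' \<in> U" "\<not> bad U f t u'" "u \<noteq> u'" for u u'
    proof -
      obtain y where y: "y \<in> pos f u" "0 < m (t v) y" using twin_colour[OF t(1) tc cv u(1,2)] by blast
      obtain s where s: "bad U f s u" "\<And>w. bad U f s w \<Longrightarrow> w = u \<or> (w \<noteq> v \<and> bad U f t w)"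
        "\<And>c. bad U f t c \<Longrightarrow> c \<noteq> v \<Longrightarrow> bad U f s c \<and> m (t c) y = m (t c) (t v)"
        using twin[OF comp t(1) u(1,2) y] by blast
      have sc: "bad U f s c" "u \<noteq> c" using s(3)[OF tc cv] u(2) tc by blast+
      have "\<not> bad U f s u'" using s(2)[of u'] u by blast
      then have "\<mu> u' u = \<mu> u' c" using K1[OF sc(1) s(1) sc(2) u(3)] by blast
      then show ?thesis using nb[OF u(3,4) tc] by simp
    qed
    show ?thesis
    proof (rule that[of \<tau>])
      fix p q assume "p \<in> U" "q \<in> U" "p \<noteq> q"
      then show "\<mu> p q = \<tau>" using nb[of p q] nb[of q p] bb[of p q] nn[of q p] mu_sym[of p q] by metis
    qed
  qed
qed

end

context hard_block
begin

subsection \<open>Cycles\<close>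

lemma nbrsD: "w \<in> nbrs \<mu> S v \<Longrightarrow> w \<in> S" "w \<in> nbrs \<mu> S v \<Longrightarrow> 0 < \<mu> v w" "w \<in> nbrs \<mu> S v \<Longrightarrow> w \<noteq> v"
  unfolding nbrs_def by auto

lemma edges_to_two:
  assumes "v \<in> U" "nbrs \<mu> U v = {a, b}" "a \<noteq> b" "choice t (U - {v})" "x \<in> X v"
  shows "edges_to x t (U - {v}) = m x (t a) + m x (t b)"
proof -
  have "{a, b} \<subseteq> U - {v}" unfolding assms(2)[symmetric] nbrs_def by auto
  moreover have "m x (t w) = 0" if "w \<in> U - {v} - {a, b}" for w
  proof -
    have "w \<notin> nbrs \<mu> U v" using that assms(2) by simp
    then have "\<mu> v w = 0" using that unfolding nbrs_def by simp
    moreover have "t w \<in> X w" using that assms(4) unfolding choice_def by blast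
    ultimately show ?thesis using m_le[OF assms(5), of "t w" w] by simp
  qed
  ultimately have "edges_to x t (U - {v}) = edges_to x t {a, b}"
    unfolding edges_to_def by (intro sum.mono_neutral_right) (use finU in auto)
  then show ?thesis using assms(3) by (simp add: edges_to_def)
qed

lemma hole_two:
  assumes "nbrs \<mu> U v = {a, b}" "a \<noteq> b" "hole U f t v" "x \<in> X v"
  shows "m x (t a) + m x (t b) = f x"
  using edges_to_two[OF _ assms(1,2) _ assms(4), of t] hole_tight(1)[OF hard assms(3,4)] assms(3)
  unfolding hole_def by simp

lemma bad_two:
  assumes "nbrs \<mu> U v = {a, b}" "a \<noteq> b" "bad U f t v"
  shows "m (t v) (t a) + m (t v) (t b) = f (t v)"
  using hole_two[OF assms(1,2) badD(1,4)[OF assms(3)]] .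

lemma hole_pos: "hole U f t v \<Longrightarrow> u \<in> U \<Longrightarrow> u \<noteq> v \<Longrightarrow> t u \<in> pos f u"
  using sdegen_pos[of f t "U - {v}" u] unfolding hole_def choice_def pos_def by auto

text \<open>Suppose \<open>x\<close> and \<open>y\<close> are not adjacent. Passing to
  \<open>a\<close> by fullness, recolouring \<open>a\<close> and returning to \<open>v\<close> shows
  that every positive colour of \<open>a\<close> takes all \<open>f x\<close> edges at
  \<open>x\<close>. A hole with a colour adjacent to \<open>x\<close> at \<open>b\<close> then gives
  \<open>x\<close> too many.\<close>

lemma full_across_two:
  assumes v: "v \<in> U" and N: "nbrs \<mu> U v = {a, b}" "a \<noteq> b" and full: "full f v a"
  shows "full f v b"
  unfolding full_def
proof (intro ballI)
  fix x y assume x: "x \<in> pos f v" and y: "y \<in> pos f b"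
  have ab: "a \<in> U" "b \<in> U" "a \<noteq> v" "b \<noteq> v" "0 < \<mu> v b"
    using nbrsD[of a U v] nbrsD[of b U v] N(1) by auto
  show "0 < m x y"
  proof (rule ccontr)
    assume neg: "\<not> 0 < m x y"
    obtain t where t: "hole U f t v" "t b = y" using hole_with[OF ab(2) v ab(4) y] by blast
    let ?T = "t(v := x)"
    have bv: "bad U f ?T v" using bad_of_hole[OF t(1)] x by (simp add: posD)
    have "0 < m (?T v) (?T a)" using full x hole_pos[OF t(1) ab(1,3)] ab unfolding full_def by simp
    then have ba: "bad U f ?T a" using bad_step[OF hard bv ab(1)] by blast
    have eq: "m x z = f x" if z: "z \<in> pos f a" for z
    proof -
      let ?T' = "?T(a := z)"
      have "bad U f ?T' a" using bad_swap[OF ba] z by (simp add: posD)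
      moreover have "0 < m (?T' a) (?T' v)" using full x z ab m_sym[of z x] unfolding full_def by simp
      ultimately have "bad U f ?T' v" using bad_step[OF hard _ v] by blast
      from bad_two[OF N this] show ?thesis using ab N(2) neg t(2) by simp
    qed
    obtain y' where y': "y' \<in> pos f b" "0 < m x y'" using colour_nbr[OF v ab(2,5) x] by blast
    obtain s where s: "hole U f s v" "s b = y'" using hole_with[OF ab(2) v ab(4) y'(1)] by blast
    have "m x (s a) = f x" using eq hole_pos[OF s(1) ab(1,3)] by blast
    then show False using hole_two[OF N s(1) posD(1)[OF x]] y'(2) s(2) by simp
  qed
qed

lemma two_nbrsE:
  assumes "two_nbrs U" "v \<in> U" "a \<in> nbrs \<mu> U v"
  obtains b where "nbrs \<mu> U v = {a, b}" "a \<noteq> b"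
proof -
  obtain p q where "nbrs \<mu> U v = {p, q}" "p \<noteq> q"
    using assms(1,2) unfolding two_nbrs_def by (metis card_2_iff)
  then show ?thesis using assms(3) that[of p] that[of q] by (metis insert_commute insertE singletonD)
qed

lemma no_full_two_nbrs:
  assumes tn: "two_nbrs U" and naf: "\<not> all_full U f"
  shows "no_full U f"
  unfolding no_full_def
proof (intro ballI impI notI)
  fix a b assume ab: "a \<in> U" "b \<in> U" "0 < \<mu> a b" and full: "full f a b"
  let ?Z = "{v \<in> U. \<forall>w\<in>nbrs \<mu> U v. full f v w}"
  have one: "v \<in> ?Z" if v: "v \<in> U" "w \<in> nbrs \<mu> U v" "full f v w" for v w
  proof -
    obtain w' where N: "nbrs \<mu> U v = {w, w'}" "w \<noteq> w'" using two_nbrsE[OF tn v(1,2)] by blast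
    then show ?thesis using full_across_two[OF v(1) N v(3)] v by auto
  qed
  have "?Z = U"
  proof (rule conn_closed[OF connU])
    show "?Z \<noteq> {}" using one[of a b] ab full unfolding nbrs_def by blast
    fix u w assume u: "u \<in> ?Z" and w: "w \<in> U" "0 < \<mu> u w"
    then have "full f w u" using full_sym unfolding nbrs_def by blast
    then show "w \<in> ?Z" using one[of w u] u w mu_sym[of u w] unfolding nbrs_def by simp
  qed blast
  then have "all_full U f" unfolding all_full_def nbrs_def by blast
  then show False using naf by blast
qed

text \<open>The colour \<open>x\<close> is met from every side by a single hole. On a cycle this
  configuration forces \<open>all_full\<close>; without it, each hole meets a positive colour of
  \<open>v\<close> from one side only.\<close>

definition both :: "'a \<Rightarrow> 'b \<Rightarrow> bool" where
  "both v x \<longleftrightarrow> x \<in> pos f v \<and> (\<exists>t. hole U f t v \<and> (\<forall>u\<in>nbrs \<mu> U v. 0 < m x (t u)))"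

text \<open>Badness moves to \<open>b\<close>, the colour there is exchanged for \<open>z\<close>,
  and badness returns to \<open>v\<close> if \<open>z\<close> is adjacent to \<open>x\<close>. The
  share of \<open>t a\<close> is unchanged, hence so is that of \<open>b\<close>.\<close>

lemma both_value:
  assumes v: "v \<in> U" and N: "nbrs \<mu> U v = {a, b}" "a \<noteq> b" and t: "hole U f t v"
    and x: "x \<in> pos f v" and pos: "0 < m x (t a)" "0 < m x (t b)" and z: "z \<in> pos f b"
  shows "m x z = 0 \<or> m x z = m x (t b)"
proof -
  have ab: "b \<in> U" "b \<noteq> v" "a \<noteq> v" using nbrsD[of a U v] nbrsD[of b U v] N(1) by auto
  let ?T = "t(v := x)"
  let ?T' = "?T(b := z)"
  have bv: "bad U f ?T v" using bad_of_hole[OF t] x by (simp add: posD)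
  have "bad U f ?T b" using bad_step[OF hard bv ab(1)] pos ab by simp
  then have b': "bad U f ?T' b" using bad_swap z by (simp add: posD)
  have "m x (t a) + m x z = f x" if "0 < m x z"
  proof -
    have "bad U f ?T' v" using bad_step[OF hard b' v] that ab m_sym[of z x] by simp
    from bad_two[OF N this] show ?thesis using ab N(2) by simp
  qed
  moreover have "m x (t a) + m x (t b) = f x" using hole_two[OF N t] x by (simp add: posD)
  ultimately show ?thesis by (cases "m x z = 0") auto
qed

text \<open>In a hole with \<open>z\<close> at \<open>b\<close> the two shares again add up to
  \<open>f x\<close>, and each is 0 or its old positive value; so neither is 0.\<close>

lemma both_const:
  assumes v: "v \<in> U" and N: "nbrs \<mu> U v = {a, b}" "a \<noteq> b" and t: "hole U f t v"
    and x: "x \<in> pos f v" and pos: "0 < m x (t a)" "0 < m x (t b)" and z: "z \<in> pos f b"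
  shows "m x z = m x (t b)"
proof -
  have ab: "a \<in> U" "b \<in> U" "a \<noteq> v" "b \<noteq> v" using nbrsD[of a U v] nbrsD[of b U v] N(1) by auto
  have N': "nbrs \<mu> U v = {b, a}" "b \<noteq> a" using N by auto
  obtain s where s: "hole U f s v" "s b = z" using hole_with[OF ab(2) v ab(4) z] by blast
  have "m x (s a) = 0 \<or> m x (s a) = m x (t a)"
    using both_value[OF v N' t x pos(2,1) hole_pos[OF s(1) ab(1,3)]] .
  moreover have "m x z = 0 \<or> m x z = m x (t b)" using both_value[OF v N t x pos z] .
  moreover have "m x (s a) + m x z = f x" "m x (t a) + m x (t b) = f x"
    using hole_two[OF N s(1)] hole_two[OF N t] s(2) x by (auto simp: posD)
  ultimately show ?thesis using pos by auto
qed

lemma both_full_tight: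
  assumes tn: "two_nbrs U" and v: "v \<in> U" and x: "both v x"
  shows "\<And>u z. u \<in> nbrs \<mu> U v \<Longrightarrow> z \<in> pos f u \<Longrightarrow> 0 < m x z"
    and "\<And>s. (\<And>u. u \<in> U - {v} \<Longrightarrow> s u \<in> pos f u) \<Longrightarrow> edges_to x s (U - {v}) = f x"
proof -
  obtain t where xp: "x \<in> pos f v" and t: "hole U f t v" "\<And>u. u \<in> nbrs \<mu> U v \<Longrightarrow> 0 < m x (t u)"
    using x unfolding both_def by blast
  have const: "m x z = m x (t u)" if u: "u \<in> nbrs \<mu> U v" "z \<in> pos f u" for u z
  proof -
    obtain w where N: "nbrs \<mu> U v = {u, w}" "u \<noteq> w" using two_nbrsE[OF tn v u(1)] by blast
    then have N': "nbrs \<mu> U v = {w, u}" "w \<noteq> u" by auto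
    show ?thesis using both_const[OF v N' t(1) xp] t(2)[of u] t(2)[of w] u N by blast
  qed
  then show "0 < m x z" if "u \<in> nbrs \<mu> U v" "z \<in> pos f u" for u z using t(2) that by metis
  fix s assume s: "\<And>u. u \<in> U - {v} \<Longrightarrow> s u \<in> pos f u"
  obtain a b where N: "nbrs \<mu> U v = {a, b}" "a \<noteq> b"
    using tn v unfolding two_nbrs_def by (metis card_2_iff)
  have ab: "a \<in> U - {v}" "b \<in> U - {v}" using nbrsD[of a U v] nbrsD[of b U v] N(1) by auto
  have "choice s (U - {v})" using s unfolding choice_def pos_def by blast
  then have "edges_to x s (U - {v}) = m x (s a) + m x (s b)"
    using edges_to_two[OF v N _ posD(1)[OF xp]] by blast
  also have "\<dots> = m x (t a) + m x (t b)"
    using const[of a "s a"] const[of b "s b"] s[OF ab(1)] s[OF ab(2)] N by simp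
  also have "\<dots> = f x" using hole_two[OF N t(1) posD(1)[OF xp]] .
  finally show "edges_to x s (U - {v}) = f x" .
qed

text \<open>A colour of type \<open>both\<close> can be continued along the cycle, which closes up to a connected bad choice.\<close>

lemma both_all_full:
  assumes tn: "two_nbrs U" and v: "v \<in> U" and x: "both v x"
  shows "all_full U f"
proof -
  have "{u \<in> U. \<exists>x. both u x} = U"
  proof (rule conn_closed[OF connU])
    show "{u \<in> U. \<exists>x. both u x} \<noteq> {}" using v x by blast
    fix w u assume "w \<in> {u \<in> U. \<exists>x. both u x}" and u: "u \<in> U" "0 < \<mu> w u"
    then obtain y where w: "w \<in> U" and y: "both w y" by blast
    have yp: "y \<in> pos f w" using y unfolding both_def by blast
    have wu: "w \<in> nbrs \<mu> U u" "u \<in> nbrs \<mu> U w" "w \<noteq> u" using w u mu_sym[of w u] unfolding nbrs_def by auto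
    obtain u' where N: "nbrs \<mu> U u = {w, u'}" "w \<noteq> u'" using two_nbrsE[OF tn u(1) wu(1)] by blast
    have u': "u' \<in> U" "u' \<noteq> u" "0 < \<mu> u' u" using nbrsD[of u' U u] N(1) mu_sym[of u u'] by auto
    obtain s where s: "hole U f s u" "s w = y" using hole_with[OF w u(1) wu(3) yp] by blast
    obtain z where z: "z \<in> pos f u" "0 < m (s u') z"
      using colour_nbr[OF u'(1) u(1) u'(3) hole_pos[OF s(1) u'(1,2)]] by blast
    have "0 < m y z" using both_full_tight(1)[OF tn w y wu(2) z(1)] .
    then have "both u z" using z s N m_sym[of z] unfolding both_def by auto
    then show "u \<in> {u \<in> U. \<exists>x. both u x}" using u by blast
  qed blast
  then have "\<forall>u. \<exists>x. u \<in> U \<longrightarrow> both u x" by blast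
  then obtain t where t: "\<And>u. u \<in> U \<Longrightarrow> both u (t u)" by metis
  then have tp: "\<And>u. u \<in> U \<Longrightarrow> t u \<in> pos f u" unfolding both_def by blast
  have adj: "0 < m (t p) (t q)" if "p \<in> U" "q \<in> U" "0 < \<mu> p q" for p q
    using both_full_tight(1)[OF tn that(1) t] tp that unfolding nbrs_def by blast
  \<comment> \<open>A proper part has a vertex joined to one outside; their colours are adjacent, so
    the tight degree is not attained inside the part.\<close>
  have "sdegen f t (U - {v})"
    unfolding sdegen_def
  proof (intro allI impI)
    fix S assume S: "S \<subseteq> U - {v}" "S \<noteq> {}"
    then obtain p q where pq: "p \<in> S" "q \<in> U - S" "0 < \<mu> p q" using conn_edge[OF connU, of S] v by blast
    have p: "p \<in> U" "q \<in> U" using pq S by auto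
    have "edges_to (t p) t S < edges_to (t p) t (insert q S)"
      using edges_to_insert[of S q] pq adj[OF p pq(3)] S finU finite_subset[of S U] by fastforce
    also have "\<dots> \<le> edges_to (t p) t U" using edges_to_mono[OF finU, of "insert q S"] S p by blast
    also have "\<dots> = f (t p)"
      using both_full_tight(2)[OF tn p(1) t[OF p(1)], of t] tp edges_to_self[OF finU, of t p] by simp
    finally show "\<exists>u\<in>S. edges_to (t u) t S < f (t u)" using pq by blast
  qed
  then have "bad U f t v" using posD(1)[OF tp] v unfolding bad_def hole_def choice_def by auto
  moreover have "conn (\<lambda>a b. m (t a) (t b)) U" by (rule conn_colours_mono[OF connU]) (rule adj)
  ultimately show ?thesis by (rule all_full_if_conn)
qed

context
  assumes tn: "two_nbrs U" and naf: "\<not> all_full U f"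
begin

lemma cycle_exclusive:
  assumes v: "v \<in> U" and N: "nbrs \<mu> U v = {a, b}" "a \<noteq> b" and t: "hole U f t v" and x: "x \<in> pos f v"
  shows "m x (t a) = 0 \<or> m x (t b) = 0"
proof (rule ccontr)
  assume "\<not> ?thesis"
  then have "both v x" using N t x unfolding both_def by auto
  then show False using both_all_full[OF tn v] naf by blast
qed

lemma cycle_value:
  assumes v: "v \<in> U" and a: "a \<in> nbrs \<mu> U v" and x: "x \<in> pos f v" and y: "y \<in> pos f a"
  shows "m x y = 0 \<or> m x y = f x"
proof -
  obtain b where N: "nbrs \<mu> U v = {a, b}" "a \<noteq> b" using two_nbrsE[OF tn v a] by blast
  obtain t where t: "hole U f t v" "t a = y" using hole_with[of a v y] nbrsD[OF a] v y by blast
  show ?thesis using cycle_exclusive[OF v N t(1) x] hole_two[OF N t(1) posD(1)[OF x]] t(2) by auto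
qed

text \<open>With \<open>y'\<close> at \<open>a\<close>, the shares of \<open>v\<close> and of the
  far neighbour \<open>a'\<close> at \<open>y'\<close> add up to \<open>f y'\<close>, both for
  \<open>x\<close> and for \<open>x'\<close> at \<open>v\<close>. As \<open>x\<close> takes
  everything, \<open>a'\<close> contributes nothing, so \<open>x'\<close> takes everything too.
  Hence colour neighbourhoods across an edge are equal or disjoint.\<close>

lemma cycle_classes:
  assumes v: "v \<in> U" and a: "a \<in> nbrs \<mu> U v" and x: "x \<in> pos f v" "x' \<in> pos f v"
    and y: "y \<in> pos f a" "y' \<in> pos f a"
    and pos: "0 < m x y" "0 < m x y'" "0 < m x' y"
  shows "0 < m x' y'"
proof -
  have aU: "a \<in> U" "a \<noteq> v" "v \<in> nbrs \<mu> U a" using nbrsD[OF a] v mu_sym[of a v] unfolding nbrs_def by auto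
  obtain a' where N: "nbrs \<mu> U a = {v, a'}" "v \<noteq> a'" using two_nbrsE[OF tn aU(1,3)] by blast
  have a': "a' \<noteq> a" "a' \<noteq> v" using nbrsD[of a' U a] N by auto
  obtain s where s: "hole U f s v" "s a = y" using hole_with[OF aU(1) v aU(2) y(1)] by blast
  have swap: "m y' z + m y' (s a') = f y'" if z: "z \<in> pos f v" "0 < m z y" for z
  proof -
    let ?T = "s(v := z)" and ?T' = "s(v := z, a := y')"
    have "bad U f ?T v" using bad_of_hole[OF s(1)] z by (simp add: posD)
    then have "bad U f ?T a" using bad_step[OF hard _ aU(1)] z aU s(2) by simp
    then have "bad U f ?T' a" using bad_swap y(2) by (simp add: posD)
    from bad_two[OF N this] show ?thesis using aU a' by simp
  qed
  have val: "m y' z = 0 \<or> m y' z = f y'" if "z \<in> pos f v" for z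
    using cycle_value[OF aU(1,3) y(2) that] .
  have "m y' x = f y'" using val[OF x(1)] pos(2) m_sym[of x y'] by simp
  then have "m y' (s a') = 0" using swap[OF x(1) pos(1)] by simp
  then have "m y' x' = f y'" using swap[OF x(2) pos(3)] by simp
  then show ?thesis using posD(2)[OF y(2)] m_sym[of x' y'] by simp
qed

text \<open>The neighbourhoods \<open>C y\<close> partition the positive colours of \<open>v\<close>
  into classes of weight \<open>\<mu> v a\<close>, while all these colours together weigh
  \<open>\<mu> v a + \<mu> v b\<close>.\<close>

lemma cycle_dvd:
  assumes v: "v \<in> U" and N: "nbrs \<mu> U v = {a, b}" "a \<noteq> b"
  shows "\<mu> v a dvd \<mu> v b"
proof -
  have a: "a \<in> nbrs \<mu> U v" "a \<in> U" "a \<noteq> v" "0 < \<mu> v a" and b: "b \<in> U" "b \<noteq> v"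
    using nbrsD[of a U v] nbrsD[of b U v] N(1) by auto
  define C where "C y = {x \<in> pos f v. 0 < m x y}" for y
  have weight: "(\<Sum>x\<in>C y. f x) = \<mu> v a" if y: "y \<in> pos f a" for y
  proof -
    have "f x = m x y" if "x \<in> C y" for x
      using cycle_value[OF v a(1) _ y, of x] that unfolding C_def by simp
    then have "(\<Sum>x\<in>C y. f x) = (\<Sum>x\<in>C y. m x y)" by simp
    also have "\<dots> = (\<Sum>x\<in>pos f v. m x y)"
      by (rule sum.mono_neutral_left) (auto simp: C_def)
    also have "\<dots> = (\<Sum>x\<in>pos f v. m y x)" by (simp add: m_sym)
    also have "\<dots> = \<mu> a v" using perfect[OF a(2) v a(3) y] .
    finally show ?thesis by (simp add: mu_sym)
  qed
  have disj: "C y = C y'" if y: "y \<in> pos f a" "y' \<in> pos f a" "C y \<inter> C y' \<noteq> {}" for y y'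
  proof -
    obtain x where x: "x \<in> pos f v" "0 < m x y" "0 < m x y'" using y(3) unfolding C_def by blast
    show ?thesis
      using cycle_classes[OF v a(1) x(1) _ y(1,2) x(2,3)] cycle_classes[OF v a(1) x(1) _ y(2,1) x(3,2)]
      unfolding C_def by blast
  qed
  have cover: "\<Union> (C ` pos f a) = pos f v"
  proof
    show "\<Union> (C ` pos f a) \<subseteq> pos f v" unfolding C_def by blast
    show "pos f v \<subseteq> \<Union> (C ` pos f a)"
    proof
      fix x assume x: "x \<in> pos f v"
      then obtain y where "y \<in> pos f a" "0 < m x y" using colour_nbr[OF v a(2,4)] by blast
      then show "x \<in> \<Union> (C ` pos f a)" using x unfolding C_def by blast
    qed
  qed
  have "(\<Sum>x\<in>pos f v. f x) = (\<Sum>Y\<in>C ` pos f a. \<Sum>x\<in>Y. f x)"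
  proof -
    have "sum f (\<Union> (C ` pos f a)) = (sum \<circ> sum) f (C ` pos f a)"
      by (rule sum.Union_disjoint) (use disj in \<open>auto simp: C_def\<close>)
    then show ?thesis by (simp add: cover comp_def)
  qed
  also have "\<dots> = (\<Sum>Y\<in>C ` pos f a. \<mu> v a)" by (rule sum.cong) (use weight in auto)
  finally have 1: "\<mu> v a dvd (\<Sum>x\<in>pos f v. f x)" by simp
  obtain t where t: "hole U f t v" using hole_exists[OF wtd v] by blast
  have "(\<Sum>x\<in>pos f v. f x) = (\<Sum>x\<in>pos f v. m (t a) x) + (\<Sum>x\<in>pos f v. m (t b) x)"
    unfolding sum.distrib[symmetric]
    by (rule sum.cong) (use hole_two[OF N t] in \<open>auto simp: posD m_sym\<close>)
  also have "\<dots> = \<mu> a v + \<mu> b v"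
    using perfect[OF a(2) v a(3) hole_pos[OF t a(2,3)]] perfect[OF b(1) v b(2) hole_pos[OF t b]] by simp
  finally have "(\<Sum>x\<in>pos f v. f x) = \<mu> v a + \<mu> v b" by (simp add: mu_sym)
  then show ?thesis using 1 by simp
qed

lemma uniform_cycle:
  obtains \<tau> where "\<And>p q. p \<in> U \<Longrightarrow> q \<in> U \<Longrightarrow> 0 < \<mu> p q \<Longrightarrow> \<mu> p q = \<tau>"
proof -
  have eq: "\<mu> v a = \<mu> v b" if v: "v \<in> U" and ab: "a \<in> nbrs \<mu> U v" "b \<in> nbrs \<mu> U v" for v a b
  proof (cases "a = b")
    case False
    obtain c where N: "nbrs \<mu> U v = {a, c}" "a \<noteq> c" using two_nbrsE[OF tn v ab(1)] by blast
    then have "c = b" using ab False by auto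
    moreover have N': "nbrs \<mu> U v = {c, a}" "c \<noteq> a" using N by auto
    ultimately show ?thesis using cycle_dvd[OF v N] cycle_dvd[OF v N'] by (simp add: dvd_antisym)
  qed simp
  obtain v where v: "v \<in> U" using conn_nonempty[OF connU] by blast
  obtain a where a: "a \<in> nbrs \<mu> U v" using tn v unfolding two_nbrs_def by fastforce
  define \<tau> where "\<tau> = \<mu> v a"
  define Z where "Z = {w \<in> U. \<forall>u\<in>nbrs \<mu> U w. \<mu> w u = \<tau>}"
  have "Z = U"
  proof (rule conn_closed[OF connU])
    have "v \<in> Z" using eq[OF v _ a] v unfolding Z_def \<tau>_def by simp
    then show "Z \<noteq> {}" by blast
    show "Z \<subseteq> U" unfolding Z_def by blast
    fix p q assume p: "p \<in> Z" and q: "q \<in> U" "0 < \<mu> p q"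
    have "q \<in> nbrs \<mu> U p" using q unfolding nbrs_def by simp
    then have "\<mu> q p = \<tau>" using p mu_sym[of q p] unfolding Z_def by simp
    moreover have pq: "p \<in> nbrs \<mu> U q" using p q mu_sym[of q p] unfolding nbrs_def Z_def by simp
    ultimately have "\<mu> q u = \<tau>" if "u \<in> nbrs \<mu> U q" for u using eq[OF q(1) that pq] by simp
    then show "q \<in> Z" using q(1) unfolding Z_def by simp
  qed
  then have "p \<in> Z" if "p \<in> U" for p using that by simp
  then have "\<mu> p q = \<tau>" if "p \<in> U" "q \<in> U" "0 < \<mu> p q" for p q
    using that unfolding Z_def nbrs_def by simp
  then show ?thesis by (rule that)
qed

end

end

section \<open>Colourings across a separating pair\<close>

lemma conn_remove_leaf:
  assumes mu: "sym_mult \<mu>" and Q: "conn \<mu> Q" and p: "p \<in> Q" "q \<in> Q" "q \<noteq> p"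
    and leaf: "nbrs \<mu> Q p \<subseteq> {r}"
  shows "conn \<mu> (Q - {p})"
proof -
  define r' where "r' = (if r \<in> Q - {p} then r else q)"
  have r': "r' \<in> Q - {p}" using p unfolding r'_def by auto
  show ?thesis
  proof (rule connI_avoid[OF mu r'])
    fix A assume A: "A \<subseteq> Q - {p}" "A \<noteq> {}" "r' \<notin> A"
    then have "A \<subseteq> Q" "A \<noteq> Q" using p by blast+
    then obtain u w where uw: "u \<in> A" "w \<in> Q - A" "0 < \<mu> u w" using conn_edge[OF Q _ A(2)] by blast
    have "w \<noteq> p"
    proof
      assume "w = p"
      then have "u \<in> nbrs \<mu> Q p" using uw \<open>A \<subseteq> Q\<close> sym_multD(1)[OF mu, of u p] unfolding nbrs_def by auto
      then have "u = r" using leaf by blast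
      then show False using uw A unfolding r'_def by (auto split: if_splits)
    qed
    then show "\<exists>u\<in>A. \<exists>w\<in>Q - {p} - A. 0 < \<mu> u w" using uw by blast
  qed
qed

context hard_block
begin

text \<open>\<open>i\<close> keeps its positive colours, and \<open>card_pos_eq\<close>, applied in
  \<open>U\<close> and in \<open>U - A\<close>, transfers their number to every other
  vertex.\<close>

lemma reduce_pos:
  assumes A: "A \<subseteq> U" and ns': "nonsep \<mu> (U - A)" and i: "i \<in> U - A" "\<forall>w\<in>A. \<mu> i w = 0"
    and t: "choice t A" "sdegen f t A"
  shows "hard_block \<mu> X m (U - A) (red f t A)"
    and "\<And>c. c \<in> U - A \<Longrightarrow> pos (red f t A) c = pos f c"
proof -
  show hb: "hard_block \<mu> X m (U - A) (red f t A)"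
    using hard_blockI[OF hard_reduce[OF hard A t nonsepD(1)[OF ns']] ns'] .
  have sub: "pos (red f t A) c \<subseteq> pos f c" for c unfolding pos_def red_def by auto
  have "edges_to y t A = 0" if "y \<in> X i" for y
    unfolding edges_to_def
  proof (rule sum.neutral, rule ballI)
    fix w assume "w \<in> A"
    then show "m y (t w) = 0" using m_le[OF that, of "t w" w] i(2) t(1) unfolding choice_def by simp
  qed
  then have "pos (red f t A) i = pos f i" unfolding pos_def red_def by auto
  fix c assume c: "c \<in> U - A"
  have "card (pos (red f t A) c) = card (pos (red f t A) i)" using hard_block.card_pos_eq[OF hb c i(1)] .
  also have "\<dots> = card (pos f i)" using \<open>pos (red f t A) i = pos f i\<close> by simp
  also have "\<dots> = card (pos f c)" using card_pos_eq c i(1) by blast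
  finally show "pos (red f t A) c = pos f c" using card_subset_eq[OF finite_pos sub] by blast
qed

lemma sdegen_exists:
  assumes "A \<subseteq> U" "A \<noteq> U"
  obtains t where "choice t A" "sdegen f t A"
proof -
  obtain v where v: "v \<in> U" "A \<subseteq> U - {v}" using assms by blast
  obtain t where "hole U f t v" using hole_exists[OF wtd v(1)] by blast
  then show ?thesis using that[of t] v choice_mono sdegen_mono unfolding hole_def by blast
qed

lemma sdegen_exists_with:
  assumes "A \<subseteq> U - {v}" "v \<in> U" "u \<in> A" "y \<in> pos f u"
  obtains t where "choice t A" "sdegen f t A" "t u = y"
proof -
  have "u \<in> U" "u \<noteq> v" using assms by auto
  then obtain t where "hole U f t v" "t u = y" using hole_with assms(2,4) by blast
  then show ?thesis using that[of t] assms(1) choice_mono sdegen_mono unfolding hole_def by blast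
qed

text \<open>The colouring \<open>s\<close> of the other side is fixed before \<open>t\<close> is
  known. Taken from a hole at \<open>a\<close> in \<open>U - {b}\<close> with \<open>z\<close>
  already subtracted, it fits every \<open>t\<close>: the sides share no edges, and \<open>z\<close>
  still has weight left after \<open>t\<close>. The identity is tightness at
  \<open>a\<close>.\<close>

lemma cut_formula:
  assumes cut: "cut_pair \<mu> U a b I" and ns': "nonsep \<mu> (U - I)" and z: "z \<in> pos f b"
  obtains s where "choice s (U - {a, b} - I)" "sdegen f s (U - {a, b} - I)"
    "\<And>t x. choice t I \<Longrightarrow> sdegen f t I \<Longrightarrow> x \<in> X a \<Longrightarrow>
       edges_to x t I + m x z + edges_to x s (U - {a, b} - I) = f x"
proof -
  let ?J = "U - {a, b} - I" and ?h = "red f (\<lambda>_. z) {b}"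
  have ab: "a \<noteq> b" "a \<in> U" "b \<in> U" "I \<subseteq> U - {a, b}" "?J \<noteq> {}" and no: "\<And>i j. i \<in> I \<Longrightarrow> j \<in> ?J \<Longrightarrow> \<mu> i j = 0"
    using cut unfolding cut_pair_def by auto
  have "conn \<mu> (U - {b})" using conn_remove[OF ab(3)] ab by blast
  then have "weighted (U - {b}) ?h"
    using weighted_reduce[OF wtd, of "{b}" "\<lambda>_. z"] ab z by (simp add: choice_def posD)
  then obtain s where s: "hole (U - {b}) ?h s a" using hole_exists[of "U - {b}" ?h a] ab by blast
  have J: "?J \<subseteq> U - {b} - {a}" "finite ?J" "finite I" using finU ab by (auto intro: finite_subset)
  have chs: "choice s ?J" using s J choice_mono unfolding hole_def by blast
  have sdh: "sdegen ?h s ?J" using s J sdegen_mono unfolding hole_def by blast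
  have sdf: "sdegen f s ?J" by (rule sdegen_weight_mono[OF sdh]) (simp add: red_def)
  have "edges_to x t I + m x z + edges_to x s ?J = f x"
    if t: "choice t I" "sdegen f t I" and x: "x \<in> X a" for t x
  proof -
    obtain j where j: "j \<in> ?J" using ab by blast
    have "\<forall>w\<in>I. \<mu> j w = 0" using no[OF _ j] by (simp add: mu_sym)
    then have "pos (red f t I) b = pos f b"
      using reduce_pos(2)[OF _ ns' _ _ t, of j b] j ab by blast
    then have zlt: "edges_to z t I < f z" using z unfolding pos_def red_def by auto
    define r where "r w = (if w \<in> I then t w else if w = b then z else s w)" for w
    have bI: "b \<notin> I" using ab by blast
    have rI: "edges_to y r I = edges_to y t I" for y by (rule edges_to_cong) (simp add: r_def)
    have rJ: "edges_to y r ?J = edges_to y s ?J" for y by (rule edges_to_cong) (auto simp: r_def)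
    have rb: "r b = z" using bI by (simp add: r_def)
    have "sdegen f r I" using t(2) sdegen_cong[of I r t f] by (simp add: r_def)
    then have 1: "sdegen f r (insert b I)" using sdegen_insert[OF J(3) _ bI] rb rI zlt by simp
    have "sdegen ?h r ?J" using sdh sdegen_cong[of ?J r s ?h] by (auto simp: r_def)
    moreover have "?h (r v) \<le> red f r (insert b I) (r v)" if v: "v \<in> ?J" for v
    proof -
      have rv: "r v \<in> X v" using chs v unfolding choice_def r_def by auto
      have "edges_to (r v) r I = 0"
        unfolding edges_to_def
      proof (rule sum.neutral, rule ballI)
        fix i assume i: "i \<in> I"
        then have "r i \<in> X i" "\<mu> v i = 0" using t(1) no[OF i v] mu_sym[of v i] unfolding choice_def r_def by auto
        then show "m (r v) (r i) = 0" using m_le[OF rv, of "r i" i] by simp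
      qed
      then show ?thesis using edges_to_insert[OF J(3) bI, of "r v" r] rb by (simp add: red_def edges_to_def)
    qed
    ultimately have 2: "sdegen (red f r (insert b I)) r ?J" by (rule sdegen_weight_mono)
    have eq: "U - {a} - insert b I = ?J" by blast
    have "insert b I \<subseteq> U - {a}" using ab by blast
    then have "sdegen f r (U - {a})"
      using sdegen_combine[of "U - {a}" "insert b I" f r] 1 2 finU eq by simp
    moreover have "choice r (U - {a})"
      using t(1) chs z unfolding choice_def r_def pos_def by auto
    ultimately have "hole U f r a" using ab unfolding hole_def by blast
    then have "edges_to x r (U - {a}) = f x" using hole_tight(1)[OF hard _ x] by blast
    moreover have "U - {a} = insert b I \<union> ?J" using ab by blast
    then have "edges_to x r (U - {a}) = edges_to x r (insert b I) + edges_to x r ?J"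
      using edges_to_Un[of "insert b I" ?J x r] J by auto
    moreover have "edges_to x r (insert b I) = m x z + edges_to x t I"
      using edges_to_insert[OF J(3) bI, of x r] rb rI by simp
    ultimately show ?thesis using rJ by simp
  qed
  then show ?thesis using that[OF chs sdf] by blast
qed

lemma cut_const:
  assumes cut: "cut_pair \<mu> U a b I" and ns': "nonsep \<mu> (U - I)"
    and t: "choice t I" "sdegen f t I" and t': "choice t' I" "sdegen f t' I" and x: "x \<in> X a"
  shows "edges_to x t I = edges_to x t' I"
proof -
  have ab: "b \<in> U" "U \<noteq> {b}" using cut unfolding cut_pair_def by auto
  then obtain z where z: "z \<in> pos f b" using pos_nonempty by blast
  obtain s where "\<And>t x. choice t I \<Longrightarrow> sdegen f t I \<Longrightarrow> x \<in> X a \<Longrightarrow>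
       edges_to x t I + m x z + edges_to x s (U - {a, b} - I) = f x"
    using cut_formula[OF cut ns' z] by blast
  from this[OF t x] this[OF t' x] show ?thesis by simp
qed

subsection \<open>The structure of hard blocks\<close>

context
  assumes IH: "\<And>S g. card S < card U \<Longrightarrow> hard_block \<mu> X m S g \<Longrightarrow> trichotomy S g"
begin

text \<open>Positive colours survive the reduction over \<open>A\<close>, so fullness means the same
  in \<open>U\<close> and in the smaller block, where one full edge leaves only
  \<open>all_full\<close> in the induction hypothesis.\<close>

lemma full_spreads_below:
  assumes A: "A \<subseteq> U" "A \<noteq> {}" and ns': "nonsep \<mu> (U - A)" and i: "i \<in> U - A" "\<forall>w\<in>A. \<mu> i w = 0"
    and pq: "p \<in> U - A" "q \<in> U - A" "0 < \<mu> p q" "full f p q"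
    and uv: "u \<in> U - A" "v \<in> U - A" "0 < \<mu> u v"
  shows "full f u v"
proof -
  obtain t where t: "choice t A" "sdegen f t A" using sdegen_exists[OF A(1)] i by blast
  note hb = reduce_pos(1)[OF A(1) ns' i t] and ps = reduce_pos(2)[OF A(1) ns' i t]
  have fe: "full (red f t A) c d = full f c d" if "c \<in> U - A" "d \<in> U - A" for c d
    using ps[OF that(1)] ps[OF that(2)] unfolding full_def by simp
  have "card (U - A) < card U" using A finU by (intro psubset_card_mono) auto
  then have "trichotomy (U - A) (red f t A)" using IH hb by blast
  moreover have "\<not> no_full (U - A) (red f t A)" using pq fe unfolding no_full_def by blast
  ultimately have "all_full (U - A) (red f t A)" unfolding trichotomy_def by blast
  then show ?thesis using uv fe unfolding all_full_def by blast
qed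

text \<open>Removing either side leaves a nonseparable set because \<open>a\<close> and
  \<open>b\<close> are adjacent. Both sides then contribute constants to a colour \<open>x\<close>
  of \<open>a\<close>, so \<open>m x z\<close> is the same for all positive \<open>z\<close> and the
  edge is full; fullness spreads to both sides.\<close>

lemma adjacent_cut:
  assumes cut: "cut_pair \<mu> U a b J" and ab: "0 < \<mu> a b"
  shows "all_full U f"
proof -
  let ?I = "U - {a, b} - J"
  note cutI = cut_pair_compl[OF mu cut]
  have c: "a \<noteq> b" "a \<in> U" "b \<in> U" "J \<subseteq> U - {a, b}" "J \<noteq> {}" "?I \<noteq> {}"
    and no: "\<And>j i. j \<in> J \<Longrightarrow> i \<in> ?I \<Longrightarrow> \<mu> j i = 0"
    using cut unfolding cut_pair_def by auto
  have cab: "conn \<mu> (insert a (insert b {}))" using conn_pair[of \<mu> a b, OF mu ab] by simp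
  have nsI: "nonsep \<mu> (insert a (insert b {}) \<union> (U - {a, b} - J))"
    by (rule nonsep_glue[OF mu ns cut _ cab]) auto
  have nsJ: "nonsep \<mu> (insert a (insert b {}) \<union> (U - {a, b} - ?I))"
    by (rule nonsep_glue[OF mu ns cutI _ cab]) auto
  have "insert a (insert b {}) \<union> (U - {a, b} - J) = U - J" "insert a (insert b {}) \<union> (U - {a, b} - ?I) = U - ?I"
    and IJ: "U - {a, b} - ?I = J" using c by blast+
  then have ns1: "nonsep \<mu> (U - J)" and ns2: "nonsep \<mu> (U - ?I)" using nsI nsJ by simp_all
  obtain tI where tI: "choice tI ?I" "sdegen f tI ?I" using sdegen_exists[of ?I] c by blast
  obtain tJ where tJ: "choice tJ J" "sdegen f tJ J" using sdegen_exists[of J] c by blast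
  have m_eq: "edges_to x tI ?I + m x z + edges_to x tJ J = f x" if x: "x \<in> X a" and z: "z \<in> pos f b" for x z
  proof -
    obtain s where s: "choice s J" "sdegen f s J"
      "\<And>t x. choice t ?I \<Longrightarrow> sdegen f t ?I \<Longrightarrow> x \<in> X a \<Longrightarrow> edges_to x t ?I + m x z + edges_to x s J = f x"
      using cut_formula[OF cutI ns2 z] unfolding IJ by blast
    have "edges_to x s J = edges_to x tJ J" using cut_const[OF cut ns1 s(1,2) tJ x] .
    then show ?thesis using s(3)[OF tI x] by simp
  qed
  have full: "full f a b"
    unfolding full_def
  proof (intro ballI)
    fix x z assume x: "x \<in> pos f a" and z: "z \<in> pos f b"
    obtain z' where z': "z' \<in> pos f b" "0 < m x z'" using colour_nbr[OF c(2,3) ab x] by blast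
    then show "0 < m x z" using m_eq[OF posD(1)[OF x] z] m_eq[OF posD(1)[OF x] z'(1)] by simp
  qed
  obtain i j where i: "i \<in> ?I" and j: "j \<in> J" using c by blast
  have "full f u v" if uv: "u \<in> U" "v \<in> U" "0 < \<mu> u v" for u v
  proof (cases "u \<in> J \<or> v \<in> J")
    case True
    then have "u \<in> U - ?I" "v \<in> U - ?I" using uv no[of u v] no[of v u] mu_sym[of u v] by auto
    moreover have "\<forall>w\<in>?I. \<mu> j w = 0" using no[OF j] by simp
    ultimately show ?thesis
      using full_spreads_below[of ?I j a b u v] ns2 j c ab full uv by blast
  next
    case False
    then have "u \<in> U - J" "v \<in> U - J" using uv by auto
    moreover have "\<forall>w\<in>J. \<mu> i w = 0" using no[OF _ i] by (simp add: mu_sym)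
    ultimately show ?thesis
      using full_spreads_below[of J i a b u v] ns1 i c ab full uv by blast
  qed
  then show ?thesis unfolding all_full_def by blast
qed

text \<open>A minimal connector \<open>P\<close> inside \<open>J\<close> splits off
  \<open>A = J - P\<close>. Both \<open>U - A\<close> and \<open>J\<close> with \<open>a\<close> and
  \<open>b\<close> added are smaller nonseparable sets; they share an edge from \<open>a\<close>
  into \<open>P\<close> and together contain every edge. It remains to exclude that the latter set
  is a cycle without full edges.\<close>

lemma nonadjacent_cut:
  assumes cut: "cut_pair \<mu> U a b J" and ab: "\<mu> a b = 0" and nsB: "nonsep \<mu> (insert a (insert b J))"
  shows "all_full U f"
proof -
  let ?I = "U - {a, b} - J" and ?B = "insert a (insert b J)"
  note cutI = cut_pair_compl[OF mu cut]
  have c: "a \<noteq> b" "a \<in> U" "b \<in> U" "J \<subseteq> U - {a, b}" "J \<noteq> {}" "?I \<noteq> {}"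
    and no: "\<And>j i. j \<in> J \<Longrightarrow> i \<in> ?I \<Longrightarrow> \<mu> j i = 0"
    using cut unfolding cut_pair_def by auto
  have B: "U - ?I = ?B" using c by blast
  have finJ: "finite J" using c finU by (meson finite_Diff finite_subset)
  obtain i j where i: "i \<in> ?I" and j: "j \<in> J" using c by blast
  have iJ: "\<mu> i w = 0" if "w \<in> J" for w using no[OF that i] mu_sym by metis
  obtain P where P: "P \<subseteq> J" "conn \<mu> (insert a (insert b P))"
    "\<And>P'. P' \<subset> P \<Longrightarrow> \<not> conn \<mu> (insert a (insert b P'))"
    "\<And>q D. q \<in> insert a (insert b P) \<Longrightarrow> D \<subseteq> P - {a, b, q} \<Longrightarrow> D \<noteq> {} \<Longrightarrow>
       \<exists>u\<in>D. \<exists>w\<in>insert a (insert b P) - {q} - D. 0 < \<mu> u w"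
    using minimal_connector[OF mu finJ nonsepD(1)[OF nsB]] by metis
  let ?Q = "insert a (insert b P)"
  define A where "A = J - P"
  have abP: "a \<notin> P" "b \<notin> P" using P(1) c by blast+
  have nsQ: "nonsep \<mu> (?Q \<union> ?I)"
  proof (rule nonsep_glue[OF mu ns cut P(1,2)])
    fix q D assume D: "q \<in> ?Q" "D \<subseteq> P - {q}" "D \<noteq> {}"
    then have "D \<subseteq> P - {a, b, q}" using abP by blast
    then show "\<exists>u\<in>D. \<exists>w\<in>?Q - {q} - D. 0 < \<mu> u w" using P(4) D by blast
  qed
  have UA: "U - A = ?Q \<union> ?I" using P(1) c unfolding A_def by blast
  have nsA: "nonsep \<mu> (U - A)" using nsQ UA by simp
  have AU: "A \<subseteq> U" using c unfolding A_def by blast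
  have "A \<noteq> {}"
  proof
    assume "A = {}"
    then have PJ: "P = J" using P(1) unfolding A_def by blast
    have "conn \<mu> (?B - {j})" using nonsepD(2)[OF nsB] j c by blast
    moreover have "?B - {j} = insert a (insert b (J - {j}))" using j c by blast
    moreover have "J - {j} \<subset> P" using j PJ by blast
    ultimately show False using P(3) by metis
  qed
  have iA: "i \<in> U - A" "\<forall>w\<in>A. \<mu> i w = 0" using i iJ unfolding A_def by auto
  obtain p where p: "p \<in> P" "0 < \<mu> a p"
  proof -
    obtain p where "p \<in> ?Q" "p \<noteq> a" "0 < \<mu> a p" using conn_nbr[OF mu P(2), of a] c by blast
    then show ?thesis using that ab by (metis insertE less_irrefl)
  qed
  have IU: "?I \<subseteq> U" by blast
  obtain t where t: "choice t ?I" "sdegen f t ?I" using sdegen_exists[OF IU] c by blast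
  have jI: "j \<in> U - ?I" "\<forall>w\<in>?I. \<mu> j w = 0" using j c no[OF j] by auto
  have nsB': "nonsep \<mu> (U - ?I)" using nsB B by simp
  note hbB = reduce_pos(1)[OF IU nsB' jI t] and psB = reduce_pos(2)[OF IU nsB' jI t]
  have fe: "full (red f t ?I) c d = full f c d" if "c \<in> U - ?I" "d \<in> U - ?I" for c d
    using psB[OF that(1)] psB[OF that(2)] unfolding full_def by simp
  have "card (U - ?I) < card U" using c finU i by (intro psubset_card_mono) auto
  then have tri: "trichotomy (U - ?I) (red f t ?I)" using IH hbB by blast
  have "all_full (U - ?I) (red f t ?I)"
  proof (rule ccontr)
    assume "\<not> ?thesis"
    then have nf: "no_full (U - ?I) (red f t ?I)" and cyc: "complete_on (U - ?I) \<or> two_nbrs (U - ?I)"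
      using tri unfolding trichotomy_def by auto
    have "\<not> complete_on (U - ?I)" using ab c unfolding complete_on_def B by auto
    then have tn: "card (nbrs \<mu> ?B v) = 2" if "v \<in> ?B" for v
      using cyc that unfolding two_nbrs_def B by blast
    have finB: "finite (nbrs \<mu> ?B v)" for v using finJ unfolding nbrs_def by simp
    \<comment> \<open>On a cycle, a vertex of \<open>P\<close> with a neighbour in \<open>A\<close>
      has at most one neighbour in the connector and could be dropped from it.\<close>
    have PA: "\<mu> u w = 0" if u: "u \<in> P" and w: "w \<in> A" for u w
    proof (rule ccontr)
      assume "\<mu> u w \<noteq> 0"
      then have wn: "w \<in> nbrs \<mu> ?B u" using w unfolding A_def nbrs_def by simp
      have "u \<in> ?B" using u P(1) by blast
      then obtain r1 r2 where r: "nbrs \<mu> ?B u = {r1, r2}" using tn[of u] by (meson card_2_iff)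
      define r where "r = (if w = r1 then r2 else r1)"
      have "nbrs \<mu> ?B u = {w, r}" using r wn unfolding r_def by auto
      moreover have "nbrs \<mu> ?Q u \<subseteq> nbrs \<mu> ?B u - {w}"
        using P(1) w c unfolding nbrs_def A_def by blast
      ultimately have leaf: "nbrs \<mu> ?Q u \<subseteq> {r}" by auto
      have "conn \<mu> (?Q - {u})" using conn_remove_leaf[OF mu P(2) _ _ _ leaf, of a] u abP by blast
      moreover have "?Q - {u} = insert a (insert b (P - {u}))" using u abP by blast
      moreover have "P - {u} \<subset> P" using u by blast
      ultimately show False using P(3) by metis
    qed
    have cutA: "cut_pair \<mu> U a b A"
    proof -
      have "\<mu> w u = 0" if "w \<in> A" "u \<in> U - {a, b} - A" for u w
      proof (cases "u \<in> P")
        case True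
        then show ?thesis using PA[OF True that(1)] mu_sym by metis
      next
        case False
        then have "u \<in> ?I" using that unfolding A_def by blast
        then show ?thesis using no that unfolding A_def by blast
      qed
      moreover have "A \<subseteq> U - {a, b}" using c unfolding A_def by blast
      moreover have "U - {a, b} - A \<noteq> {}" using i unfolding A_def by blast
      ultimately show ?thesis unfolding cut_pair_def using c \<open>A \<noteq> {}\<close> by blast
    qed
    obtain k where k: "k \<in> A" "0 < \<mu> a k"
    proof -
      have "insert a A \<noteq> {a}" using \<open>A \<noteq> {}\<close> c unfolding A_def by blast
      then obtain k where "k \<in> insert a A" "k \<noteq> a" "0 < \<mu> a k"
        using conn_nbr[OF mu side_conn(1)[OF mu ns cutA], of a] by blast
      then show ?thesis using that by blast
    qed
    have only: "\<mu> a w = 0" if "w \<in> A" "w \<noteq> k" for w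
    proof (rule ccontr)
      assume "\<mu> a w \<noteq> 0"
      then have "{p, k, w} \<subseteq> nbrs \<mu> ?B a" using p k that P(1) unfolding A_def nbrs_def by auto
      moreover have "p \<noteq> k" "p \<noteq> w" using p k that unfolding A_def by blast+
      then have "card {p, k, w} = 3" using that by simp
      ultimately show False using card_mono[OF finB, of "{p, k, w}" a] tn[of a] by simp
    qed
    have AUb: "A \<subseteq> U - {a}" using c unfolding A_def by blast
    have finA: "finite A" using finJ unfolding A_def by simp
    have single: "edges_to x s A = m x (s k)" if "choice s A" "x \<in> X a" for s x
    proof -
      have "m x (s w) = 0" if "w \<in> A - {k}" for w
        using only[of w] that m_le[OF \<open>x \<in> X a\<close>, of "s w" w] \<open>choice s A\<close> unfolding choice_def by simp
      then have "edges_to x s (A - {k}) = 0" unfolding edges_to_def by simp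
      then show ?thesis using edges_to_remove[OF finA k(1)] by simp
    qed
    have kU: "k \<in> U" using k AU by blast
    \<comment> \<open>The side \<open>A\<close> contributes to a colour of \<open>a\<close> through
      \<open>k\<close> alone, and by \<open>cut_const\<close> this contribution does not depend on
      the colour of \<open>k\<close>.\<close>
    have "full f a k"
      unfolding full_def
    proof (intro ballI)
      fix x y assume x: "x \<in> pos f a" and y: "y \<in> pos f k"
      obtain y' where y': "y' \<in> pos f k" "0 < m x y'" using colour_nbr[OF c(2) kU k(2) x] by blast
      obtain s where s: "choice s A" "sdegen f s A" "s k = y"
        using sdegen_exists_with[OF AUb c(2) k(1) y] by blast
      obtain s' where s': "choice s' A" "sdegen f s' A" "s' k = y'"
        using sdegen_exists_with[OF AUb c(2) k(1) y'(1)] by blast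
      have "edges_to x s A = edges_to x s' A"
        using cut_const[OF cutA nsA s(1,2) s'(1,2)] x by (simp add: posD)
      then have "m x y = m x y'" using single[OF s(1)] single[OF s'(1)] s(3) s'(3) posD(1)[OF x] by simp
      then show "0 < m x y" using y' by simp
    qed
    moreover have "a \<in> U - ?I" "k \<in> U - ?I" using c k unfolding A_def by auto
    ultimately show False using nf k(2) fe unfolding no_full_def by blast
  qed
  then have fB: "full f u v" if "u \<in> U - ?I" "v \<in> U - ?I" "0 < \<mu> u v" for u v
    using fe that unfolding all_full_def by blast
  have "full f a p" using fB[of a p] p P(1) c by blast
  then have fA: "full f u v" if "u \<in> U - A" "v \<in> U - A" "0 < \<mu> u v" for u v
    using full_spreads_below[OF AU \<open>A \<noteq> {}\<close> nsA iA, of a p u v] p that UA by blast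
  have "full f u v" if uv: "u \<in> U" "v \<in> U" "0 < \<mu> u v" for u v
  proof (cases "u \<in> ?I \<or> v \<in> ?I")
    case True
    then have "u \<notin> J" "v \<notin> J" using uv no[of u v] no[of v u] mu_sym[of u v] by auto
    then show ?thesis using fA uv unfolding A_def by blast
  next
    case False
    then show ?thesis using fB uv by blast
  qed
  then show ?thesis unfolding all_full_def by blast
qed

text \<open>For nonadjacent \<open>v\<close> and \<open>w\<close>, induction on one-vertex deletions
  shows that all other pairs are adjacent. Deleting \<open>z\<close> or \<open>z'\<close> then falls
  in the full case, and since multiplicities there are 0 or the whole weight, some colour gets
  overloaded.\<close>

lemma no_cut_complete:
  assumes nocut: "\<And>p q. p \<in> U \<Longrightarrow> q \<in> U \<Longrightarrow> p \<noteq> q \<Longrightarrow> U - {p, q} \<noteq> {} \<Longrightarrow> conn \<mu> (U - {p, q})"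
    and naf: "\<not> all_full U f"
  shows "complete_on U"
  unfolding complete_on_def
proof (intro ballI impI, rule ccontr)
  fix v w assume v: "v \<in> U" and w: "w \<in> U" and vw: "v \<noteq> w" and "\<not> 0 < \<mu> v w"
  then have na: "\<mu> v w = 0" "\<mu> w v = 0" using mu_sym[of v w] by auto
  have notpair: "\<not> conn \<mu> {v, w}"
  proof
    assume con: "conn \<mu> {v, w}"
    obtain w' where "w' \<in> {v, w}" "w' \<noteq> v" "0 < \<mu> v w'" using conn_nbr[OF mu con, of v] vw by blast
    then show False using na by auto
  qed
  have extra: "\<exists>p\<in>S. p \<noteq> v \<and> p \<noteq> w" if S: "conn \<mu> S" "v \<in> S" "w \<in> S" for S
  proof (rule ccontr)
    assume "\<not> ?thesis"
    then have "S = {v, w}" using S by blast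
    then show False using notpair S(1) by simp
  qed
  \<comment> \<open>Three further vertices are needed: \<open>z\<close> and \<open>z'\<close> are
    deleted in turn, and each time the other one and \<open>q\<close> rule out a cycle.\<close>
  obtain z where z: "z \<in> U" "z \<noteq> v" "z \<noteq> w" using extra[OF connU v w] by blast
  have "conn \<mu> (U - {z})" using conn_remove z v by blast
  then obtain z' where z': "z' \<in> U" "z' \<noteq> v" "z' \<noteq> w" "z' \<noteq> z" using extra[of "U - {z}"] v w z by blast
  have "conn \<mu> (U - {z, z'})" using nocut[of z z'] z z' v by blast
  then obtain q where q: "q \<in> U" "q \<noteq> v" "q \<noteq> w" "q \<noteq> z" "q \<noteq> z'"
    using extra[of "U - {z, z'}"] v w z z' by blast
  have U1: "U - {c} \<noteq> {u}" for c u
  proof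
    assume "U - {c} = {u}"
    then have "U \<subseteq> {c, u}" by blast
    then have "{v, w, z} \<subseteq> {c, u}" using v w z by blast
    then have "card {v, w, z} \<le> card {c, u}" by (intro card_mono) auto
    then show False using vw z card_insert_le_m1[of 2 "{u}" c] by auto
  qed
  have nsd: "nonsep \<mu> (U - {c})" if c: "c \<in> U" for c
  proof -
    have "conn \<mu> (U - {c} - {d})" if "d \<in> U - {c}" for d
    proof -
      have "U - {c} - {d} = U - {c, d}" by blast
      moreover have "U - {c, d} \<noteq> {}" using v w vw z by blast
      ultimately show ?thesis using nocut[of c d] c that by auto
    qed
    moreover have "conn \<mu> (U - {c})" using conn_remove[OF c] v w vw by blast
    ultimately show ?thesis unfolding nonsep_def by blast
  qed
  have tri: "trichotomy (U - {c}) (red f (\<lambda>_. x) {c})" if c: "c \<in> U" "x \<in> pos f c" for c x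
  proof -
    have "hard (U - {c}) (red f (\<lambda>_. x) {c})"
      using hard_reduce[OF hard, of "{c}" "\<lambda>_. x"] sdegen_singleton[of f "\<lambda>_. x" c] c nonsepD(1)[OF nsd[OF c(1)]]
      by (simp add: choice_def posD)
    moreover have "card (U - {c}) < card U" using c finU by (meson card_Diff1_less)
    ultimately show ?thesis using IH hard_blockI nsd c by blast
  qed
  have Upos: "pos f c \<noteq> {}" if "c \<in> U" for c using pos_nonempty[OF that] v w vw by blast
  have comp: "complete_on (U - {c})" if cd: "c \<in> U" "d \<in> U" "c \<noteq> d" "\<mu> c d = 0" for c d
  proof -
    obtain x where x: "x \<in> pos f c" using Upos[OF cd(1)] by blast
    have "\<not> all_full (U - {c}) (red f (\<lambda>_. x) {c})"
      using deleted_adjacent[OF cd(1) x nsd[OF cd(1)] U1 _ naf, of d] cd by auto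
    moreover have "\<not> two_nbrs (U - {c})"
    proof
      assume "two_nbrs (U - {c})"
      then have "card (nbrs \<mu> (U - {c}) d) = 2" using cd unfolding two_nbrs_def by blast
      \<comment> \<open>Without \<open>p\<close> and \<open>r\<close> the vertex \<open>d\<close>
        would be isolated, as it is not adjacent to \<open>c\<close> either; but no pair
        separates.\<close>
      then obtain p r where pr: "nbrs \<mu> (U - {c}) d = {p, r}" "p \<noteq> r" by (metis card_2_iff)
      have p: "p \<in> U" "r \<in> U" "p \<noteq> c" "r \<noteq> c" "p \<noteq> d" "r \<noteq> d"
        using nbrsD[of p "U - {c}" d] nbrsD[of r "U - {c}" d] pr(1) by auto
      have con: "conn \<mu> (U - {p, r})" using nocut[OF p(1,2) pr(2)] p cd by blast
      have d: "{d} \<subseteq> U - {p, r}" "{d} \<noteq> {}" "{d} \<noteq> U - {p, r}" using p cd by blast+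
      obtain e where "e \<in> U - {p, r} - {d}" "0 < \<mu> d e" using conn_edge[OF con d] by blast
      moreover have "e \<noteq> c" using calculation(2) cd(4) mu_sym[of c d] by auto
      ultimately have "e \<in> nbrs \<mu> (U - {c}) d" "e \<notin> {p, r}" unfolding nbrs_def by auto
      then show False using pr(1) by simp
    qed
    ultimately show ?thesis using tri[OF cd(1) x] unfolding trichotomy_def by blast
  qed
  have cv: "complete_on (U - {v})" and cw: "complete_on (U - {w})"
    using comp[OF v w vw na(1)] comp[OF w v _ na(2)] vw by auto
  have adj: "0 < \<mu> c d" if "c \<in> U" "d \<in> U" "c \<noteq> d" "c \<noteq> v" "c \<noteq> w" for c d
    using cv cw that vw unfolding complete_on_def by (cases "d = v") auto
  have afz: "all_full (U - {c}) (red f (\<lambda>_. y) {c})"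
    if c: "c \<in> U" "c \<noteq> v" "c \<noteq> w" "y \<in> pos f c" and d: "d \<in> U" "e \<in> U" "d \<notin> {v, w, c}" "e \<notin> {v, w, c}" "d \<noteq> e"
    for c y d e
  proof -
    have "\<not> complete_on (U - {c})" using na v w vw c unfolding complete_on_def by auto
    moreover have "\<not> two_nbrs (U - {c})"
    proof
      assume "two_nbrs (U - {c})"
      then have "card (nbrs \<mu> (U - {c}) d) = 2" using c d unfolding two_nbrs_def by blast
      moreover have "{v, w, e} \<subseteq> nbrs \<mu> (U - {c}) d" using adj[of d] v w c d unfolding nbrs_def by auto
      moreover have "card {v, w, e} = 3" using vw d by auto
      moreover have "finite (nbrs \<mu> (U - {c}) d)" using finU unfolding nbrs_def by simp
      ultimately show False using card_mono[of "nbrs \<mu> (U - {c}) d" "{v, w, e}"] by simp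
    qed
    ultimately show ?thesis using tri[OF c(1,4)] unfolding trichotomy_def by blast
  qed
  obtain x where x: "x \<in> pos f v" using Upos v by blast
  have "0 < \<mu> v z" "0 < \<mu> v z'" "0 < \<mu> z w" using adj[of z v] adj[of z' v] adj[of z w] z z' v w mu_sym[of v] by auto
  then obtain y y' where y: "y \<in> pos f z" "0 < m x y" and y': "y' \<in> pos f z'" "0 < m x y'"
    and h0: "\<And>y. y \<in> pos f z \<Longrightarrow> \<exists>h\<in>pos f w. 0 < m y h"
    using colour_nbr[OF v z(1) _ x] colour_nbr[OF v z'(1) _ x] colour_nbr[OF z(1) w] by metis
  obtain h where h: "h \<in> pos f w" "0 < m y h" using h0[OF y(1)] by blast
  have afy: "all_full (U - {z}) (red f (\<lambda>_. y) {z})" using afz[of z y z' q] z z' q y by auto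
  have afy': "all_full (U - {z'}) (red f (\<lambda>_. y') {z'})" using afz[of z' y' z q] z z' q y' by auto
  have yx: "m y x = f x"
    using deleted_zero_or_weight[OF z(1) y(1) nsd[OF z(1)] U1 afy naf, of v x] v z x y m_sym[of x y] by auto
  have yh: "m y h = f h"
    using deleted_zero_or_weight[OF z(1) y(1) nsd[OF z(1)] U1 afy naf, of w h] w z h by auto
  have y'x: "m y' x = f x"
    using deleted_zero_or_weight[OF z'(1) y'(1) nsd[OF z'(1)] U1 afy' naf, of v x] v z' x y' m_sym[of x y'] by auto
  have "0 < m y y'"
  proof (rule ccontr)
    assume "\<not> 0 < m y y'"
    then have "m x y' = 0"
      using deleted_separates[OF z(1) y(1) nsd[OF z(1)] U1 afy naf, of v z' x y'] v z z' x y' y m_sym[of x y] by auto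
    then show False using y' by simp
  qed
  then have yy': "m y y' = f y'" "m y' y = f y"
    using deleted_zero_or_weight[OF z(1) y(1) nsd[OF z(1)] U1 afy naf, of z' y']
      deleted_zero_or_weight[OF z'(1) y'(1) nsd[OF z'(1)] U1 afy' naf, of z y] z z' y y' m_sym[of y y'] by auto
  have feq: "f y = f y'" using yy' m_sym[of y y'] by simp
  \<comment> \<open>One choice serves both overload tests for \<open>y\<close>: first on
    \<open>v\<close> and \<open>w\<close> with colours \<open>x\<close> and \<open>h\<close>, then
    on \<open>v\<close> and \<open>z'\<close> with colours \<open>x\<close> and
    \<open>y'\<close>.\<close>
  let ?t = "(\<lambda>_. h)(v := x, z' := y')"
  have "x \<in> X v" "h \<in> X w" "0 < f x" "0 < f h" "y' \<in> X z'" "y \<in> X z" using x h y y' by (auto simp: posD)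
  have xh: "m h x = 0" "m x h = 0" using m_le[of x v h w] m_sym[of x h] na \<open>x \<in> X v\<close> \<open>h \<in> X w\<close> by auto
  have "f x + f h \<le> f y"
  proof -
    have sd: "sdegen f ?t (insert w {v})"
      using sdegen_insert[of "{v}" f ?t w] sdegen_singleton[of f ?t v] vw z' xh \<open>0 < f x\<close> \<open>0 < f h\<close>
      by (auto simp: edges_to_def)
    have "edges_to y ?t (insert w {v}) \<le> f y"
    proof (rule extend_le[OF hard z(1) _ _ _ sd \<open>y \<in> X z\<close>])
      show "conn \<mu> (U - {w, v})" using nocut[of w v] v w vw z by blast
      show "choice ?t {w, v}" using \<open>x \<in> X v\<close> \<open>h \<in> X w\<close> vw z' by (auto simp: choice_def)
    qed (use v w z in auto)
    then show ?thesis using vw z' yx yh by (auto simp: edges_to_def)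
  qed
  then have lt: "f x < f y'" using feq \<open>0 < f h\<close> by simp
  \<comment> \<open>Because \<open>f x < f y'\<close>, the adjacent colours \<open>x\<close> and
    \<open>y'\<close> are strictly degenerate together; their load on \<open>y\<close> then exceeds
    \<open>f y = f y'\<close>.\<close>
  have "f x + f y' \<le> f y"
  proof -
    have sd: "sdegen f ?t (insert z' {v})"
      using sdegen_insert[of "{v}" f ?t z'] sdegen_singleton[of f ?t v] z' y'x lt \<open>0 < f x\<close>
      by (auto simp: edges_to_def)
    have "edges_to y ?t (insert z' {v}) \<le> f y"
    proof (rule extend_le[OF hard z(1) _ _ _ sd \<open>y \<in> X z\<close>])
      show "conn \<mu> (U - {z', v})" using nocut[of z' v] v z' z by blast
      show "choice ?t {z', v}" using \<open>x \<in> X v\<close> \<open>y' \<in> X z'\<close> z' by (auto simp: choice_def)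
    qed (use v z' z in auto)
    then show ?thesis using z' yx yy' by (auto simp: edges_to_def)
  qed
  then show False using feq \<open>0 < f x\<close> by simp
qed

lemma trichotomy_step: "trichotomy U f"
proof (cases "all_full U f \<or> complete_on U \<or> two_nbrs U")
  case True
  then show ?thesis using no_full_complete no_full_two_nbrs unfolding trichotomy_def by blast
next
  case False
  have "all_full U f"
  proof (cases "\<exists>a b J. cut_pair \<mu> U a b J")
    case True
    then obtain a0 b0 J0 where cut0: "cut_pair \<mu> U a0 b0 J0" by blast
    show ?thesis
    proof (cases "\<exists>a b J. cut_pair \<mu> U a b J \<and> 0 < \<mu> a b")
      case True
      then show ?thesis using adjacent_cut by blast
    next
      case False
      then have na: "\<forall>a b J. cut_pair \<mu> U a b J \<longrightarrow> \<mu> a b = 0" by auto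
      have "\<not> (\<forall>v\<in>U. card (nbrs \<mu> U v) = 2)"
        using \<open>\<not> (all_full U f \<or> complete_on U \<or> two_nbrs U)\<close> unfolding two_nbrs_def by blast
      then obtain a b J where "cut_pair \<mu> U a b J" "nonsep \<mu> (insert a (insert b J))"
        using nonsep_side_exists[OF mu finU ns cut0 na] by blast
      then show ?thesis using nonadjacent_cut na by blast
    qed
  next
    case no: False
    have "complete_on U"
    proof (rule no_cut_complete)
      fix p q assume "p \<in> U" "q \<in> U" "p \<noteq> q" "U - {p, q} \<noteq> {}"
      then show "conn \<mu> (U - {p, q})" using cut_pair_exists[OF mu, of p U q] no by blast
    qed (use False in blast)
    then show ?thesis using False by blast
  qed
  then show ?thesis unfolding trichotomy_def by blast
qed

end

end

context cover_system
begin

theorem hard_block_trichotomy: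
  "hard_block \<mu> X m U f \<Longrightarrow> trichotomy U f"
proof (induction "card U" arbitrary: U f rule: less_induct)
  case less
  interpret B: hard_block \<mu> X m U f by (rule less.prems)
  show ?case by (rule B.trichotomy_step) (rule less.hyps)
qed

end

section \<open>Multigraphs and covers\<close>

lemma multigraphD:
  assumes "multigraph G"
  shows "finite (verts G)" "mu G u v = mu G v u" "mu G v v = 0"
    "0 < mu G u v \<Longrightarrow> u \<in> verts G" "0 < mu G u v \<Longrightarrow> v \<in> verts G" "sym_mult (mu G)"
  using assms unfolding multigraph_def sym_mult_def by blast+

lemma card_edges_at:
  assumes "finite S" "\<And>w. w \<in> S \<Longrightarrow> w \<noteq> v"
  shows "finite {({v, w}, i) | w i. w \<in> S \<and> i < (k w :: nat)}"
    and "card {({v, w}, i) | w i. w \<in> S \<and> i < k w} = (\<Sum>w\<in>S. k w)"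
proof -
  let ?h = "\<lambda>(w, i). ({v, w}, i)" and ?D = "SIGMA w:S. {..<k w}"
  have eq: "{({v, w}, i) | w i. w \<in> S \<and> i < k w} = ?h ` ?D" by force
  have inj: "inj_on ?h ?D" by (auto simp: inj_on_def doubleton_eq_iff)
  show "finite {({v, w}, i) | w i. w \<in> S \<and> i < k w}" unfolding eq using assms(1) by simp
  show "card {({v, w}, i) | w i. w \<in> S \<and> i < k w} = (\<Sum>w\<in>S. k w)"
    unfolding eq card_image[OF inj] using assms(1) by simp
qed

lemma vdegree_eq_sum:
  assumes "multigraph G"
  shows "vdegree G v = (\<Sum>w\<in>verts G. mu G v w)"
proof -
  note G = multigraphD[OF assms]
  have "{e \<in> edges G. v \<in> fst e} = {({v, w}, i) | w i. w \<in> verts G - {v} \<and> i < mu G v w}"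
  proof (rule set_eqI)
    fix e
    show "e \<in> {e \<in> edges G. v \<in> fst e} \<longleftrightarrow> e \<in> {({v, w}, i) | w i. w \<in> verts G - {v} \<and> i < mu G v w}"
    proof
      assume "e \<in> {e \<in> edges G. v \<in> fst e}"
      then obtain a b i where e: "e = ({a, b}, i)" "i < mu G a b" "v = a \<or> v = b"
        unfolding edges_def by auto
      define w where "w = (if v = a then b else a)"
      have w: "e = ({v, w}, i)" "i < mu G v w" using e G(2)[of a b] unfolding w_def by auto
      then have "w \<in> verts G - {v}" using G(3)[of v] G(5)[of v w] by auto
      then show "e \<in> {({v, w}, i) | w i. w \<in> verts G - {v} \<and> i < mu G v w}" using w by blast
    qed (auto simp: edges_def)
  qed
  then have "vdegree G v = (\<Sum>w\<in>verts G - {v}. mu G v w)"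
    unfolding vdegree_def using card_edges_at(2)[of "verts G - {v}" v "mu G v"] G(1) by simp
  also have "\<dots> = (\<Sum>w\<in>verts G. mu G v w)"
    by (rule sum.mono_neutral_left) (use G(1,3) in auto)
  finally show ?thesis .
qed

text \<open>Each of the \<open>mu G u v\<close> matchings contains at most one edge at
  \<open>x\<close>, and their union contains all edges from \<open>x\<close> to
  \<open>X v\<close>.\<close>

lemma cover_sum_le:
  assumes cov: "cover G X H" and u: "u \<in> verts G" and v: "v \<in> verts G" and x: "x \<in> X u"
  shows "(\<Sum>y\<in>X v. mu H x y) \<le> mu G u v"
proof (cases "u = v")
  case True
  then have "(\<Sum>y\<in>X v. mu H x y) = 0" using cov v x unfolding cover_def independent_in_def by simp
  then show ?thesis by simp
next
  case False
  have H: "multigraph H" "verts H = (\<Union>v\<in>verts G. X v)" "disjoint_family_on X (verts G)"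
    using cov unfolding cover_def by auto
  obtain M where M: "\<And>i. i < mu G u v \<Longrightarrow> matching H (M i)"
    "edges_between H (X u) (X v) = (\<Union>i<mu G u v. M i)"
    using cov u v False unfolding cover_def by metis
  let ?E = "{({x, y}, i) | y i. y \<in> X v \<and> i < mu H x y}"
  have fin: "finite (X v)" using H(2) multigraphD(1)[OF H(1)] v by (metis UN_upper finite_subset)
  have "x \<notin> X v" using H(3) u v x False unfolding disjoint_family_on_def by blast
  then have ne: "\<And>y. y \<in> X v \<Longrightarrow> y \<noteq> x" by blast
  note E = card_edges_at[of "X v" x "mu H x", OF fin ne]
  have "?E \<subseteq> edges_between H (X u) (X v)"
  proof
    fix e assume "e \<in> ?E"
    then obtain y i where e: "e = ({x, y}, i)" "y \<in> X v" "i < mu H x y" by blast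
    then have "e \<in> edges H" "fst e = {x, y}" unfolding edges_def by auto
    then show "e \<in> edges_between H (X u) (X v)" using x e(2) unfolding edges_between_def by blast
  qed
  then have "?E \<subseteq> (\<Union>i<mu G u v. ?E \<inter> M i)" using M(2) by auto
  then have "card ?E \<le> card (\<Union>i<mu G u v. ?E \<inter> M i)" using E(1) by (intro card_mono) auto
  also have "\<dots> \<le> (\<Sum>i<mu G u v. card (?E \<inter> M i))" by (rule card_UN_le) simp
  also have "\<dots> \<le> (\<Sum>i<mu G u v. 1)"
  proof (rule sum_mono)
    fix i assume i: "i \<in> {..<mu G u v}"
    have "e = e'" if "e \<in> ?E \<inter> M i" "e' \<in> ?E \<inter> M i" for e e'
    proof (rule ccontr)
      assume "e \<noteq> e'"
      have "matching H (M i)" using M(1) i by simp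
      moreover have "e \<in> M i" "e' \<in> M i" using that by blast+
      ultimately have "fst e \<inter> fst e' = {}" using \<open>e \<noteq> e'\<close> unfolding matching_def by simp
      moreover have "x \<in> fst e" "x \<in> fst e'" using that by auto
      ultimately show False by blast
    qed
    then show "card (?E \<inter> M i) \<le> 1" using E(1) by (simp add: card_le_Suc0_iff_eq)
  qed
  finally show ?thesis using E(2) by simp
qed

section \<open>Blocks in terms of cut connectivity\<close>

lemma conn_cong:
  assumes "\<And>u v. u \<in> S \<Longrightarrow> v \<in> S \<Longrightarrow> \<mu> u v = \<mu>' u v"
  shows "conn \<mu> S = conn \<mu>' S"
proof -
  have "conn \<mu>' S" if c: "conn \<mu> S" and e: "\<And>u v. u \<in> S \<Longrightarrow> v \<in> S \<Longrightarrow> \<mu> u v = \<mu>' u v" for \<mu> \<mu>'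
    unfolding conn_def
  proof (intro conjI allI impI)
    show "S \<noteq> {}" using c unfolding conn_def by blast
    fix A assume A: "A \<subseteq> S" "A \<noteq> {} \<and> A \<noteq> S"
    obtain u w where uw: "u \<in> A" "w \<in> S - A" "0 < \<mu> u w" using conn_edge[OF c A(1)] A(2) by blast
    then have "0 < \<mu>' u w" using e[of u w] A by auto
    then show "\<exists>u\<in>A. \<exists>w\<in>S - A. 0 < \<mu>' u w" using uw by blast
  qed
  from this[of \<mu> \<mu>'] this[of \<mu>' \<mu>] show ?thesis using assms by metis
qed

lemma conn_mono:
  assumes "conn \<mu> S" "\<And>u v. \<mu> u v \<le> \<mu>' u v"
  shows "conn \<mu>' S"
  unfolding conn_def
proof (intro conjI allI impI)
  show "S \<noteq> {}" using assms(1) unfolding conn_def by blast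
  fix A assume A: "A \<subseteq> S" "A \<noteq> {} \<and> A \<noteq> S"
  obtain u w where uw: "u \<in> A" "w \<in> S - A" "0 < \<mu> u w" using conn_edge[OF assms(1) A(1)] A(2) by blast
  then have "0 < \<mu>' u w" using assms(2)[of u w] by simp
  then show "\<exists>u\<in>A. \<exists>w\<in>S - A. 0 < \<mu>' u w" using uw by blast
qed

lemma nonsep_mono: "nonsep \<mu> S \<Longrightarrow> (\<And>u v. \<mu> u v \<le> \<mu>' u v) \<Longrightarrow> nonsep \<mu>' S"
  unfolding nonsep_def using conn_mono by metis

lemma multigraph_induced: "multigraph G \<Longrightarrow> multigraph (induced G S)"
  unfolding multigraph_def induced_def by auto

lemma induced_simps [simp]:
  "verts (induced G S) = verts G \<inter> S"
  "mu (induced G S) u v = (if u \<in> S \<and> v \<in> S then mu G u v else 0)"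
  by (simp_all add: induced_def)

lemma connected_graph_iff_conn:
  assumes "multigraph G"
  shows "connected_graph G \<longleftrightarrow> conn (mu G) (verts G)"
proof
  note G = multigraphD[OF assms]
  assume con: "connected_graph G"
  show "conn (mu G) (verts G)"
    unfolding conn_def
  proof (intro conjI allI impI, rule_tac [2] ccontr)
    show "verts G \<noteq> {}" using con unfolding connected_graph_def by blast
    fix A assume A: "A \<subseteq> verts G" "A \<noteq> {} \<and> A \<noteq> verts G"
      and no: "\<not> (\<exists>u\<in>A. \<exists>w\<in>verts G - A. 0 < mu G u w)"
    obtain u w where uw: "u \<in> A" "w \<in> verts G - A" using A by blast
    then have "(\<lambda>u v. mu G u v > 0)\<^sup>*\<^sup>* u w" using con A unfolding connected_graph_def reachable_def by blast
    then have "w \<in> A" using uw(1)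
    proof (induction rule: rtranclp_induct)
      case (step p q)
      then show ?case using no G(5)[of p q] by blast
    qed
    then show False using uw by blast
  qed
next
  assume con: "conn (mu G) (verts G)"
  show "connected_graph G"
    unfolding connected_graph_def
  proof (intro conjI ballI)
    show "verts G \<noteq> {}" using con unfolding conn_def by blast
    fix u v assume uv: "u \<in> verts G" "v \<in> verts G"
    have "{w \<in> verts G. reachable G u w} = verts G"
    proof (rule conn_closed[OF con])
      show "{w \<in> verts G. reachable G u w} \<noteq> {}" using uv unfolding reachable_def by blast
      fix p q assume "p \<in> {w \<in> verts G. reachable G u w}" "q \<in> verts G" "0 < mu G p q"
      then show "q \<in> {w \<in> verts G. reachable G u w}"
        unfolding reachable_def by (auto intro: rtranclp.rtrancl_into_rtrancl)
    qed blast
    then show "reachable G u v" using uv by blast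
  qed
qed

lemma card_components_ge_2_iff:
  assumes "multigraph G"
  shows "2 \<le> card (components G) \<longleftrightarrow> verts G \<noteq> {} \<and> \<not> connected_graph G"
proof -
  note G = multigraphD[OF assms]
  define R where "R = {(u, v). u \<in> verts G \<and> v \<in> verts G \<and> reachable G u v}"
  have comps: "components G = verts G // R" unfolding components_def R_def ..
  have "symp (\<lambda>u v. 0 < mu G u v)" using G(2) by (simp add: symp_def)
  then have "symp (reachable G)" unfolding reachable_def by (rule symp_rtranclp)
  then have eqv: "equiv (verts G) R"
    unfolding R_def equiv_def refl_on_def sym_def trans_def
    by (auto simp: reachable_def dest: sympD intro: rtranclp_trans)
  show ?thesis
  proof
    assume ge: "2 \<le> card (components G)"
    have "verts G \<noteq> {}" using ge unfolding comps by auto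
    moreover have "\<not> connected_graph G"
    proof
      assume con: "connected_graph G"
      have "verts G // R \<subseteq> {verts G}"
        using con unfolding quotient_def R_def connected_graph_def by auto
      then have "card (verts G // R) \<le> card {verts G}" by (intro card_mono) auto
      then show False using ge unfolding comps by simp
    qed
    ultimately show "verts G \<noteq> {} \<and> \<not> connected_graph G" by blast
  next
    assume "verts G \<noteq> {} \<and> \<not> connected_graph G"
    then obtain u v where uv: "u \<in> verts G" "v \<in> verts G" "\<not> reachable G u v"
      unfolding connected_graph_def by blast
    have "R `` {u} \<noteq> R `` {v}" using eq_equiv_class[OF _ eqv uv(2)] uv(3) unfolding R_def by blast
    then have "card {R `` {u}, R `` {v}} = 2" by simp
    moreover have "{R `` {u}, R `` {v}} \<subseteq> verts G // R" using uv by (auto intro: quotientI)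
    moreover have "finite (verts G // R)" using G(1) by (rule finite_quotient) (auto simp: R_def)
    ultimately show "2 \<le> card (components G)" unfolding comps by (metis card_mono)
  qed
qed

lemma nonseparable_iff_nonsep:
  assumes "multigraph G"
  shows "nonseparable G \<longleftrightarrow> nonsep (mu G) (verts G)"
proof -
  have "separating_vertex G c \<longleftrightarrow> \<not> (verts G = {c} \<or> conn (mu G) (verts G - {c}))" if c: "c \<in> verts G" for c
  proof -
    have D: "multigraph (delete_vertex G c)" "verts (delete_vertex G c) = verts G - {c}"
      using multigraph_induced[OF assms] unfolding delete_vertex_def by auto
    have "conn (mu (delete_vertex G c)) (verts G - {c}) = conn (mu G) (verts G - {c})"
      by (rule conn_cong) (simp add: delete_vertex_def)
    then show ?thesis
      using card_components_ge_2_iff[OF D(1)] connected_graph_iff_conn[OF D(1)] c D(2)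
      unfolding separating_vertex_def by auto
  qed
  then have "(\<exists>c. separating_vertex G c) \<longleftrightarrow> (\<exists>c\<in>verts G. \<not> (verts G = {c} \<or> conn (mu G) (verts G - {c})))"
    unfolding separating_vertex_def by blast
  then show ?thesis
    unfolding nonseparable_def nonsep_def connected_graph_iff_conn[OF assms] by blast
qed

text \<open>Adding the missing edges of \<open>G\<close> on the same vertices keeps \<open>B\<close>
  nonseparable, so by maximality none is missing.\<close>

lemma block_of_induced:
  assumes G: "multigraph G" and B: "block_of B G"
  shows "B = induced G (verts B)" "verts B \<subseteq> verts G" "nonsep (mu G) (verts B)"
proof -
  have sub: "subgraph B G" and nsB: "nonseparable B" using B unfolding block_of_def by auto
  have mB: "multigraph B" and V: "verts B \<subseteq> verts G" and le: "\<And>u v. mu B u v \<le> mu G u v"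
    using sub unfolding subgraph_def by auto
  show "verts B \<subseteq> verts G" by (rule V)
  show ns: "nonsep (mu G) (verts B)"
    using nonsep_mono[of "mu B" "verts B" "mu G"] nsB le nonseparable_iff_nonsep[OF mB] by blast
  let ?I = "induced G (verts B)"
  have mI: "multigraph ?I" and vI: "verts ?I = verts B" using multigraph_induced[OF G] V by auto
  have cong: "conn (mu ?I) S = conn (mu G) S" if "S \<subseteq> verts B" for S
    by (rule conn_cong) (use that in auto)
  have "nonsep (mu ?I) (verts B)"
    using ns cong[of "verts B"] cong[of "verts B - {c}" for c] unfolding nonsep_def by auto
  then have "nonseparable ?I" using nonseparable_iff_nonsep[OF mI] vI by simp
  moreover have "subgraph ?I G" using mI V unfolding subgraph_def by auto
  moreover have "subgraph B ?I"
    unfolding subgraph_def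
  proof (intro conjI allI)
    fix u v show "mu B u v \<le> mu ?I u v"
      using le[of u v] multigraphD(4,5)[OF mB, of u v] by (cases "mu B u v = 0") auto
  qed (use mB vI in auto)
  ultimately show "B = ?I" using B unfolding block_of_def by metis
qed

subsection \<open>Bricks\<close>

lemma brick_complete:
  assumes B: "multigraph B" "verts B \<noteq> {}"
    and eq: "\<And>u v. u \<in> verts B \<Longrightarrow> v \<in> verts B \<Longrightarrow> u \<noteq> v \<Longrightarrow> mu B u v = t" and t: "1 \<le> t"
  shows "brick B"
proof -
  let ?n = "card (verts B)"
  have fin: "finite (verts B)" using multigraphD(1)[OF B(1)] .
  obtain h where h: "bij_betw h (verts B) {0..<?n}" using ex_bij_betw_finite_nat[OF fin] by blast
  have "graph_iso B (multiple t (complete_graph ?n))"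
    unfolding graph_iso_def
  proof (intro exI conjI ballI)
    show "bij_betw h (verts B) (verts (multiple t (complete_graph ?n)))"
      using h by (simp add: multiple_def complete_graph_def lessThan_atLeast0)
    fix u v assume uv: "u \<in> verts B" "v \<in> verts B"
    have lt: "h u < ?n" "h v < ?n" using h uv unfolding bij_betw_def by auto
    have "h u = h v \<longleftrightarrow> u = v" using h uv unfolding bij_betw_def inj_on_def by blast
    then show "mu (multiple t (complete_graph ?n)) (h u) (h v) = mu B u v"
      using lt eq[OF uv] multigraphD(3)[OF B(1), of v] by (auto simp: multiple_def complete_graph_def)
  qed
  moreover have "1 \<le> ?n" using B(2) fin by (simp add: Suc_leI card_gt_0_iff)
  ultimately show ?thesis using t unfolding brick_def by blast
qed

text \<open>Take a longest path. The neighbours of its last vertex lie on it, and the one other than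
  the predecessor is the first vertex, since an inner vertex would get a third neighbour. The
  resulting cycle is closed under adjacency.\<close>

lemma cycle_enumeration:
  assumes mu: "sym_mult \<mu>" and fin: "finite U" and con: "conn \<mu> U"
    and two: "\<And>v. v \<in> U \<Longrightarrow> card (nbrs \<mu> U v) = 2"
  obtains n :: nat and g where "3 \<le> n" "bij_betw g {..<n} U"
    "\<forall>i<n. \<forall>j<n. 0 < \<mu> (g i) (g j) \<longleftrightarrow> j = (i + 1) mod n \<or> i = (j + 1) mod n"
proof -
  define path where "path k g \<longleftrightarrow> inj_on g {..k} \<and> g ` {..k} \<subseteq> U \<and> (\<forall>i<k. 0 < \<mu> (g i) (g (Suc i)))"
    for k :: nat and g :: "nat \<Rightarrow> 'a"
  have finN: "finite (nbrs \<mu> U v)" for v using fin unfolding nbrs_def by simp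
  obtain u where "u \<in> U" using conn_nonempty[OF con] by blast
  then have "\<exists>g. path 0 g" by (intro exI[of _ "\<lambda>_. u"]) (auto simp: path_def)
  moreover have "k \<le> card U" if k: "\<exists>g. path k g" for k
  proof -
    obtain g where g: "inj_on g {..k}" "g ` {..k} \<subseteq> U" using k unfolding path_def by blast
    have "card {..k} \<le> card U" using card_inj_on_le[OF g fin] .
    then show ?thesis by simp
  qed
  ultimately obtain k where k: "\<exists>g. path k g" and mx: "\<And>l. \<exists>g. path l g \<Longrightarrow> l \<le> k"
    using Nat.ex_has_greatest_nat[of "\<lambda>k. \<exists>g. path k g" 0 "card U"] by blast
  then obtain g where g: "inj_on g {..k}" "g ` {..k} \<subseteq> U" "\<And>i. i < k \<Longrightarrow> 0 < \<mu> (g i) (g (Suc i))"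
    unfolding path_def by blast
  have gU: "g i \<in> U" if "i \<le> k" for i using g(2) that by auto
  have inj: "g i = g j \<longleftrightarrow> i = j" if "i \<le> k" "j \<le> k" for i j using g(1) that unfolding inj_on_def by auto
  have bwd: "0 < \<mu> (g (Suc i)) (g i)" if "i < k" for i using g(3)[OF that] sym_multD(1)[OF mu] by metis
  have inpath: "w \<in> g ` {..<k}" if w: "w \<in> nbrs \<mu> U (g k)" for w
  proof (rule ccontr)
    assume neg: "w \<notin> g ` {..<k}"
    have "w \<noteq> g k" "w \<in> U" "0 < \<mu> (g k) w" using w sym_multD(2)[OF mu] unfolding nbrs_def by auto
    have w': "w \<notin> g ` {..k}"
    proof
      assume "w \<in> g ` {..k}"
      then obtain i where "i \<le> k" "w = g i" by auto
      then show False using neg \<open>w \<noteq> g k\<close> by (cases "i = k") auto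
    qed
    let ?g = "g(Suc k := w)"
    have im: "?g ` {..k} = g ` {..k}" by (rule image_cong) auto
    have "inj_on ?g (insert (Suc k) {..k})"
      unfolding inj_on_insert using g(1) w' im by (auto simp: inj_on_def)
    then have "inj_on ?g {..Suc k}" by (simp add: atMost_Suc)
    moreover have "?g ` {..Suc k} \<subseteq> U" using g(2) \<open>w \<in> U\<close> by (auto simp: atMost_Suc)
    moreover have "0 < \<mu> (?g i) (?g (Suc i))" if "i < Suc k" for i
      using g(3)[of i] \<open>0 < \<mu> (g k) w\<close> that by (cases "i = k") auto
    ultimately have "path (Suc k) ?g" unfolding path_def by blast
    then show False using mx[of "Suc k"] by force
  qed
  have "card (nbrs \<mu> U (g k)) \<le> card (g ` {..<k})" using inpath by (intro card_mono) auto
  also have "\<dots> \<le> k" using card_image_le[of "{..<k}" g] by simp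
  finally have k2: "2 \<le> k" using two[OF gU[of k]] by simp
  have closes: "0 < \<mu> (g k) (g 0)"
  proof -
    obtain a b where ab: "nbrs \<mu> U (g k) = {a, b}" "a \<noteq> b" using two[OF gU[of k]] by (auto simp: card_2_iff)
    define w where "w = (if a = g (k - 1) then b else a)"
    have w: "w \<in> nbrs \<mu> U (g k)" "w \<noteq> g (k - 1)" using ab unfolding w_def by auto
    obtain j where j: "j < k" "w = g j" using inpath[OF w(1)] by auto
    have jk: "j \<noteq> k - 1" using w(2) j by auto
    have adj: "0 < \<mu> (g k) (g j)" using w(1) j unfolding nbrs_def by simp
    have "j = 0"
    proof (rule ccontr)
      assume "j \<noteq> 0"
      then have j1: "j - 1 < k" "Suc (j - 1) = j" "Suc j < k" using j jk by auto
      have "0 < \<mu> (g j) (g (j - 1))" "0 < \<mu> (g j) (g (Suc j))" "0 < \<mu> (g j) (g k)"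
        using bwd[OF j1(1)] g(3)[OF j(1)] adj sym_multD(1)[OF mu, of "g k"] j1 by auto
      then have "{g (j - 1), g (Suc j), g k} \<subseteq> nbrs \<mu> U (g j)"
        using gU j1 j unfolding nbrs_def by auto
      then have "card {g (j - 1), g (Suc j), g k} \<le> 2"
        using card_mono[OF finN[of "g j"]] two[OF gU[of j]] j by fastforce
      moreover have "card {g (j - 1), g (Suc j), g k} = 3"
        using inj[of "j - 1" "Suc j"] inj[of "j - 1" k] inj[of "Suc j" k] j1 by simp
      ultimately show False by simp
    qed
    then show ?thesis using adj by simp
  qed
  let ?n = "Suc k"
  have succ: "(i + 1) mod ?n = (if i = k then 0 else Suc i)" if "i < ?n" for i using that by auto
  define pr where "pr i = (if i = 0 then k else i - 1)" for i
  have pr: "pr i \<le> k" "(pr i + 1) mod ?n = i" "(i + 1) mod ?n \<noteq> pr i" if "i < ?n" for i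
    using that k2 succ[of "pr i"] succ[of i] unfolding pr_def by (auto split: if_splits)
  have nx: "0 < \<mu> (g i) (g ((i + 1) mod ?n))" if "i < ?n" for i
    using g(3)[of i] closes that succ[OF that] by (cases "i = k") auto
  have N: "nbrs \<mu> U (g i) = {g ((i + 1) mod ?n), g (pr i)}" if i: "i < ?n" for i
  proof -
    have lt: "(i + 1) mod ?n \<le> k" using mod_less_divisor[of ?n "i + 1"] by simp
    have "0 < \<mu> (g i) (g (pr i))"
      using nx[of "pr i"] pr[OF i] sym_multD(1)[OF mu, of "g i"] by simp
    then have "{g ((i + 1) mod ?n), g (pr i)} \<subseteq> nbrs \<mu> U (g i)"
      using nx[OF i] gU[OF lt] gU[OF pr(1)[OF i]] unfolding nbrs_def by auto
    moreover have "card {g ((i + 1) mod ?n), g (pr i)} = 2"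
      using inj[OF lt pr(1)[OF i]] pr(3)[OF i] by simp
    ultimately show ?thesis using card_subset_eq[OF finN, of "{g ((i + 1) mod ?n), g (pr i)}" "g i"] two[OF gU[of i]] i by simp
  qed
  have onto: "g ` {..<?n} = U"
  proof (rule conn_closed[OF con])
    show "g ` {..<?n} \<subseteq> U" using gU by auto
    fix p q assume p: "p \<in> g ` {..<?n}" and q: "q \<in> U" "0 < \<mu> p q"
    obtain i where i: "i < ?n" "p = g i" using p by auto
    have "q \<in> {g ((i + 1) mod ?n), g (pr i)}" using q N[OF i(1)] i(2) unfolding nbrs_def by blast
    moreover have "(i + 1) mod ?n < ?n" "pr i < ?n" using pr(1)[OF i(1)] by auto
    ultimately show "q \<in> g ` {..<?n}" by blast
  qed (auto simp: lessThan_Suc)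
  show ?thesis
  proof (rule that[of ?n g])
    show "3 \<le> ?n" using k2 by simp
    show "bij_betw g {..<?n} U" using onto g(1) unfolding bij_betw_def by (simp add: lessThan_Suc_atMost)
    have "0 < \<mu> (g i) (g j) \<longleftrightarrow> j = (i + 1) mod ?n \<or> i = (j + 1) mod ?n" if ij: "i < ?n" "j < ?n" for i j
    proof -
      have "0 < \<mu> (g i) (g j) \<longleftrightarrow> g j \<in> nbrs \<mu> U (g i)" using gU[of j] ij unfolding nbrs_def by simp
      also have "\<dots> \<longleftrightarrow> j = (i + 1) mod ?n \<or> j = pr i"
        using N[OF ij(1)] inj[of j "(i + 1) mod ?n"] inj[of j "pr i"] pr(1)[OF ij(1)] ij mod_less_divisor[of ?n "i + 1"]
        by auto
      also have "j = pr i \<longleftrightarrow> i = (j + 1) mod ?n"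
        using succ[OF ij(2)] ij unfolding pr_def by auto
      finally show ?thesis .
    qed
    then show "\<forall>i<?n. \<forall>j<?n. 0 < \<mu> (g i) (g j) \<longleftrightarrow> j = (i + 1) mod ?n \<or> i = (j + 1) mod ?n" by blast
  qed
qed

lemma brick_cycle:
  assumes B: "multigraph B" and con: "conn (mu B) (verts B)"
    and two: "\<And>v. v \<in> verts B \<Longrightarrow> card (nbrs (mu B) (verts B) v) = 2"
    and eq: "\<And>u v. 0 < mu B u v \<Longrightarrow> mu B u v = t" and t: "1 \<le> t"
  shows "brick B"
proof -
  obtain n :: nat and g where n: "3 \<le> n" and g: "bij_betw g {..<n} (verts B)"
    and adj: "\<forall>i<n. \<forall>j<n. 0 < mu B (g i) (g j) \<longleftrightarrow> j = (i + 1) mod n \<or> i = (j + 1) mod n"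
    using cycle_enumeration[OF multigraphD(6,1)[OF B] con two] by metis
  let ?h = "inv_into {..<n} g"
  have h: "bij_betw ?h (verts B) {..<n}" using bij_betw_inv_into[OF g] .
  have "graph_iso B (multiple t (cycle_graph n))"
    unfolding graph_iso_def
  proof (intro exI conjI ballI)
    show "bij_betw ?h (verts B) (verts (multiple t (cycle_graph n)))"
      using h by (simp add: multiple_def cycle_graph_def)
    fix u v assume uv: "u \<in> verts B" "v \<in> verts B"
    have lt: "?h u < n" "?h v < n" using h uv unfolding bij_betw_def by auto
    have gh: "g (?h u) = u" "g (?h v) = v" using g uv by (simp_all add: bij_betw_inv_into_right)
    have iff: "0 < mu B u v \<longleftrightarrow> ?h v = (?h u + 1) mod n \<or> ?h u = (?h v + 1) mod n"
      using adj lt gh by metis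
    show "mu (multiple t (cycle_graph n)) (?h u) (?h v) = mu B u v"
    proof (cases "0 < mu B u v")
      case True
      then show ?thesis using iff lt eq[OF True] by (simp add: multiple_def cycle_graph_def)
    next
      case False
      then show ?thesis using iff by (auto simp: multiple_def cycle_graph_def)
    qed
  qed
  then show ?thesis using n t unfolding brick_def by blast
qed

subsection \<open>Critical graphs\<close>

text \<open>Members of \<open>P\<close> have natural numbers as vertices, so criticality of a graph
  over another type is examined on such a copy.\<close>

lemma nat_copy_exists:
  assumes "multigraph K"
  obtains N :: "nat mgraph" and h where "multigraph N" "bij_betw h (verts K) (verts N)"
    "\<And>u v. u \<in> verts K \<Longrightarrow> v \<in> verts K \<Longrightarrow> mu N (h u) (h v) = mu K u v"
proof -
  note K = multigraphD[OF assms]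
  obtain h where h: "bij_betw h (verts K) {0..<card (verts K)}" using ex_bij_betw_finite_nat[OF K(1)] by blast
  let ?V = "{0..<card (verts K)}" and ?i = "inv_into (verts K) h"
  define N where "N = \<lparr>verts = ?V, mu = (\<lambda>a b. if a \<in> ?V \<and> b \<in> ?V then mu K (?i a) (?i b) else 0)\<rparr>"
  have "multigraph N" unfolding multigraph_def N_def using K(2,3) by auto
  moreover have "bij_betw h (verts K) (verts N)" using h unfolding N_def by simp
  moreover have "mu N (h u) (h v) = mu K u v" if "u \<in> verts K" "v \<in> verts K" for u v
    using that h bij_betw_inv_into_left[OF h] unfolding N_def bij_betw_def by auto
  ultimately show ?thesis using that by blast
qed

text \<open>An inclusion-minimal \<open>S\<close> inducing a graph outside \<open>P\<close> is
  critical, so its minimum degree is at least \<open>crit_degree P\<close>. It is nonempty because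
  heredity puts the empty graph into \<open>P\<close>.\<close>

lemma critical_subgraph:
  assumes P: "reliable_property P" and r: "crit_degree P = r" and N: "multigraph N" "N \<notin> P"
  obtains S where "S \<subseteq> verts N" "S \<noteq> {}" "induced N S \<in> CR P"
    "\<And>v. v \<in> S \<Longrightarrow> r \<le> (\<Sum>w\<in>S. mu N v w)"
proof -
  note mN = multigraphD[OF N(1)]
  have her: "\<And>G S. G \<in> P \<Longrightarrow> S \<subseteq> verts G \<Longrightarrow> induced G S \<in> P"
    using P unfolding reliable_property_def hereditary_property_def by blast
  have ext: "G = G'" if "verts G = verts G'" "mu G = mu G'" for G G' :: "nat mgraph" using that by simp
  let ?F = "{S. S \<subseteq> verts N \<and> induced N S \<notin> P}"
  have "induced N (verts N) = N"
    by (rule ext) (use mN(4,5) in \<open>auto simp: fun_eq_iff\<close>)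
  then have "finite ?F" "verts N \<in> ?F" using mN(1) N(2) by auto
  then obtain S where S: "S \<in> ?F" and "\<forall>T\<in>?F. T \<subseteq> S \<longrightarrow> S = T"
    using finite_has_minimal2[of ?F "verts N"] by meson
  then have mn: "induced N T \<in> P" if "T \<subset> S" for T using that by blast
  have SV: "S \<subseteq> verts N" using S by blast
  have "S \<noteq> {}"
  proof
    assume "S = {}"
    obtain Q where Q: "Q \<in> P" using P unfolding reliable_property_def nontrivial_property_def by blast
    have "induced Q {} = induced N {}" by (rule ext) (auto simp: fun_eq_iff)
    then show False using her[OF Q, of "{}"] S \<open>S = {}\<close> by simp
  qed
  let ?K = "induced N S"
  have mK: "multigraph ?K" using multigraph_induced[OF N(1)] .
  have vK: "verts ?K = S" using SV by auto
  have "delete_vertex ?K v \<in> P" if "v \<in> S" for v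
  proof -
    have "delete_vertex ?K v = induced N (S - {v})"
      unfolding delete_vertex_def by (rule ext) (use SV in \<open>auto simp: fun_eq_iff\<close>)
    then show ?thesis using mn[of "S - {v}"] that by auto
  qed
  then have crit: "?K \<in> CR P" unfolding CR_def using S mK vK by auto
  have "r \<le> min_degree ?K" unfolding r[symmetric] crit_degree_def by (rule Least_le) (use crit in blast)
  have "r \<le> (\<Sum>w\<in>S. mu N v w)" if v: "v \<in> S" for v
  proof -
    have "min_degree ?K \<le> vdegree ?K v"
      unfolding min_degree_def vK using v SV mN(1) by (intro Min_le) (auto intro: finite_subset)
    also have "\<dots> = (\<Sum>w\<in>S. mu ?K v w)" using vdegree_eq_sum[OF mK] vK by simp
    also have "\<dots> = (\<Sum>w\<in>S. mu N v w)" using v by (intro sum.cong) auto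
    finally show ?thesis using \<open>r \<le> min_degree ?K\<close> by simp
  qed
  then show ?thesis using that SV \<open>S \<noteq> {}\<close> crit by blast
qed

lemma not_in_class_dense:
  assumes P: "reliable_property P" and r: "crit_degree P = r" and K: "multigraph K" "\<not> in_class K P"
  obtains S where "S \<subseteq> verts K" "S \<noteq> {}" "\<And>v. v \<in> S \<Longrightarrow> r \<le> (\<Sum>w\<in>S. mu K v w)"
    "S = verts K \<Longrightarrow> in_class K (CR P)"
proof -
  obtain N :: "nat mgraph" and h where N: "multigraph N" "bij_betw h (verts K) (verts N)"
    "\<And>u v. u \<in> verts K \<Longrightarrow> v \<in> verts K \<Longrightarrow> mu N (h u) (h v) = mu K u v"
    using nat_copy_exists[OF K(1)] by blast
  have iso: "graph_iso K N" unfolding graph_iso_def using N by blast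
  then have "N \<notin> P" using K unfolding in_class_def by blast
  then obtain S' where S': "S' \<subseteq> verts N" "S' \<noteq> {}" "induced N S' \<in> CR P"
    "\<And>v. v \<in> S' \<Longrightarrow> r \<le> (\<Sum>w\<in>S'. mu N v w)"
    using critical_subgraph[OF P r N(1)] by blast
  define S where "S = {v \<in> verts K. h v \<in> S'}"
  have im: "h ` S = S'" using S'(1) N(2) unfolding S_def bij_betw_def by auto
  have bij: "bij_betw h S S'"
    using im N(2) unfolding bij_betw_def S_def by (auto intro: inj_on_subset)
  show ?thesis
  proof (rule that[of S])
    show "S \<subseteq> verts K" unfolding S_def by blast
    show "S \<noteq> {}" using im S'(2) by blast
    show "r \<le> (\<Sum>w\<in>S. mu K v w)" if v: "v \<in> S" for v
    proof -
      have "(\<Sum>w\<in>S. mu K v w) = (\<Sum>w\<in>S. mu N (h v) (h w))"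
        using v N(3) unfolding S_def by (intro sum.cong) auto
      also have "\<dots> = (\<Sum>w\<in>S'. mu N (h v) w)" by (rule sum.reindex_bij_betw[OF bij])
      finally show ?thesis using S'(4)[of "h v"] v unfolding S_def by simp
    qed
    show "in_class K (CR P)" if "S = verts K"
    proof -
      have "S' = verts N" using im that N(2) unfolding bij_betw_def by simp
      then have "induced N S' = N"
        using multigraphD(4,5)[OF N(1)] by (intro mgraph.equality) (auto simp: fun_eq_iff)
      then show ?thesis using S'(3) iso K(1) unfolding in_class_def by auto
    qed
  qed
qed

section \<open>The theorem\<close>

text \<open>\<open>cover\<close> says nothing about \<open>X\<close> outside \<open>G\<close>, while
  the locale quantifies over all vertices; hence the colour sets there are emptied.\<close>

lemma cover_system_of_cover:
  assumes G: "multigraph G" and cov: "cover G X H"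
  shows "cover_system (mu G) (\<lambda>v. if v \<in> verts G then X v else {}) (mu H)"
proof
  have H: "multigraph H" "verts H = (\<Union>v\<in>verts G. X v)" using cov unfolding cover_def by auto
  show "sym_mult (mu G)" "sym_mult (mu H)" using multigraphD(6) G H(1) by auto
  show "finite (if v \<in> verts G then X v else {})" for v
    using multigraphD(1)[OF H(1)] H(2) by (auto intro: finite_subset)
  show "(\<Sum>y\<in>(if v \<in> verts G then X v else {}). mu H x y) \<le> mu G u v"
    if "x \<in> (if u \<in> verts G then X u else {})" for x u v
    using cover_sum_le[OF cov, of u v x] that by (auto split: if_splits)
qed

lemma hard_of_not_colorable:
  assumes P: "reliable_property P" and r: "crit_degree P = r"
    and G: "multigraph G" and con: "connected_graph G" and cvr: "cover G X H"
    and deg: "\<And>v. v \<in> verts G \<Longrightarrow> r * card (X v) \<ge> vdegree G v"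
    and nc: "\<not> colorable P G X H"
  shows "cover_system.hard (mu G) (\<lambda>v. if v \<in> verts G then X v else {}) (mu H) (verts G) (\<lambda>_. r)"
proof -
  interpret cover_system "mu G" "\<lambda>v. if v \<in> verts G then X v else {}" "mu H"
    by (rule cover_system_of_cover[OF G cvr])
  have H: "multigraph H" "verts H = (\<Union>v\<in>verts G. X v)" "disjoint_family_on X (verts G)"
    using cvr unfolding cover_def by auto
  have "weighted (verts G) (\<lambda>_. r)"
    unfolding weighted_def
  proof (intro conjI ballI)
    show "finite (verts G)" using multigraphD(1)[OF G] .
    show "conn (mu G) (verts G)" using con connected_graph_iff_conn[OF G] by blast
    fix u assume "u \<in> verts G"
    then show "(\<Sum>w\<in>verts G. mu G u w) \<le> (\<Sum>x\<in>(if u \<in> verts G then X u else {}). r)"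
      using deg[of u] vdegree_eq_sum[OF G, of u] by (simp add: mult.commute)
  qed
  moreover have "\<not> sdegen (\<lambda>_. r) t (verts G)" if t: "choice t (verts G)" for t
  proof
    assume sd: "sdegen (\<lambda>_. r) t (verts G)"
    have tX: "t v \<in> X v" if "v \<in> verts G" for v using t that unfolding choice_def by auto
    have uniq: "v = w" if "v \<in> verts G" "w \<in> verts G" "t v \<in> X w" for v w
      using tX[OF that(1)] that H(3) unfolding disjoint_family_on_def by blast
    have inj: "inj_on t (verts G)" using uniq tX by (metis inj_onI)
    let ?T = "t ` verts G"
    have TH: "?T \<subseteq> verts H" using tX H(2) by auto
    have "?T \<inter> X v = {t v}" if "v \<in> verts G" for v using uniq that tX by blast
    then have trans: "transversal G X H ?T" using TH unfolding transversal_def by simp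
    have mI: "multigraph (induced H ?T)" using multigraph_induced[OF H(1)] .
    have "in_class (induced H ?T) P"
    proof (rule ccontr)
      assume "\<not> in_class (induced H ?T) P"
      then obtain S where S: "S \<subseteq> verts (induced H ?T)" "S \<noteq> {}"
        "\<And>x. x \<in> S \<Longrightarrow> r \<le> (\<Sum>y\<in>S. mu (induced H ?T) x y)"
        using not_in_class_dense[OF P r mI] by metis
      have ST: "S \<subseteq> ?T" using S(1) by auto
      define S0 where "S0 = {v \<in> verts G. t v \<in> S}"
      have im: "t ` S0 = S" using ST unfolding S0_def by auto
      then have "S0 \<noteq> {}" "S0 \<subseteq> verts G" using S(2) unfolding S0_def by auto
      then obtain u where u: "u \<in> S0" "edges_to (t u) t S0 < r" using sd unfolding sdegen_def by blast
      have "inj_on t S0" using inj unfolding S0_def by (auto intro: inj_on_subset)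
      then have "edges_to (t u) t S0 = (\<Sum>y\<in>S. mu H (t u) y)"
        unfolding edges_to_def im[symmetric] by (simp add: sum.reindex)
      also have "\<dots> = (\<Sum>y\<in>S. mu (induced H ?T) (t u) y)"
        using u(1) ST unfolding S0_def by (intro sum.cong) auto
      finally show False using S(3)[of "t u"] u unfolding S0_def by simp
    qed
    then show False using nc trans unfolding colorable_def by blast
  qed
  ultimately show ?thesis unfolding hard_def by blast
qed

theorem theorem7:
  fixes P :: "nat mgraph set" and r :: nat
    and G :: "'a mgraph" and X :: "'a \<Rightarrow> 'b set" and H :: "'b mgraph"
  assumes "reliable_property P"
    and "crit_degree P = r"
    and "multigraph G" and "connected_graph G"
    and "cover G X H"
    and "\<And>v. v \<in> verts G \<Longrightarrow> r * card (X v) \<ge> vdegree G v"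
    and "\<not> colorable P G X H"
  shows "\<forall>B. block_of B G \<longrightarrow>
           brick B \<or>
           (\<exists>t B'. t \<ge> 1 \<and> multigraph B' \<and> B = multiple t B' \<and>
              ((in_class B' (CR P) \<and> regular_graph r B') \<or>
               (in_class B' P \<and> max_degree B' \<le> r)))"
proof (intro allI impI)
  fix B assume B: "block_of B G"
  let ?X = "\<lambda>v. if v \<in> verts G then X v else {}" and ?U = "verts B"
  note blk = block_of_induced[OF assms(3) B]
  have mB: "multigraph B" using B unfolding block_of_def subgraph_def by blast
  have muB: "mu B u v = (if u \<in> ?U \<and> v \<in> ?U then mu G u v else 0)" for u v
    using arg_cong[OF blk(1), of "\<lambda>G. mu G u v"] by simp
  interpret cover_system "mu G" ?X "mu H" by (rule cover_system_of_cover[OF assms(3,5)])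
  have hardG: "hard (verts G) (\<lambda>_. r)" by (rule hard_of_not_colorable[OF assms])
  have conU: "conn (mu G) ?U" using nonsepD(1)[OF blk(3)] .
  obtain v0 where v0: "v0 \<in> ?U" using conn_nonempty[OF conU] by blast
  show "brick B \<or> (\<exists>t B'. t \<ge> 1 \<and> multigraph B' \<and> B = multiple t B' \<and>
              ((in_class B' (CR P) \<and> regular_graph r B') \<or> (in_class B' P \<and> max_degree B' \<le> r)))"
  proof (cases "?U = {v0}")
    case True
    then have "brick B" using brick_complete[OF mB, of 1] by auto
    then show ?thesis ..
  next
    case False
    have big: "?U \<noteq> {u}" for u
    proof
      assume "?U = {u}"
      then have "u = v0" using v0 by simp
      then show False using False \<open>?U = {u}\<close> by simp
    qed
    let ?A = "verts G - ?U"
    have UA: "verts G - ?A = ?U" using blk(2) by blast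
    have "v0 \<in> verts G" using v0 blk(2) by blast
    \<comment> \<open>Greedy colouring towards a vertex of the block colours everything outside the
      block; only that part of the colouring is kept.\<close>
    then obtain s where "hole (verts G) (\<lambda>_. r) s v0" using hole_exists[OF hardD(1)[OF hardG]] by blast
    then have s: "choice s ?A" "sdegen (\<lambda>_. r) s ?A"
      using v0 choice_mono[of s "verts G - {v0}" ?A] sdegen_mono[of _ s "verts G - {v0}" ?A]
      unfolding hole_def by auto
    define g where "g = red (\<lambda>_. r) s ?A"
    have g_le: "g x \<le> r" for x unfolding g_def red_def by simp
    have "hard ?U g" using hard_reduce[OF hardG _ s] conU UA unfolding g_def by simp
    then have hb: "hard_block (mu G) ?X (mu H) ?U g" using hard_blockI blk(3) by blast
    interpret D: hard_block "mu G" ?X "mu H" ?U g by (rule hb)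
    have "trichotomy ?U g" by (rule hard_block_trichotomy[OF hb])
    then consider (full) "all_full ?U g" | (complete) "\<not> all_full ?U g" "complete_on ?U"
      | (cycle) "\<not> all_full ?U g" "two_nbrs ?U"
      unfolding trichotomy_def by blast
    then show ?thesis
    proof cases
      case complete
      obtain \<tau> where \<tau>: "\<And>p q. p \<in> ?U \<Longrightarrow> q \<in> ?U \<Longrightarrow> p \<noteq> q \<Longrightarrow> mu G p q = \<tau>"
        using D.uniform_complete[OF complete(2,1)] by blast
      obtain w where w: "w \<in> ?U" "w \<noteq> v0" "0 < mu G v0 w" using conn_nbr[OF mu conU v0 big] by blast
      have "1 \<le> \<tau>" using \<tau>[OF v0 w(1)] w by simp
      moreover have "mu B u v = \<tau>" if "u \<in> ?U" "v \<in> ?U" "u \<noteq> v" for u v using \<tau>[OF that] muB that by simp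
      ultimately have "brick B" using brick_complete[OF mB] v0 by blast
      then show ?thesis ..
    next
      case cycle
      obtain \<tau> where \<tau>: "\<And>p q. p \<in> ?U \<Longrightarrow> q \<in> ?U \<Longrightarrow> 0 < mu G p q \<Longrightarrow> mu G p q = \<tau>"
        using D.uniform_cycle[OF cycle(2,1)] by blast
      obtain w where w: "w \<in> ?U" "w \<noteq> v0" "0 < mu G v0 w" using conn_nbr[OF mu conU v0 big] by blast
      have "1 \<le> \<tau>" using \<tau>[OF v0 w(1,3)] w by simp
      moreover have "mu B u v = \<tau>" if "0 < mu B u v" for u v
        using \<tau>[of u v] that muB[of u v] by (auto split: if_splits)
      moreover have "conn (mu B) ?U" using conU conn_cong[of ?U "mu B" "mu G"] muB by simp
      moreover have "card (nbrs (mu B) ?U v) = 2" if "v \<in> ?U" for v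
      proof -
        have "nbrs (mu B) ?U v = nbrs (mu G) ?U v" using muB that unfolding nbrs_def by auto
        then show ?thesis using cycle(2) that unfolding two_nbrs_def by simp
      qed
      ultimately have "brick B" using brick_cycle[OF mB] by blast
      then show ?thesis ..
    next
      case full
      have "\<forall>u. \<exists>x. u \<in> ?U \<longrightarrow> x \<in> pos g u" using D.pos_nonempty big by blast
      then obtain t where t: "\<And>u. u \<in> ?U \<Longrightarrow> t u \<in> pos g u" by metis
      define B' where "B' = \<lparr>verts = ?U, mu = (\<lambda>u v. if u \<in> ?U \<and> v \<in> ?U then mu H (t u) (t v) else 0)\<rparr>"
      define k where "k = card (pos g v0)"
      have mB': "multigraph B'"
        unfolding multigraph_def B'_def using D.finU m_sym by auto
      have k1: "1 \<le> k" using D.pos_nonempty[OF v0 big] unfolding k_def by (simp add: Suc_leI card_gt_0_iff)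
      have BB': "B = multiple k B'"
      proof (rule mgraph.equality)
        show "mu B = mu (multiple k B')"
        proof (intro ext)
          fix u v
          show "mu B u v = mu (multiple k B') u v"
          proof (cases "u \<in> ?U \<and> v \<in> ?U \<and> u \<noteq> v")
            case True
            have "mu G u v = card (pos g v) * mu H (t u) (t v)"
              using D.all_full_uniform[OF full t] True by blast
            then show ?thesis
              using True muB D.card_pos_eq[of v v0] v0 unfolding k_def B'_def multiple_def by simp
          next
            case False
            then show ?thesis using muB[of u v] unfolding B'_def multiple_def by auto
          qed
        qed
      qed (auto simp: multiple_def B'_def)
      have deg: "(\<Sum>w\<in>?U. mu B' u w) = g (t u)" if u: "u \<in> ?U" for u
      proof -
        have "(\<Sum>w\<in>?U. mu B' u w) = edges_to (t u) t ?U"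
          using u unfolding B'_def edges_to_def by simp
        then show ?thesis using bad_degree[OF D.hard D.all_full_bad[OF full t u]] by simp
      qed
      have vdeg: "vdegree B' u = g (t u)" if "u \<in> ?U" for u
        using vdegree_eq_sum[OF mB', of u] deg[OF that] unfolding B'_def by simp
      have "(in_class B' (CR P) \<and> regular_graph r B') \<or> (in_class B' P \<and> max_degree B' \<le> r)"
      proof (cases "in_class B' P")
        case True
        have "max_degree B' \<le> r"
          unfolding max_degree_def using v0 D.finU vdeg g_le
          by (intro Max.boundedI) (auto simp: B'_def)
        then show ?thesis using True by blast
      next
        case False
        have vB': "verts B' = ?U" unfolding B'_def by simp
        obtain S where S: "S \<subseteq> ?U" "S \<noteq> {}" "\<And>v. v \<in> S \<Longrightarrow> r \<le> (\<Sum>w\<in>S. mu B' v w)"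
          "S = ?U \<Longrightarrow> in_class B' (CR P)"
          using not_in_class_dense[OF assms(1,2) mB' False] unfolding vB' by metis
        \<comment> \<open>Degrees in \<open>B'\<close> are reduced weights and hence at most
          \<open>r\<close>, while \<open>S\<close> alone already provides \<open>r\<close>. So no
          edge leaves \<open>S\<close>, and connectedness gives \<open>S = ?U\<close>.\<close>
        have tight: "(\<Sum>w\<in>S. mu B' v w) = (\<Sum>w\<in>?U. mu B' v w) \<and> (\<Sum>w\<in>?U. mu B' v w) = r"
          if v: "v \<in> S" for v
        proof -
          have "(\<Sum>w\<in>S. mu B' v w) \<le> (\<Sum>w\<in>?U. mu B' v w)" using S(1) D.finU by (intro sum_mono2) auto
          then show ?thesis using S(3)[OF v] deg[of v] g_le[of "t v"] S(1) v by force
        qed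
        have "conn (mu B') ?U"
        proof -
          have "conn (\<lambda>a b. mu H (t a) (t b)) ?U"
            by (rule D.conn_colours_mono[OF conU]) (use full t in \<open>auto simp: all_full_def full_def\<close>)
          moreover have "conn (mu B') ?U = conn (\<lambda>a b. mu H (t a) (t b)) ?U"
            by (rule conn_cong) (simp add: B'_def)
          ultimately show ?thesis by simp
        qed
        then have SU: "S = ?U"
        proof (rule conn_closed[OF _ S(1,2)])
          fix u w assume u: "u \<in> S" and w: "w \<in> ?U" "0 < mu B' u w"
          show "w \<in> S"
          proof (rule ccontr)
            assume "w \<notin> S"
            then have "(\<Sum>w\<in>insert w S. mu B' u w) \<le> (\<Sum>w\<in>?U. mu B' u w)"
              using S(1) w D.finU by (intro sum_mono2) auto
            moreover have "finite S" using S(1) D.finU finite_subset by blast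
            ultimately show False using tight[OF u] w \<open>w \<notin> S\<close> by simp
          qed
        qed
        have "vdegree B' u = r" if "u \<in> ?U" for u
          using vdeg[OF that] tight[of u] deg[OF that] SU that by simp
        then have "regular_graph r B'" unfolding regular_graph_def vB' by blast
        then show ?thesis using S(4)[OF SU] by blast
      qed
      then show ?thesis using k1 mB' BB' by blast
    qed
  qed
qed

end
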